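(* Consider any cell-probe data structure for the partial-sums problem on an array of $n$ integers, with cell size $b$ bits and update arguments of $\delta$ bits, using amortization and Las Vegas randomization. Let $t_u$, $t_q$, $t_s$ be the (amortized expected) running times of \texttt{update}, \texttt{sum} and \texttt{select}. Then $$t_q\left(\lg\frac{b}{\delta}+\lg\frac{t_u}{t_q}\right)=\Omega(\lg n)\quad\text{and}\quad t_s\left(\lg\frac{b}{\delta}+\lg\frac{t_u}{t_s}\right)=\Omega(\lg n).$$
   Context: Throughout, $\lg x$ denotes $\log_2(2+x)$. The partial-sums problem asks to maintain an array $A[1..n]$ of integers under: $\texttt{update}(k,\Delta)$, which sets $A[k]\gets\Delta$; $\texttt{sum}(k)$, which returns $\sum_{i=1}^k A[i]$; $\texttt{select}(\sigma)$, which returns the index $i$ with $\texttt{sum}(i-1)<\sigma\le\texttt{sum}(i)$ (for \texttt{select} it is required that $A[i]>0$ for all $i$). Every array element and every partial sum fits in a cell; $b=\Omega(\lg n)$; $\delta\le b$ is the number of bits needed to represent an argument $\Delta$ of \texttt{update}. Cell-probe model: memory consists of at most $2^b$ cells of $b$ bits; an operation reads and writes cells, computation is free, no state is retained between operations, and the cost of an operation is the number of cells read or written. Las Vegas randomization: some cells are initialized to uniformly random values at creation, afterwards everything is deterministic and always correct; running times are expected and may be amortized. *)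

theory Defs
  imports "HOL-Probability.Probability"
begin

definition lg :: "real \<Rightarrow> real" where
  "lg x = log 2 (2 + x)"


section \<open>The cell-probe model\<close>

type_synonym memory = "nat \<Rightarrow> nat"

text \<open>
  One execution of an operation: a finite-depth adaptive sequence of probes. Computation between
  probes is arbitrary (the continuation of a read is any function of the value read) and free.
\<close>

datatype cp_program =
    Return int
  | Read nat "nat \<Rightarrow> cp_program"
  | Write nat nat cp_program

primrec run :: "cp_program \<Rightarrow> memory \<Rightarrow> int \<times> memory" where
  "run (Return r) m = (r, m)"
| "run (Read a f) m = run (f (m a)) m"
| "run (Write a v p) m = run p (m(a := v))"

primrec probes :: "cp_program \<Rightarrow> memory \<Rightarrow> nat" where
  "probes (Return r) m = 0"
| "probes (Read a f) m = Suc (probes (f (m a)) m)"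
| "probes (Write a v p) m = Suc (probes p (m(a := v)))"

text \<open>There are \<open>2 ^ b\<close> cells, and each of them holds a value below \<open>2 ^ b\<close>.\<close>

primrec wf_program :: "nat \<Rightarrow> cp_program \<Rightarrow> bool" where
  "wf_program b (Return r) \<longleftrightarrow> True"
| "wf_program b (Read a f) \<longleftrightarrow> a < 2 ^ b \<and> (\<forall>v < 2 ^ b. wf_program b (f v))"
| "wf_program b (Write a v p) \<longleftrightarrow> a < 2 ^ b \<and> v < 2 ^ b \<and> wf_program b p"


section \<open>Operations of the partial-sums problem\<close>

datatype ps_op = Update nat int | Sum nat | Select int

datatype ps_query = SumQuery | SelectQuery

text \<open>
  Three readings of ``an integer of \<open>w\<close> bits''. With \<open>Positive\<close>, the format required by
  \<open>Select\<close>, the \<open>2 ^ w\<close> words denote the first \<open>2 ^ w\<close> positive integers; excluding zero from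
  the unsigned format instead would leave one-bit arguments with the single value 1.
\<close>

datatype int_format = Unsigned | Signed | Positive

fun ints_of_width :: "int_format \<Rightarrow> nat \<Rightarrow> int set" where
  "ints_of_width Unsigned w = {0 ..< 2 ^ w}"
| "ints_of_width Signed w = {- (2 ^ (w - 1)) ..< 2 ^ (w - 1)}"
| "ints_of_width Positive w = {1 .. 2 ^ w}"

text \<open>An array \<open>A[1..n]\<close> is a function of which only the values on \<open>{1..n}\<close> matter.\<close>

definition psum :: "(nat \<Rightarrow> int) \<Rightarrow> nat \<Rightarrow> int" where
  "psum A k = (\<Sum>i = 1..k. A i)"

definition fits_in_cells :: "nat \<Rightarrow> nat \<Rightarrow> int_format \<Rightarrow> (nat \<Rightarrow> int) \<Rightarrow> bool" where
  "fits_in_cells n b fmt A \<longleftrightarrow>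
     (\<forall>k \<in> {1..n}. A k \<in> ints_of_width fmt b \<and> psum A k \<in> ints_of_width fmt b)"

fun apply_op :: "ps_op \<Rightarrow> (nat \<Rightarrow> int) \<Rightarrow> (nat \<Rightarrow> int)" where
  "apply_op (Update k \<Delta>) A = A(k := \<Delta>)"
| "apply_op (Sum k) A = A"
| "apply_op (Select \<sigma>) A = A"

fun legal_op ::
  "nat \<Rightarrow> nat \<Rightarrow> nat \<Rightarrow> int_format \<Rightarrow> ps_query set \<Rightarrow> (nat \<Rightarrow> int) \<Rightarrow> ps_op \<Rightarrow> bool" where
  "legal_op n b \<delta> fmt Q A (Update k \<Delta>) \<longleftrightarrow>
     k \<in> {1..n} \<and> \<Delta> \<in> ints_of_width fmt \<delta> \<and> fits_in_cells n b fmt (A(k := \<Delta>))"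
| "legal_op n b \<delta> fmt Q A (Sum k) \<longleftrightarrow> SumQuery \<in> Q \<and> k \<in> {1..n}"
| "legal_op n b \<delta> fmt Q A (Select \<sigma>) \<longleftrightarrow> SelectQuery \<in> Q \<and> 0 < \<sigma> \<and> \<sigma> \<le> psum A n"

primrec legal_ops ::
  "nat \<Rightarrow> nat \<Rightarrow> nat \<Rightarrow> int_format \<Rightarrow> ps_query set \<Rightarrow> (nat \<Rightarrow> int) \<Rightarrow> ps_op list \<Rightarrow> bool" where
  "legal_ops n b \<delta> fmt Q A [] \<longleftrightarrow> True"
| "legal_ops n b \<delta> fmt Q A (x # xs) \<longleftrightarrow>
     legal_op n b \<delta> fmt Q A x \<and> legal_ops n b \<delta> fmt Q (apply_op x A) xs"

fun correct_answer :: "nat \<Rightarrow> (nat \<Rightarrow> int) \<Rightarrow> ps_op \<Rightarrow> int \<Rightarrow> bool" where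
  "correct_answer n A (Update k \<Delta>) r \<longleftrightarrow> True"
| "correct_answer n A (Sum k) r \<longleftrightarrow> r = psum A k"
| "correct_answer n A (Select \<sigma>) r \<longleftrightarrow>
     (\<exists>i \<in> {1..n}. r = int i \<and> psum A (i - 1) < \<sigma> \<and> \<sigma> \<le> psum A i)"


section \<open>Las Vegas data structures\<close>

text \<open>
  At creation the cells in \<open>random_cells\<close> receive independent uniform values and every other cell
  receives its value in \<open>initial_memory\<close>. A program depends only on the operation being executed,
  so the memory is all that is carried from one operation to the next.
\<close>

record cp_structure =
  random_cells :: "nat set"
  initial_memory :: memory
  program :: "ps_op \<Rightarrow> cp_program"

definition wf_structure :: "nat \<Rightarrow> cp_structure \<Rightarrow> bool" where
  "wf_structure b D \<longleftrightarrow>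
     random_cells D \<subseteq> {..<2 ^ b} \<and> (\<forall>a < 2 ^ b. initial_memory D a < 2 ^ b) \<and>
     (\<forall>x. wf_program b (program D x))"

definition initial_memories :: "nat \<Rightarrow> cp_structure \<Rightarrow> memory set" where
  "initial_memories b D =
     {m. (\<forall>a \<in> random_cells D. m a < 2 ^ b) \<and>
         (\<forall>a. a \<notin> random_cells D \<longrightarrow> m a = initial_memory D a)}"

lemma initial_memories_nonempty: "initial_memories b D \<noteq> {}"
proof -
  have "(\<lambda>a. if a \<in> random_cells D then 0 else initial_memory D a) \<in> initial_memories b D"
    by (simp add: initial_memories_def)
  then show ?thesis by blast
qed

lemma finite_initial_memories:
  assumes "wf_structure b D"
  shows "finite (initial_memories b D)"
proof -
  let ?R = "random_cells D"
  have "finite ?R"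
    using assms unfolding wf_structure_def by (meson finite_lessThan finite_subset)
  then have "finite (PiE ?R (\<lambda>_. {..<2 ^ b :: nat}))"
    by (intro finite_PiE) auto
  moreover have "initial_memories b D \<subseteq>
      (\<lambda>f a. if a \<in> ?R then f a else initial_memory D a) ` PiE ?R (\<lambda>_. {..<2 ^ b})"
  proof
    fix m assume m: "m \<in> initial_memories b D"
    then have "m = (\<lambda>a. if a \<in> ?R then restrict m ?R a else initial_memory D a)"
      by (auto simp: initial_memories_def fun_eq_iff)
    moreover have "restrict m ?R \<in> PiE ?R (\<lambda>_. {..<2 ^ b})"
      using m by (auto simp: initial_memories_def)
    ultimately show "m \<in> (\<lambda>f a. if a \<in> ?R then f a else initial_memory D a) `
        PiE ?R (\<lambda>_. {..<2 ^ b})"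
      by blast
  qed
  ultimately show ?thesis by (meson finite_imageI finite_subset)
qed

definition creation_pmf :: "nat \<Rightarrow> cp_structure \<Rightarrow> memory pmf" where
  "creation_pmf b D = pmf_of_set (initial_memories b D)"

primrec all_correct ::
  "nat \<Rightarrow> cp_structure \<Rightarrow> (nat \<Rightarrow> int) \<Rightarrow> ps_op list \<Rightarrow> memory \<Rightarrow> bool" where
  "all_correct n D A [] m \<longleftrightarrow> True"
| "all_correct n D A (x # xs) m \<longleftrightarrow>
     correct_answer n A x (fst (run (program D x) m)) \<and>
     all_correct n D (apply_op x A) xs (snd (run (program D x) m))"

primrec total_probes :: "cp_structure \<Rightarrow> ps_op list \<Rightarrow> memory \<Rightarrow> nat" where
  "total_probes D [] m = 0"
| "total_probes D (x # xs) m =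
     probes (program D x) m + total_probes D xs (snd (run (program D x) m))"

text \<open>
  \<open>A0\<close> is the array represented at creation and \<open>Q\<close> the set of queries supported next to
  \<open>Update\<close>; the full problem is \<open>Q = {SumQuery, SelectQuery}\<close>.
\<close>

definition partial_sums_structure ::
  "nat \<Rightarrow> nat \<Rightarrow> nat \<Rightarrow> int_format \<Rightarrow> ps_query set \<Rightarrow> (nat \<Rightarrow> int) \<Rightarrow> cp_structure \<Rightarrow> bool" where
  "partial_sums_structure n b \<delta> fmt Q A0 D \<longleftrightarrow>
     wf_structure b D \<and> fits_in_cells n b fmt A0 \<and>
     (\<forall>xs. legal_ops n b \<delta> fmt Q A0 xs \<longrightarrow>
        (\<forall>m \<in> initial_memories b D. all_correct n D A0 xs m))"

definition num_updates :: "ps_op list \<Rightarrow> nat" where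
  "num_updates xs = length (filter (\<lambda>x. \<exists>k \<Delta>. x = Update k \<Delta>) xs)"

definition num_sums :: "ps_op list \<Rightarrow> nat" where
  "num_sums xs = length (filter (\<lambda>x. \<exists>k. x = Sum k) xs)"

definition num_selects :: "ps_op list \<Rightarrow> nat" where
  "num_selects xs = length (filter (\<lambda>x. \<exists>\<sigma>. x = Select \<sigma>) xs)"

definition amortized_expected_times ::
  "nat \<Rightarrow> nat \<Rightarrow> nat \<Rightarrow> int_format \<Rightarrow> ps_query set \<Rightarrow> (nat \<Rightarrow> int) \<Rightarrow> cp_structure \<Rightarrow>
   real \<Rightarrow> real \<Rightarrow> real \<Rightarrow> bool" where
  "amortized_expected_times n b \<delta> fmt Q A0 D t_u t_q t_s \<longleftrightarrow>
     (\<forall>xs. legal_ops n b \<delta> fmt Q A0 xs \<longrightarrow>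
        measure_pmf.expectation (creation_pmf b D) (\<lambda>m. real (total_probes D xs m))
          \<le> real (num_updates xs) * t_u + real (num_sums xs) * t_q + real (num_selects xs) * t_s)"

text \<open>
  \<open>K\<close> is the constant of \<open>b = \<Omega>(lg n)\<close>. For positive arrays, \<open>2 * n \<le> 2 ^ b\<close> says that all sums
  fit in a cell already when the elements are arbitrary one-bit values 1 and 2. It cannot be
  dropped: if \<open>2 ^ b = n + 1\<close>, say, fitting sums allow at most one element to differ from 1, and
  all operations take constant time.
\<close>

definition admissible ::
  "real \<Rightarrow> nat \<Rightarrow> nat \<Rightarrow> nat \<Rightarrow> int_format \<Rightarrow> ps_query set \<Rightarrow> bool" where
  "admissible K n b \<delta> fmt Q \<longleftrightarrow>
     1 \<le> \<delta> \<and> \<delta> \<le> b \<and> K * lg (real n) \<le> real b \<and>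
     (SelectQuery \<in> Q \<longrightarrow> fmt = Positive) \<and>
     (fmt = Positive \<longrightarrow> 2 * n \<le> 2 ^ b)"

end

theory Submission
  imports Defs
begin

text \<open>
  The chronogram method, with the information transfer counted level by level. Rounds of one random
  update and \<open>r \<approx> t_u / t_q\<close> random queries are grouped into a tree of degree \<open>\<beta> = 2 ^ w\<close>, where
  \<open>\<beta>\<close> is about \<open>(b / \<delta>) (t_u / t_q)\<close>, and the updates follow the bit-reversal permutation, so that
  the updates of every tree node are spread evenly over the array. For a query and a level \<open>i\<close>, let
  the epoch consist of the earlier siblings of the level-\<open>i\<close> node of the query. If the query seldom
  reads a cell last written in the epoch, and if few such cells are read in the node before it, then
  the updates of the epoch can be encoded too cheaply: the decoder replays the node from the
  transferred cells and recovers the updates one by one by binary search on the partial sums, where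
  each comparison is a possible query of the node, and the few comparisons that would read the epoch
  are given explicitly. A read is counted at one level only, so that summing over all levels bounds
  the cost of a query from below by the depth of the tree.

  The binary search of \<open>select\<close> depends on the values to be recovered, hence its queries cannot be
  fixed in advance. They can be included in the encoding, though: there are few of them in the node,
  compared with the updates of the epoch.
\<close>

section \<open>Reads with time stamps\<close>

text \<open>The size of \<beta> comes from comparing bits. Replaying an operation and describing a
  transferred cell cost O(\<open>b\<close>) bits each, while an update carries \<open>a\<close>
  bits, with \<open>a\<close> of order \<delta>. A node has \<open>r + 1\<close> operations per
  round, and its epoch fewer than \<open>2 ^ w\<close> times as many rounds. The updates outweigh
  the replay once \<open>2 ^ w\<close> exceeds a constant times \<open>(b / a) * (r + 1)\<close>,
  and \<open>w\<close> is what divides \<open>lg n\<close> in the depth. The delicate point is not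
  to lose a factor of \<open>a\<close> on the queries. An item of \<open>a\<close> bits can be
  recovered through any of \<open>a + 1\<close> dyadic levels; a bad level is therefore charged O(1)
  bits, a single parity, and the query is uniform over items, levels and sides. Then a constant
  fraction of the comparisons must be bad, which forces a constant expected transfer per level.
  Amortization is used once, to find an array and a memory from which the average block is cheap.
  From there on the memory is fixed, and all averages are finite sums over item values and query
  choices. No decoder is built: two inputs with equal codes would make one query return equal
  results where different answers are correct.\<close>

primrec stamped_reads ::
  "cp_program \<Rightarrow> nat \<Rightarrow> memory \<Rightarrow> (nat \<Rightarrow> nat) \<Rightarrow> (nat \<times> nat) set" where
  "stamped_reads (Return r) t m \<tau> = {}"
| "stamped_reads (Read a f) t m \<tau> = insert (a, \<tau> a) (stamped_reads (f (m a)) t m \<tau>)"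
| "stamped_reads (Write a v p) t m \<tau> = stamped_reads p t (m(a := v)) (\<tau>(a := t))"

primrec stamps_after ::
  "cp_program \<Rightarrow> nat \<Rightarrow> memory \<Rightarrow> (nat \<Rightarrow> nat) \<Rightarrow> nat \<Rightarrow> nat" where
  "stamps_after (Return r) t m \<tau> = \<tau>"
| "stamps_after (Read a f) t m \<tau> = stamps_after (f (m a)) t m \<tau>"
| "stamps_after (Write a v p) t m \<tau> = stamps_after p t (m(a := v)) (\<tau>(a := t))"

lemma finite_stamped_reads [simp]: "finite (stamped_reads p t m \<tau>)"
  by (induction p arbitrary: m \<tau>) auto

lemma card_stamped_reads_le: "card (stamped_reads p t m \<tau>) \<le> probes p m"
proof (induction p arbitrary: m \<tau>)
  case (Read a f)
  have "card (stamped_reads (f (m a)) t m \<tau>) \<le> probes (f (m a)) m"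
    using Read by blast
  then show ?case
    by (simp add: card_insert_if)
next
  case (Write a v p)
  then show ?case
    by (simp add: le_Suc_eq)
qed auto

lemma stamps_after_cases:
  "stamps_after p t m \<tau> a = t \<or>
   (stamps_after p t m \<tau> a = \<tau> a \<and> snd (run p m) a = m a)"
proof (induction p arbitrary: m \<tau>)
  case (Write c v p)
  show ?case
    using Write[of "m(c := v)" "\<tau>(c := t)"] by (auto simp: fun_upd_def split: if_splits)
qed auto

definition valid_memory :: "nat \<Rightarrow> memory \<Rightarrow> bool" where
  "valid_memory b m \<longleftrightarrow> (\<forall>a < 2 ^ b. m a < 2 ^ b)"

lemma valid_memory_run:
  "wf_program b p \<Longrightarrow> valid_memory b m \<Longrightarrow> valid_memory b (snd (run p m))"
  by (induction p arbitrary: m) (auto simp: valid_memory_def)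

lemma stamped_reads_address:
  "wf_program b p \<Longrightarrow> valid_memory b m \<Longrightarrow> (a, s) \<in> stamped_reads p t m \<tau> \<Longrightarrow> a < 2 ^ b"
proof (induction p arbitrary: m \<tau>)
  case (Write c v p)
  have "valid_memory b (m(c := v))"
    using Write.prems by (auto simp: valid_memory_def)
  with Write show ?case
    by simp
next
  case (Read c f)
  then have "wf_program b (f (m c))"
    by (auto simp: valid_memory_def)
  with Read.IH[of "f (m c)" m \<tau>] Read.prems show ?case
    by auto
qed auto

text \<open>\<open>m\<close> is the true memory and \<open>m'\<close> a reconstruction, which may be
  wrong on cells stamped in \<open>E\<close> outside \<open>R\<close>; the program reads no such
  cell. Both runs write the same values, so a written cell agrees afterwards whether or not its new
  stamp \<open>t\<close> lies in \<open>E\<close>.\<close>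

lemma run_agree:
  assumes "\<And>a. \<tau> a \<notin> E \<or> a \<in> R \<Longrightarrow> m a = m' a"
    and "\<And>a s. (a, s) \<in> stamped_reads p t m \<tau> \<Longrightarrow> s \<in> E \<Longrightarrow> a \<in> R"
  shows "fst (run p m') = fst (run p m) \<and>
    (\<forall>a. stamps_after p t m \<tau> a \<notin> E \<or> a \<in> R \<longrightarrow> snd (run p m) a = snd (run p m') a)"
  using assms
proof (induction p arbitrary: m m' \<tau>)
  case (Return r)
  then show ?case by auto
next
  case (Read c f)
  have "m c = m' c"
    using Read.prems(1)[of c] Read.prems(2)[of c "\<tau> c"] by auto
  moreover have "fst (run (f (m c)) m') = fst (run (f (m c)) m) \<and>
      (\<forall>a. stamps_after (f (m c)) t m \<tau> a \<notin> E \<or> a \<in> R \<longrightarrow>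
         snd (run (f (m c)) m) a = snd (run (f (m c)) m') a)"
  proof (rule Read.IH)
    show "m a = m' a" if "\<tau> a \<notin> E \<or> a \<in> R" for a
      using Read.prems(1) that .
    show "a \<in> R" if "(a, s) \<in> stamped_reads (f (m c)) t m \<tau>" "s \<in> E" for a s
      by (rule Read.prems(2)[OF _ that(2)]) (simp add: that(1))
  qed simp
  ultimately show ?case by simp
next
  case (Write c v p)
  have "fst (run p (m'(c := v))) = fst (run p (m(c := v))) \<and>
      (\<forall>a. stamps_after p t (m(c := v)) (\<tau>(c := t)) a \<notin> E \<or> a \<in> R \<longrightarrow>
         snd (run p (m(c := v))) a = snd (run p (m'(c := v))) a)"
  proof (rule Write.IH)
    show "(m(c := v)) a = (m'(c := v)) a" if "(\<tau>(c := t)) a \<notin> E \<or> a \<in> R" for a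
      using that Write.prems(1)[of a] by (cases "a = c") auto
    show "a \<in> R" if "(a, s) \<in> stamped_reads p t (m(c := v)) (\<tau>(c := t))" "s \<in> E" for a s
      by (rule Write.prems(2)[OF _ that(2)]) (use that(1) in \<open>simp only: stamped_reads.simps\<close>)
  qed
  then show ?case by simp
qed


section \<open>Sequences of operations\<close>

primrec mem_at :: "cp_structure \<Rightarrow> memory \<Rightarrow> (nat \<Rightarrow> ps_op) \<Rightarrow> nat \<Rightarrow> memory" where
  "mem_at D m f 0 = m"
| "mem_at D m f (Suc u) = snd (run (program D (f u)) (mem_at D m f u))"

text \<open>Operation \<open>u\<close> stamps the cells it writes with \<open>Suc u\<close>; stamp \<open>0\<close> marks untouched cells.\<close>

primrec stamp_at ::
  "cp_structure \<Rightarrow> memory \<Rightarrow> (nat \<Rightarrow> ps_op) \<Rightarrow> nat \<Rightarrow> nat \<Rightarrow> nat" where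
  "stamp_at D m f 0 = (\<lambda>_. 0)"
| "stamp_at D m f (Suc u) =
     stamps_after (program D (f u)) (Suc u) (mem_at D m f u) (stamp_at D m f u)"

definition op_reads ::
  "cp_structure \<Rightarrow> memory \<Rightarrow> (nat \<Rightarrow> ps_op) \<Rightarrow> nat \<Rightarrow> (nat \<times> nat) set" where
  "op_reads D m f u =
     stamped_reads (program D (f u)) (Suc u) (mem_at D m f u) (stamp_at D m f u)"

definition op_probes :: "cp_structure \<Rightarrow> memory \<Rightarrow> (nat \<Rightarrow> ps_op) \<Rightarrow> nat \<Rightarrow> nat" where
  "op_probes D m f u = probes (program D (f u)) (mem_at D m f u)"

definition op_result :: "cp_structure \<Rightarrow> memory \<Rightarrow> (nat \<Rightarrow> ps_op) \<Rightarrow> nat \<Rightarrow> int" where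
  "op_result D m f u = fst (run (program D (f u)) (mem_at D m f u))"

lemma finite_op_reads [simp]: "finite (op_reads D m f u)"
  by (simp add: op_reads_def)

lemma mem_at_cong:
  "(\<And>v. v < u \<Longrightarrow> f v = g v) \<Longrightarrow> mem_at D m f u = mem_at D m g u"
  by (induction u) auto

lemma stamp_at_cong:
  assumes "\<And>v. v < u \<Longrightarrow> f v = g v"
  shows "stamp_at D m f u = stamp_at D m g u"
  using assms
proof (induction u)
  case (Suc u)
  moreover from Suc have "mem_at D m f u = mem_at D m g u"
    by (intro mem_at_cong) auto
  ultimately show ?case by simp
qed simp

lemma op_reads_cong:
  assumes "\<And>v. v \<le> u \<Longrightarrow> f v = g v"
  shows "op_reads D m f u = op_reads D m g u"
  using assms mem_at_cong[of u f g D m] stamp_at_cong[of u f g D m]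
  by (simp add: op_reads_def)

lemma stamp_at_le: "stamp_at D m f u a \<le> u"
proof (induction u)
  case (Suc u)
  then show ?case
    using stamps_after_cases[of "program D (f u)" "Suc u" "mem_at D m f u" "stamp_at D m f u" a]
    by auto
qed simp

text \<open>Every write from \<open>u\<^sub>0\<close> on leaves a stamp above
  \<open>u\<^sub>0\<close>, so a smaller stamp certifies old contents.\<close>

lemma mem_at_unstamped:
  assumes "u\<^sub>0 \<le> u" "stamp_at D m f u a \<le> u\<^sub>0"
  shows "mem_at D m f u a = mem_at D m f u\<^sub>0 a"
  using assms
proof (induction u rule: dec_induct)
  case (step v)
  then show ?case
    using stamps_after_cases[of "program D (f v)" "Suc v" "mem_at D m f v" "stamp_at D m f v" a]
    by auto
qed simp

lemma valid_memory_mem_at: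
  assumes "wf_structure b D" "valid_memory b m"
  shows "valid_memory b (mem_at D m f u)"
  using assms by (induction u) (auto simp: wf_structure_def intro: valid_memory_run)

section \<open>Replaying a window of operations from its input cells\<close>

definition input_cells ::
  "cp_structure \<Rightarrow> memory \<Rightarrow> (nat \<Rightarrow> ps_op) \<Rightarrow> nat set \<Rightarrow> nat \<Rightarrow> nat \<Rightarrow> nat set" where
  "input_cells D m f E u\<^sub>1 u = {a. \<exists>v\<in>{u\<^sub>1..<u}. \<exists>s\<in>E. (a, s) \<in> op_reads D m f v}"

lemma mem_at_replay:
  assumes M: "\<And>a. stamp_at D m f u\<^sub>1 a \<notin> E \<or> a \<in> R \<Longrightarrow> mem_at D m f u\<^sub>1 a = M a"
    and R: "input_cells D m f E u\<^sub>1 (u\<^sub>1 + k) \<subseteq> R"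
  shows "stamp_at D m f (u\<^sub>1 + k) a \<notin> E \<or> a \<in> R \<Longrightarrow>
    mem_at D m f (u\<^sub>1 + k) a = mem_at D M (\<lambda>v. f (u\<^sub>1 + v)) k a"
  using R
proof (induction k arbitrary: a)
  case 0
  then show ?case using M by simp
next
  case (Suc k)
  have "input_cells D m f E u\<^sub>1 (u\<^sub>1 + k) \<subseteq> input_cells D m f E u\<^sub>1 (u\<^sub>1 + Suc k)"
    unfolding input_cells_def using add_Suc_right by fastforce
  then have R': "input_cells D m f E u\<^sub>1 (u\<^sub>1 + k) \<subseteq> R"
    using Suc.prems(2) by blast
  have "a \<in> R" if "(a, s) \<in> op_reads D m f (u\<^sub>1 + k)" "s \<in> E" for a s
    using Suc.prems(2) that unfolding input_cells_def by fastforce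
  then have "\<forall>a. stamp_at D m f (Suc (u\<^sub>1 + k)) a \<notin> E \<or> a \<in> R \<longrightarrow>
     snd (run (program D (f (u\<^sub>1 + k))) (mem_at D m f (u\<^sub>1 + k))) a =
     snd (run (program D (f (u\<^sub>1 + k))) (mem_at D M (\<lambda>v. f (u\<^sub>1 + v)) k)) a"
    using run_agree[of "stamp_at D m f (u\<^sub>1 + k)" E R "mem_at D m f (u\<^sub>1 + k)"
        "mem_at D M (\<lambda>v. f (u\<^sub>1 + v)) k" "program D (f (u\<^sub>1 + k))" "Suc (u\<^sub>1 + k)"] Suc.IH R'
    by (simp add: op_reads_def)
  then show ?case
    using Suc.prems(1) by simp
qed

lemma op_result_replay:
  assumes "\<And>a. stamp_at D m f u\<^sub>1 a \<notin> E \<or> a \<in> R \<Longrightarrow> mem_at D m f u\<^sub>1 a = M a"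
    and "input_cells D m f E u\<^sub>1 (u\<^sub>1 + k) \<subseteq> R"
    and "\<And>a s. (a, s) \<in> op_reads D m f (u\<^sub>1 + k) \<Longrightarrow> s \<notin> E"
  shows "op_result D m f (u\<^sub>1 + k) =
    fst (run (program D (f (u\<^sub>1 + k))) (mem_at D M (\<lambda>v. f (u\<^sub>1 + v)) k))"
proof -
  have "fst (run (program D (f (u\<^sub>1 + k))) (mem_at D M (\<lambda>v. f (u\<^sub>1 + v)) k)) =
      fst (run (program D (f (u\<^sub>1 + k))) (mem_at D m f (u\<^sub>1 + k)))"
  proof (rule conjunct1[OF run_agree])
    show "mem_at D m f (u\<^sub>1 + k) a = mem_at D M (\<lambda>v. f (u\<^sub>1 + v)) k a"
      if "stamp_at D m f (u\<^sub>1 + k) a \<notin> E \<or> a \<in> R" for a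
      by (rule mem_at_replay[OF assms(1,2) that])
    show "a \<in> R"
      if "(a, s) \<in> stamped_reads (program D (f (u\<^sub>1 + k))) (Suc (u\<^sub>1 + k)) (mem_at D m f (u\<^sub>1 + k))
        (stamp_at D m f (u\<^sub>1 + k))" "s \<in> E" for a s
      using assms(3) that by (auto simp: op_reads_def)
  qed
  then show ?thesis
    by (simp add: op_result_def)
qed

text \<open>Both runs replay the same memory \<open>M\<close>, which has the contents at
  \<open>u\<^sub>1\<close> on \<open>R\<close> and those at \<open>u\<^sub>0\<close> elsewhere: a
  cell without a stamp from the gap has kept its contents, and up to \<open>u\<^sub>0\<close> the
  histories coincide. Within the gap \<open>f\<close> and \<open>g\<close> may differ arbitrarily.
  Agreement after the gap is asked of the operations themselves, because those of
  \<open>Select\<close> depend on the array.\<close>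

lemma op_result_eqI:
  assumes le: "u\<^sub>0 \<le> u\<^sub>1" "u\<^sub>1 \<le> u"
    and before: "\<And>v. v < u\<^sub>0 \<Longrightarrow> f v = g v"
    and after: "\<And>v. u\<^sub>1 \<le> v \<Longrightarrow> v \<le> u \<Longrightarrow> f v = g v"
    and R: "input_cells D m f {u\<^sub>0<..u\<^sub>1} u\<^sub>1 u = R" "input_cells D m g {u\<^sub>0<..u\<^sub>1} u\<^sub>1 u = R"
    and vals: "\<And>a. a \<in> R \<Longrightarrow> mem_at D m f u\<^sub>1 a = mem_at D m g u\<^sub>1 a"
    and unread: "\<And>a s. (a, s) \<in> op_reads D m f u \<Longrightarrow> s \<notin> {u\<^sub>0<..u\<^sub>1}"
      "\<And>a s. (a, s) \<in> op_reads D m g u \<Longrightarrow> s \<notin> {u\<^sub>0<..u\<^sub>1}"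
  shows "op_result D m f u = op_result D m g u"
proof -
  define M where "M = (\<lambda>a. if a \<in> R then mem_at D m f u\<^sub>1 a else mem_at D m f u\<^sub>0 a)"
  define k where "k = u - u\<^sub>1"
  have u: "u = u\<^sub>1 + k"
    using le by (simp add: k_def)
  have mem0: "mem_at D m f u\<^sub>0 = mem_at D m g u\<^sub>0"
    by (intro mem_at_cong before)
  have Mf: "mem_at D m f u\<^sub>1 a = M a" if "stamp_at D m f u\<^sub>1 a \<notin> {u\<^sub>0<..u\<^sub>1} \<or> a \<in> R" for a
    using that mem_at_unstamped[OF le(1), of D m f a] stamp_at_le[of D m f u\<^sub>1 a]
    by (auto simp: M_def)
  have Mg: "mem_at D m g u\<^sub>1 a = M a" if "stamp_at D m g u\<^sub>1 a \<notin> {u\<^sub>0<..u\<^sub>1} \<or> a \<in> R" for a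
    using that mem_at_unstamped[OF le(1), of D m g a] stamp_at_le[of D m g u\<^sub>1 a] vals[of a] mem0
    by (auto simp: M_def)
  have "op_result D m f u = fst (run (program D (f u)) (mem_at D M (\<lambda>v. f (u\<^sub>1 + v)) k))"
    using op_result_replay[of D m f u\<^sub>1 "{u\<^sub>0<..u\<^sub>1}" R M k, OF Mf] R unread
    by (simp add: u)
  moreover have "op_result D m g u = fst (run (program D (g u)) (mem_at D M (\<lambda>v. g (u\<^sub>1 + v)) k))"
    using op_result_replay[of D m g u\<^sub>1 "{u\<^sub>0<..u\<^sub>1}" R M k, OF Mg] R unread
    by (simp add: u)
  moreover have "mem_at D M (\<lambda>v. f (u\<^sub>1 + v)) k = mem_at D M (\<lambda>v. g (u\<^sub>1 + v)) k"
    by (intro mem_at_cong after) (auto simp: u)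
  ultimately show ?thesis
    using after[of u] le by simp
qed


section \<open>Counting\<close>

text \<open>Kraft and Gibbs in one: \<open>- ln (w c)\<close> is the length of the codeword
  \<open>c\<close> in nats, \<open>Z\<close> bounds the Kraft sum, and the mean length under an
  injective code is at least \<open>ln (card X) - ln Z\<close>. It follows by summing
  \<open>ln y \<le> y - 1\<close> at \<open>y = w (f x) * card X / Z\<close>. Weights spare the
  construction of a prefix-free code.\<close>

lemma sum_neg_ln_weights_ge:
  fixes w :: "'c \<Rightarrow> real"
  assumes X: "finite X" "X \<noteq> {}" and f: "inj_on f X" "f ` X \<subseteq> C" and C: "finite C"
    and pos: "\<And>c. c \<in> C \<Longrightarrow> 0 < w c" and Z: "sum w C \<le> Z"
  shows "(\<Sum>x\<in>X. - ln (w (f x))) \<ge> card X * (ln (card X) - ln Z)"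
proof -
  have card: "0 < real (card X)"
    using X by (simp add: card_gt_0_iff)
  have sum: "(\<Sum>x\<in>X. w (f x)) \<le> Z"
  proof -
    have "(\<Sum>x\<in>X. w (f x)) = sum w (f ` X)"
      using f(1) by (simp add: sum.reindex)
    also have "\<dots> \<le> sum w C"
      using f(2) C pos by (intro sum_mono2) (auto intro: less_imp_le)
    finally show ?thesis using Z by simp
  qed
  have posX: "0 < w (f x)" if "x \<in> X" for x
    using that f(2) pos by blast
  have "0 < (\<Sum>x\<in>X. w (f x))"
    using X posX by (intro sum_pos) auto
  with sum have Zpos: "0 < Z" by linarith
  have "ln (w (f x)) + ln (card X) - ln Z \<le> w (f x) * card X / Z - 1" if "x \<in> X" for x
  proof -
    have "ln (w (f x)) + ln (card X) - ln Z = ln (w (f x) * card X / Z)"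
      using posX[OF that] card Zpos by (simp add: ln_mult ln_div)
    also have "\<dots> \<le> w (f x) * card X / Z - 1"
      using posX[OF that] card Zpos by (intro ln_le_minus_one) simp
    finally show ?thesis .
  qed
  then have "(\<Sum>x\<in>X. ln (w (f x)) + ln (card X) - ln Z) \<le> (\<Sum>x\<in>X. w (f x) * card X / Z - 1)"
    by (rule sum_mono)
  also have "\<dots> = (\<Sum>x\<in>X. w (f x)) * (card X / Z) - card X"
    by (simp add: sum_subtractf sum_distrib_right sum_divide_distrib)
  also have "\<dots> \<le> Z * (card X / Z) - card X"
    using sum card Zpos by (intro diff_right_mono mult_right_mono) auto
  also have "\<dots> = 0"
    using Zpos by simp
  finally show ?thesis
    by (simp add: sum.distrib sum_subtractf sum_negf algebra_simps)
qed

text \<open>Resampling the coordinates in \<open>U\<close> leaves the uniform distribution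
  unchanged: exchanging the old and the new values on \<open>U\<close> is an involution on the
  pairs.\<close>

lemma sum_PiE_override:
  fixes F :: "('i \<Rightarrow> 'a) \<Rightarrow> real"
  assumes "U \<subseteq> I"
  shows "(\<Sum>x\<in>PiE I B. \<Sum>y\<in>PiE U B. F (override_on x y U)) =
    card (PiE U B) * (\<Sum>x\<in>PiE I B. F x)"
proof -
  let ?swap = "\<lambda>(x, y). (override_on x y U, restrict x U)"
  have invol: "?swap (?swap z) = z" if "z \<in> PiE I B \<times> PiE U B" for z
    using that by (auto simp: override_on_def fun_eq_iff PiE_def extensional_def)
  have closed: "?swap z \<in> PiE I B \<times> PiE U B" if "z \<in> PiE I B \<times> PiE U B" for z
    using that assms by (auto simp: override_on_def PiE_def extensional_def)
  have "(\<Sum>x\<in>PiE I B. \<Sum>y\<in>PiE U B. F (override_on x y U)) =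
      (\<Sum>(x, y)\<in>PiE I B \<times> PiE U B. F (override_on x y U))"
    by (simp add: sum.cartesian_product)
  also have "\<dots> = (\<Sum>(x, y)\<in>PiE I B \<times> PiE U B. F x)"
    by (rule sum.reindex_bij_witness[of _ ?swap ?swap]) (use invol closed in auto)
  also have "\<dots> = (\<Sum>x\<in>PiE I B. \<Sum>y\<in>PiE U B. F x)"
    by (simp only: sum.cartesian_product)
  finally show ?thesis
    by (simp add: sum_distrib_left)
qed

lemma sum_PiE_update:
  fixes F :: "('i \<Rightarrow> 'a) \<Rightarrow> real"
  assumes "u \<in> I"
  shows "(\<Sum>x\<in>PiE I (\<lambda>_. S). \<Sum>c\<in>S. F (x(u := c))) = card S * (\<Sum>x\<in>PiE I (\<lambda>_. S). F x)"
proof -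
  let ?swap = "\<lambda>(x, c). (x(u := c), x u)"
  have closed: "?swap z \<in> PiE I (\<lambda>_. S) \<times> S" if "z \<in> PiE I (\<lambda>_. S) \<times> S" for z
    using that assms by (auto simp: PiE_def extensional_def)
  have "(\<Sum>x\<in>PiE I (\<lambda>_. S). \<Sum>c\<in>S. F (x(u := c))) = (\<Sum>(x, c)\<in>PiE I (\<lambda>_. S) \<times> S. F (x(u := c)))"
    by (simp add: sum.cartesian_product)
  also have "\<dots> = (\<Sum>(x, c)\<in>PiE I (\<lambda>_. S) \<times> S. F x)"
    by (rule sum.reindex_bij_witness[of _ ?swap ?swap]) (use closed in auto)
  also have "\<dots> = (\<Sum>x\<in>PiE I (\<lambda>_. S). \<Sum>c\<in>S. F x)"
    by (simp only: sum.cartesian_product)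
  finally show ?thesis
    by (simp add: sum_distrib_left)
qed


section \<open>The bit-reversal permutation\<close>

primrec bitrev :: "nat \<Rightarrow> nat \<Rightarrow> nat" where
  "bitrev 0 t = 0"
| "bitrev (Suc m) t = (t mod 2) * 2 ^ m + bitrev m (t div 2)"

lemma bitrev_less: "bitrev m t < 2 ^ m"
proof (induction m arbitrary: t)
  case (Suc m)
  have "(t mod 2) * 2 ^ m \<le> 1 * 2 ^ m"
    by (intro mult_right_mono) linarith+
  with Suc[of "t div 2"] show ?case
    by (simp only: bitrev.simps power_Suc)
qed simp

lemma inj_on_bitrev: "inj_on (bitrev m) {..<2 ^ m}"
proof (induction m)
  case 0
  then show ?case by (auto simp: inj_on_def)
next
  case (Suc m)
  show ?case
  proof (rule inj_onI)
    fix s t :: nat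
    assume st: "s \<in> {..<2 ^ Suc m}" "t \<in> {..<2 ^ Suc m}" "bitrev (Suc m) s = bitrev (Suc m) t"
    have div: "bitrev (Suc m) x div 2 ^ m = x mod 2" and mod: "bitrev (Suc m) x mod 2 ^ m = bitrev m (x div 2)" for x
      using bitrev_less[of m "x div 2"] by auto
    have "s mod 2 = t mod 2"
      using div st(3) by metis
    moreover have "bitrev m (s div 2) = bitrev m (t div 2)"
      using mod st(3) by metis
    then have "s div 2 = t div 2"
      by (rule inj_onD[OF Suc]) (use st(1,2) in auto)
    ultimately show "s = t"
      by (metis div_mult_mod_eq)
  qed
qed

text \<open>The low bits of the argument become the high bits of the value, so an aligned block of
  arguments is mapped onto an arithmetic progression with step \<open>2 ^ c\<close> and offset
  \<open>bitrev c h\<close>.\<close>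

lemma bitrev_add:
  "u < 2 ^ g \<Longrightarrow> bitrev (g + c) (h * 2 ^ g + u) = bitrev g u * 2 ^ c + bitrev c h"
proof (induction g arbitrary: u)
  case (Suc g)
  have "(h * 2 ^ Suc g + u) mod 2 = u mod 2"
    by (simp add: mult.left_commute[of h])
  moreover have "(h * 2 ^ Suc g + u) div 2 = h * 2 ^ g + u div 2"
    by (simp add: mult.left_commute[of h])
  ultimately show ?case
    using Suc.IH[of "u div 2"] Suc.prems by (simp add: power_add algebra_simps)
qed simp

lemma bitrev_image: "bitrev m ` {..<2 ^ m} = {..<2 ^ m}"
  using bitrev_less by (intro endo_inj_surj inj_on_bitrev) auto

text \<open>
  An aligned block of arguments is spread evenly over the values. The largest of its values is left
  out, so that each of the others has room for \<open>2 ^ (m - g)\<close> values to its right.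
\<close>

lemma bitrev_block:
  assumes g: "g \<le> m" and h: "h < 2 ^ (m - g)"
  obtains U where "U \<subseteq> bitrev m ` {h * 2 ^ g..<Suc h * 2 ^ g}" "card U = 2 ^ g - 1"
    "\<And>p. p \<in> U \<Longrightarrow> p + 2 ^ (m - g) < 2 ^ m"
    "\<And>p q. p \<in> U \<Longrightarrow> q \<in> U \<Longrightarrow> p < q \<Longrightarrow> p + 2 ^ (m - g) \<le> q"
proof -
  define L :: nat where "L = 2 ^ (m - g)"
  define off where "off = bitrev (m - g) h"
  have off: "off < L"
    by (simp add: off_def L_def bitrev_less)
  have LL: "2 ^ g * L = 2 ^ m"
    using g by (simp add: L_def power_add[symmetric])
  define U where "U = (\<lambda>j. j * L + off) ` {..<2 ^ g - 1}"
  have "U \<subseteq> bitrev m ` {h * 2 ^ g..<Suc h * 2 ^ g}"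
  proof
    fix p assume "p \<in> U"
    then obtain j where j: "j < 2 ^ g - 1" "p = j * L + off"
      by (auto simp: U_def)
    then have "j \<in> bitrev g ` {..<2 ^ g}"
      unfolding bitrev_image by simp
    then obtain u where u: "u < 2 ^ g" "j = bitrev g u"
      by auto
    have "bitrev m (h * 2 ^ g + u) = p"
      using bitrev_add[OF u(1), of "m - g" h] g by (simp add: j u(2)[symmetric] L_def off_def)
    moreover have "h * 2 ^ g + u \<in> {h * 2 ^ g..<Suc h * 2 ^ g}"
      using u by simp
    ultimately show "p \<in> bitrev m ` {h * 2 ^ g..<Suc h * 2 ^ g}"
      by blast
  qed
  moreover have "card U = 2 ^ g - 1"
    unfolding U_def by (subst card_image) (auto simp: inj_on_def L_def)
  moreover have "p + L < 2 ^ m" if "p \<in> U" for p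
  proof -
    from that obtain j where j: "j < 2 ^ g - 1" "p = j * L + off"
      by (auto simp: U_def)
    then have "(j + 2) * L \<le> 2 ^ g * L"
      by (intro mult_right_mono) auto
    with j off LL show ?thesis
      by (simp add: algebra_simps)
  qed
  moreover have "p + L \<le> q" if "p \<in> U" "q \<in> U" "p < q" for p q
  proof -
    from that obtain i j where ij: "p = i * L + off" "q = j * L + off"
      by (auto simp: U_def)
    with that have "i < j"
      by (auto simp: L_def)
    then have "(i + 1) * L \<le> j * L"
      by (intro mult_right_mono) auto
    with ij show ?thesis by simp
  qed
  ultimately show thesis
    using that unfolding L_def by blast
qed

text \<open>The translates of \<open>U\<close> by less than \<open>L\<close> are disjoint. Averaging
  over the shift \<open>j\<close> replaces the items of \<open>U\<close>, which depend on the level,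
  by all items, so that one distribution of queries serves every level.\<close>

lemma sum_separated_le:
  fixes f :: "nat \<Rightarrow> real"
  assumes pos: "\<And>k. 0 \<le> f k" and fin: "finite U"
    and N: "\<And>p. p \<in> U \<Longrightarrow> p + L < N" and sep: "\<And>p q. p \<in> U \<Longrightarrow> q \<in> U \<Longrightarrow> p < q \<Longrightarrow> p + L \<le> q"
  shows "(\<Sum>j<L. \<Sum>p\<in>U. f (p + j)) \<le> (\<Sum>k<N. f k)"
proof -
  have inj: "inj_on (\<lambda>(j, p). p + j) ({..<L} \<times> U)"
  proof (rule inj_onI, clarsimp)
    fix j p j' p' :: nat
    assume *: "j < L" "p \<in> U" "j' < L" "p' \<in> U" "p + j = p' + j'"
    have "\<not> p < p'" "\<not> p' < p"
      using sep[of p p'] sep[of p' p] * by linarith+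
    with * show "j = j' \<and> p = p'" by simp
  qed
  have "(\<Sum>j<L. \<Sum>p\<in>U. f (p + j)) = (\<Sum>(j, p)\<in>{..<L} \<times> U. f (p + j))"
    by (simp add: sum.cartesian_product)
  also have "\<dots> = sum f ((\<lambda>(j, p). p + j) ` ({..<L} \<times> U))"
    using inj by (simp add: sum.reindex case_prod_unfold)
  also have "\<dots> \<le> sum f {..<N}"
    using N pos by (intro sum_mono2) fastforce+
  finally show ?thesis .
qed


section \<open>Comparison queries\<close>

lemma psum_mono:
  assumes "\<And>p. p \<in> {1..n} \<Longrightarrow> 0 \<le> A p" "i \<le> j" "j \<le> n"
  shows "psum A i \<le> psum A j"
  unfolding psum_def using assms by (intro sum_mono2) auto

text \<open>Take the largest \<open>l\<close> at which the quotients differ. If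
  \<open>l < a\<close>, they coincide after one more halving, so they form a pair
  \<open>2 * c\<close>, \<open>2 * c + 1\<close>; if \<open>l = a\<close>, the distance bound
  suffices.\<close>

lemma consecutive_quotients:
  fixes P P' :: int
  assumes "P < P'" "P' < P + 2 ^ a"
  obtains l where "l \<le> a" "P' div 2 ^ l = P div 2 ^ l + 1"
proof -
  define S where "S = {l. l \<le> a \<and> P div 2 ^ l < P' div 2 ^ l}"
  define l where "l = Max S"
  have S: "finite S" "0 \<in> S"
    using assms by (auto simp: S_def)
  have "l \<in> S"
    unfolding l_def using S by (intro Max_in) auto
  then have l: "l \<le> a" "P div 2 ^ l < P' div 2 ^ l"
    by (auto simp: S_def)
  have "P' div 2 ^ l \<le> P div 2 ^ l + 1"
  proof (cases "l = a")
    case True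
    have "P' div 2 ^ a \<le> (P + 2 ^ a) div 2 ^ a"
      using assms by (intro zdiv_mono1) auto
    with True show ?thesis by simp
  next
    case False
    have "Suc l \<notin> S"
      using Max_ge[OF S(1), of "Suc l"] unfolding l_def[symmetric] by linarith
    with False l have le: "P' div 2 ^ Suc l \<le> P div 2 ^ Suc l"
      by (auto simp: S_def not_less)
    have "x div 2 ^ Suc l = x div 2 ^ l div 2" for x :: int
      by (simp add: zdiv_zmult2_eq[symmetric] mult.commute)
    with le show ?thesis by simp
  qed
  with l show thesis
    by (intro that[of l]) auto
qed

text \<open>
  With \<open>sel\<close> the query \<open>(k, l, e)\<close> compares the partial sum of item \<open>k\<close> (stored at position
  \<open>Suc k\<close>) with the multiple of \<open>2 ^ l\<close> next to it, below or above according to \<open>e\<close>. The maximum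
  with 1 makes it legal.
\<close>

definition query_op :: "bool \<Rightarrow> (nat \<Rightarrow> int) \<Rightarrow> nat \<times> nat \<times> nat \<Rightarrow> ps_op" where
  "query_op sel A = (\<lambda>(k, l, e).
     if sel then Select (max 1 (2 ^ l * (psum A (Suc k) div 2 ^ l + int e))) else Sum (Suc k))"

text \<open>The multiple of \<open>2 ^ l\<close> above the sum in \<open>A\<close> is the one below
  the sum in \<open>A'\<close>, so sides 1 and 0 denote the same query. As a threshold it separates
  the two sums: \<open>Select\<close> answers beyond \<open>Suc k\<close> in \<open>A\<close> and at
  most \<open>Suc k\<close> in \<open>A'\<close>. It exceeds a nonnegative sum, so the maximum with
  1 does not change it. For \<open>Sum\<close> the two answers are the sums themselves.\<close>

lemma query_op_distinguishes:
  assumes P: "psum A (Suc k) < psum A' (Suc k)" "psum A' (Suc k) < psum A (Suc k) + 2 ^ a"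
    and k: "Suc k \<le> n"
    and pos: "\<And>p. sel \<Longrightarrow> p \<in> {1..n} \<Longrightarrow> 1 \<le> A p" "\<And>p. sel \<Longrightarrow> p \<in> {1..n} \<Longrightarrow> 1 \<le> A' p"
  obtains l where "l \<le> a" "query_op sel A (k, l, 1) = query_op sel A' (k, l, 0)"
    "even (psum A (Suc k) div 2 ^ l) \<noteq> even (psum A' (Suc k) div 2 ^ l)"
    "\<And>r. correct_answer n A (query_op sel A (k, l, 1)) r \<Longrightarrow>
          \<not> correct_answer n A' (query_op sel A (k, l, 1)) r"
proof -
  obtain l where l: "l \<le> a" "psum A' (Suc k) div 2 ^ l = psum A (Suc k) div 2 ^ l + 1"
    using consecutive_quotients[OF P] by blast
  show thesis
  proof (rule that[OF l(1)])
    show "query_op sel A (k, l, 1) = query_op sel A' (k, l, 0)"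
      by (simp add: query_op_def l(2))
    show "even (psum A (Suc k) div 2 ^ l) \<noteq> even (psum A' (Suc k) div 2 ^ l)"
      by (simp add: l(2))
    fix r
    assume A: "correct_answer n A (query_op sel A (k, l, 1)) r"
    show "\<not> correct_answer n A' (query_op sel A (k, l, 1)) r"
    proof
      assume A': "correct_answer n A' (query_op sel A (k, l, 1)) r"
      show False
      proof (cases sel)
        case False
        with A A' P show False by (simp add: query_op_def)
      next
        case True
        let ?m = "2 ^ l * (psum A (Suc k) div 2 ^ l + 1)"
        have mono: "psum A i \<le> psum A j" "psum A' i \<le> psum A' j" if "i \<le> j" "j \<le> n" for i j
          using that pos[OF True] by (intro psum_mono[of n]; force)+
        have "psum A 0 \<le> psum A (Suc k)"
          using mono k by blast
        have lo: "psum A (Suc k) < ?m"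
        proof -
          have "psum A (Suc k) = 2 ^ l * (psum A (Suc k) div 2 ^ l) + psum A (Suc k) mod 2 ^ l"
            by simp
          moreover have "psum A (Suc k) mod 2 ^ l < 2 ^ l"
            by simp
          ultimately show ?thesis
            by (simp only: distrib_left mult_1_right)
        qed
        with \<open>psum A 0 \<le> psum A (Suc k)\<close> have max: "max 1 ?m = ?m"
          by (simp add: psum_def)
        have hi: "?m \<le> psum A' (Suc k)"
        proof -
          have "psum A' (Suc k) = 2 ^ l * (psum A' (Suc k) div 2 ^ l) + psum A' (Suc k) mod 2 ^ l"
            by simp
          moreover have "0 \<le> psum A' (Suc k) mod 2 ^ l"
            by simp
          ultimately show ?thesis
            unfolding l(2) by linarith
        qed
        obtain i where i: "i \<in> {1..n}" "r = int i" "?m \<le> psum A i"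
          using A True max by (auto simp: query_op_def)
        obtain j where j: "j \<in> {1..n}" "r = int j" "psum A' (j - 1) < ?m"
          using A' True max by (auto simp: query_op_def)
        have "Suc k < i"
          using mono(1)[of i "Suc k"] i lo k by force
        moreover have "\<not> Suc k \<le> j - 1"
          using mono(2)[of "Suc k" "j - 1"] j hi by fastforce
        ultimately show False
          using i j by simp
      qed
    qed
  qed
qed


section \<open>An encoding bound\<close>

text \<open>The generating function of partial maps by number of entries. It prices a set of unknown
  size without fixing that size beforehand.\<close>

lemma sum_option_weights:
  fixes q :: real
  assumes "finite A" "finite S"
  shows "(\<Sum>f\<in>PiE A (\<lambda>_. insert None (Some ` S)). \<Prod>x\<in>A. if f x = None then 1 else q) =
    (1 + q * card S) ^ card A"
proof -
  have "(\<Sum>f\<in>PiE A (\<lambda>_. insert None (Some ` S)). \<Prod>x\<in>A. if f x = None then 1 else q) =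
      (\<Prod>x\<in>A. \<Sum>z\<in>insert None (Some ` S). if z = None then 1 else q)"
    using assms by (intro prod_sum_PiE[symmetric]) auto
  also have "(\<Sum>z\<in>insert None (Some ` S). if z = None then 1 else q) = 1 + q * card S"
    using assms by (simp add: sum.reindex)
  finally show ?thesis by simp
qed

lemma neg_ln_prod_option:
  fixes q :: real
  assumes "finite A" "0 < q"
  shows "- ln (\<Prod>x\<in>A. if f x = None then 1 else q) = - ln q * card {x \<in> A. f x \<noteq> None}"
proof -
  have "- ln (\<Prod>x\<in>A. if f x = None then 1 else q) = - (\<Sum>x\<in>A. ln (if f x = None then 1 else q))"
    using assms by (subst ln_prod) auto
  also have "(\<Sum>x\<in>A. ln (if f x = None then 1 else q)) = (\<Sum>x\<in>A. if f x \<noteq> None then ln q else 0)"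
    by (intro sum.cong) auto
  also have "\<dots> = ln q * card {x \<in> A. f x \<noteq> None}"
    using assms by (simp add: sum.If_cases Int_def)
  finally show ?thesis by simp
qed

text \<open>
  The price of an input cell is \<open>2 * b\<close> bits (address and contents), that of a bad comparison a
  constant, and every replayed operation costs \<open>b\<close> bits.
\<close>

lemma encoding_bound:
  fixes I :: "'x \<Rightarrow> nat \<Rightarrow> nat option" and F :: "'x \<Rightarrow> nat \<Rightarrow> 'o" and S :: "'x \<Rightarrow> 'z \<Rightarrow> bool option"
  assumes X: "finite X" "X \<noteq> {}" and inj: "inj_on (\<lambda>x. (I x, F x, S x)) X"
    and I: "\<And>x. x \<in> X \<Longrightarrow> I x \<in> PiE {..<2 ^ b} (\<lambda>_. insert None (Some ` {..<2 ^ b}))"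
    and F: "\<And>x. x \<in> X \<Longrightarrow> F x \<in> PiE V OP" "finite V"
      "\<And>v. v \<in> V \<Longrightarrow> finite (OP v)" "\<And>v. v \<in> V \<Longrightarrow> card (OP v) \<le> 2 ^ b"
    and S: "\<And>x. x \<in> X \<Longrightarrow> S x \<in> PiE Z (\<lambda>_. UNIV)" "finite Z"
  shows "card X * (ln (card X) - 1 - real (card V) * b - card Z / 32) \<le>
    (\<Sum>x\<in>X. 2 * real b * card {c. c < 2 ^ b \<and> I x c \<noteq> None} + 5 * real (card {z\<in>Z. S x z \<noteq> None}))"
proof -
  define C1 :: "(nat \<Rightarrow> nat option) set"
    where "C1 = PiE {..<2 ^ b} (\<lambda>_. insert None (Some ` {..<2 ^ b}))"
  define C2 where "C2 = PiE V OP"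
  define C3 :: "('z \<Rightarrow> bool option) set" where "C3 = PiE Z (\<lambda>_. insert None (Some ` UNIV))"
  \<comment> \<open>There are \<open>4 ^ b\<close> pairs of address and contents, so the Kraft sum
    is \<open>(1 + 1 / 2 ^ b) ^ 2 ^ b\<close>, at most \<open>exp 1\<close>.\<close>
  define w1 :: "(nat \<Rightarrow> nat option) \<Rightarrow> real"
    where "w1 = (\<lambda>f. \<Prod>x\<in>{..<2 ^ b}. if f x = None then 1 else 1 / 4 ^ b)"
  \<comment> \<open>The weight 1/64 balances two needs: with two possible bits a comparison adds
    only 1/32 to the logarithm of the Kraft sum, and a bad one costs
    \<open>6 * ln 2 < 5\<close>.\<close>
  define w3 :: "('z \<Rightarrow> bool option) \<Rightarrow> real"
    where "w3 = (\<lambda>f. \<Prod>x\<in>Z. if f x = None then 1 else 1 / 64)"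
  \<comment> \<open>The replayed operations have weight 1. They are paid for in the Kraft sum
    \<open>W\<close>, through the size of \<open>C2\<close>.\<close>
  define w where "w = (\<lambda>(f, g :: nat \<Rightarrow> 'o, h). w1 f * w3 h)"
  define W where "W = exp 1 * (2 ^ b) ^ card V * exp (card Z / 32 :: real)"
  have fin: "finite C1" "finite C2" "finite C3"
    using F S by (auto simp: C1_def C2_def C3_def intro!: finite_PiE)
  have pos: "0 < w1 f" "0 < w3 h" for f h
    by (auto simp: w1_def w3_def intro!: prod_pos)
  have e: "(1 + x) ^ k \<le> exp (k * x)" if "0 \<le> x" for x :: real and k :: nat
    using power_mono[OF exp_ge_add_one_self[of x], of k] that by (simp add: exp_of_nat_mult)
  have "sum w1 C1 = (1 + 1 / 4 ^ b * 2 ^ b) ^ 2 ^ b"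
    unfolding w1_def C1_def by (subst sum_option_weights) auto
  also have "\<dots> \<le> exp (real (2 ^ b) * (1 / 4 ^ b * 2 ^ b))"
    by (rule e) auto
  also have "real (2 ^ b) * (1 / 4 ^ b * 2 ^ b) = 1"
    by (simp add: power_mult_distrib[symmetric])
  finally have w1: "sum w1 C1 \<le> exp 1" .
  have "sum w3 C3 = (1 + 1 / 64 * 2) ^ card Z"
    unfolding w3_def C3_def using S by (subst sum_option_weights) (auto simp: UNIV_bool)
  also have "\<dots> \<le> exp (card Z * (1 / 64 * 2))"
    by (rule e) auto
  finally have w3: "sum w3 C3 \<le> exp (card Z / 32)"
    by simp
  have "card C2 = (\<Prod>v\<in>V. card (OP v))"
    unfolding C2_def using F by (simp add: card_PiE)
  also have "\<dots> \<le> (\<Prod>v\<in>V. 2 ^ b)"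
    using F by (intro prod_mono) auto
  finally have "real (card C2) \<le> real ((2 ^ b) ^ card V)"
    unfolding of_nat_le_iff by simp
  then have c2: "real (card C2) \<le> (2 ^ b) ^ card V"
    by simp
  have nonneg: "0 \<le> sum w1 C1" "0 \<le> sum w3 C3"
    using pos by (simp_all add: sum_nonneg less_imp_le)
  have "sum w (C1 \<times> C2 \<times> C3) = sum w1 C1 * (card C2 * sum w3 C3)"
  proof -
    have "sum w (C1 \<times> C2 \<times> C3) = (\<Sum>f\<in>C1. \<Sum>g\<in>C2. \<Sum>h\<in>C3. w1 f * w3 h)"
      by (simp add: w_def sum.cartesian_product[symmetric])
    also have "\<dots> = (\<Sum>f\<in>C1. w1 f * (card C2 * sum w3 C3))"
      by (simp add: sum_distrib_left[symmetric] mult_ac)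
    finally show ?thesis
      by (simp only: sum_distrib_right)
  qed
  also have "\<dots> \<le> exp 1 * ((2 ^ b) ^ card V * exp (card Z / 32))"
    using w1 c2 w3 nonneg by (intro mult_mono) simp_all
  finally have sumw: "sum w (C1 \<times> C2 \<times> C3) \<le> W"
    by (simp add: W_def mult_ac)
  have lnW: "ln W \<le> 1 + real (card V) * b + card Z / 32"
  proof -
    have "ln W = 1 + real (card V) * (b * ln 2) + card Z / 32"
      by (simp add: W_def ln_mult ln_realpow)
    also have "real (card V) * (b * ln 2) \<le> real (card V) * b"
      using ln_2_less_1 by (simp add: mult_left_le mult_left_mono)
    finally show ?thesis by simp
  qed
  have "ln (2 ^ 2) = 2 * ln (2 :: real)" "ln (2 ^ 6) = 6 * ln (2 :: real)"
    by (simp_all only: ln_realpow)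
  then have ln4: "ln 4 = 2 * ln (2 :: real)" and ln64: "ln 64 = 6 * ln (2 :: real)"
    by simp_all
  have cost: "- ln (w (I x, F x, S x)) \<le>
      2 * real b * card {c. c < 2 ^ b \<and> I x c \<noteq> None} + 5 * real (card {z\<in>Z. S x z \<noteq> None})" for x
  proof -
    have "- ln (w (I x, F x, S x)) = - ln (w1 (I x)) + - ln (w3 (S x))"
      using pos(1)[of "I x"] pos(2)[of "S x"] by (simp add: w_def ln_mult)
    also have "- ln (w1 (I x)) = b * (2 * ln 2) * card {c. c < 2 ^ b \<and> I x c \<noteq> None}"
      unfolding w1_def by (subst neg_ln_prod_option)
        (auto simp: ln_div ln_realpow ln4)
    also have "- ln (w3 (S x)) = 6 * ln 2 * card {z\<in>Z. S x z \<noteq> None}"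
      unfolding w3_def using S by (subst neg_ln_prod_option)
        (auto simp: ln_div ln64)
    also have "b * (2 * ln 2) * card {c. c < 2 ^ b \<and> I x c \<noteq> None} \<le>
        real b * 2 * real (card {c. c < 2 ^ b \<and> I x c \<noteq> None})"
      by (intro mult_right_mono mult_left_mono) (use ln_2_less_1 in auto)
    also have "6 * ln 2 * card {z\<in>Z. S x z \<noteq> None} \<le> 5 * real (card {z\<in>Z. S x z \<noteq> None})"
      using ln2_le_25_over_36 by (intro mult_right_mono) auto
    finally show ?thesis by (simp add: mult_ac)
  qed
  have "card X * (ln (card X) - 1 - real (card V) * b - card Z / 32) \<le> card X * (ln (card X) - ln W)"
    using lnW by (intro mult_left_mono) auto
  also have "\<dots> \<le> (\<Sum>x\<in>X. - ln (w (I x, F x, S x)))"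
  proof (rule sum_neg_ln_weights_ge[OF X inj _ _ _ sumw])
    have "C3 = PiE Z (\<lambda>_. UNIV)"
      by (simp add: C3_def UNIV_option_conv)
    then have "(I x, F x, S x) \<in> C1 \<times> C2 \<times> C3" if "x \<in> X" for x
      using I[OF that] F(1)[OF that] S(1)[OF that] by (simp add: C1_def C2_def)
    then show "(\<lambda>x. (I x, F x, S x)) ` X \<subseteq> C1 \<times> C2 \<times> C3"
      by (rule image_subsetI)
    show "finite (C1 \<times> C2 \<times> C3)"
      using fin by simp
    show "0 < w c" for c
      using pos by (cases c) (simp add: w_def)
  qed
  also have "\<dots> \<le> (\<Sum>x\<in>X. 2 * real b * card {c. c < 2 ^ b \<and> I x c \<noteq> None} +
      5 * real (card {z\<in>Z. S x z \<noteq> None}))"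
    by (intro sum_mono cost)
  finally show ?thesis .
qed


section \<open>Blocks of operations\<close>

definition array_after ::
  "nat \<Rightarrow> int \<Rightarrow> (nat \<Rightarrow> int) \<Rightarrow> (nat \<Rightarrow> nat) \<Rightarrow> nat \<Rightarrow> nat \<Rightarrow> int" where
  "array_after m lo Y x t =
     (\<lambda>p. if p \<in> Suc ` bitrev m ` {..<t} then lo + int (x (p - 1)) else Y p)"

text \<open>
  A block consists of \<open>2 ^ m\<close> rounds of one update and \<open>r\<close> queries each; round \<open>t\<close> sets item
  \<open>bitrev m t\<close>.
\<close>

definition block_op ::
  "nat \<Rightarrow> int \<Rightarrow> nat \<Rightarrow> bool \<Rightarrow> (nat \<Rightarrow> int) \<Rightarrow> (nat \<Rightarrow> nat) \<Rightarrow> (nat \<Rightarrow> nat \<times> nat \<times> nat) \<Rightarrow>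
   nat \<Rightarrow> ps_op" where
  "block_op m lo r sel Y x \<kappa> v =
     (let t = v div Suc r in
      if v mod Suc r = 0 then Update (Suc (bitrev m t)) (lo + int (x (bitrev m t)))
      else query_op sel (array_after m lo Y x (Suc t)) (\<kappa> v))"

definition item_values :: "nat \<Rightarrow> nat \<Rightarrow> (nat \<Rightarrow> nat) set" where
  "item_values m a = PiE {..<2 ^ m} (\<lambda>_. {..<2 ^ a})"

definition query_set :: "nat \<Rightarrow> nat \<Rightarrow> (nat \<times> nat \<times> nat) set" where
  "query_set m a = {..<2 ^ m} \<times> {..a} \<times> {..<2}"

definition query_choices :: "nat \<Rightarrow> nat \<Rightarrow> nat \<Rightarrow> (nat \<Rightarrow> nat \<times> nat \<times> nat) set" where
  "query_choices m a r = PiE {..<2 ^ m * Suc r} (\<lambda>_. query_set m a)"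

lemma finite_item_values [simp]: "finite (item_values m a)"
  by (auto simp: item_values_def intro!: finite_PiE)

lemma finite_query_set [simp]: "finite (query_set m a)"
  by (simp add: query_set_def)

lemma finite_query_choices [simp]: "finite (query_choices m a r)"
  by (auto simp: query_choices_def intro!: finite_PiE)

text \<open>One block run from a fixed array \<open>Y\<close> and a fixed memory \<open>M\<close>;
  what remains random are the item values and the queries. The last part of \<open>params\<close>
  lets the updates of an epoch outweigh the replay of a node, and \<open>bounded\<close> leaves at
  most \<open>2 ^ b\<close> possibilities for a replayed \<open>Select\<close>, hence
  \<open>b\<close> bits.\<close>

locale partial_sums_block =
  fixes n b a w d r :: nat and sel :: bool and lo :: int and Y :: "nat \<Rightarrow> int"
    and D :: cp_structure and M :: memory
  assumes wf: "wf_structure b D" "valid_memory b M"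
    and params: "1 \<le> a" "a \<le> b" "1 \<le> w" "0 < r" "40 * b * Suc r \<le> a * 2 ^ w"
    and size: "2 ^ (w * d) < n"
    and positive: "sel \<Longrightarrow> 1 \<le> lo" "\<And>p. sel \<Longrightarrow> p \<in> {1..n} \<Longrightarrow> 1 \<le> Y p"
    and bounded: "\<And>x t c. sel \<Longrightarrow> x \<in> item_values (w * d) a \<Longrightarrow> t < 2 ^ (w * d) \<Longrightarrow>
      c \<in> query_set (w * d) a \<Longrightarrow>
      query_op sel (array_after (w * d) lo Y x (Suc t)) c \<in> Select ` {1..2 ^ b}"
    and correct: "\<And>x \<kappa> v. x \<in> item_values (w * d) a \<Longrightarrow> \<kappa> \<in> query_choices (w * d) a r \<Longrightarrow>
      v < 2 ^ (w * d) * Suc r \<Longrightarrow> v mod Suc r \<noteq> 0 \<Longrightarrow>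
      correct_answer n (array_after (w * d) lo Y x (Suc (v div Suc r)))
        (block_op (w * d) lo r sel Y x \<kappa> v) (op_result D M (block_op (w * d) lo r sel Y x \<kappa>) v)"
begin

abbreviation "m \<equiv> w * d"
abbreviation "ops \<equiv> block_op m lo r sel Y"
abbreviation "arr \<equiv> array_after m lo Y"

section \<open>Levels of the tree and transfer across them\<close>

definition grain :: "nat \<Rightarrow> nat" where
  "grain i = Suc r * 2 ^ (w * i)"

definition start :: "nat \<Rightarrow> nat \<Rightarrow> nat" where
  "start i u = grain i * (u div grain i)"

text \<open>
  The stamps of the operations that precede the level-\<open>i\<close> block of \<open>u\<close> inside its level-\<open>i + 1\<close>
  block.
\<close>

definition epoch :: "nat \<Rightarrow> nat \<Rightarrow> nat set" where
  "epoch i u = {start (Suc i) u<..start i u}"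

definition transfer :: "nat \<Rightarrow> (nat \<Rightarrow> nat) \<Rightarrow> (nat \<Rightarrow> nat \<times> nat \<times> nat) \<Rightarrow> nat \<Rightarrow> nat" where
  "transfer i x \<kappa> u = card {z \<in> op_reads D M (ops x \<kappa>) u. snd z \<in> epoch i u}"

lemma grain_pos [simp]: "0 < grain i"
  by (simp add: grain_def)

lemma start_le: "start i u \<le> u"
  by (simp add: start_def)

lemma start_antimono: "i \<le> j \<Longrightarrow> start j u \<le> start i u"
proof -
  assume "i \<le> j"
  then have "grain i dvd grain j"
    unfolding grain_def by (intro mult_dvd_mono le_imp_power_dvd mult_le_mono) auto
  then obtain k where k: "grain j = grain i * k" ..
  have "grain i * (k * (u div grain j)) \<le> u"
    using start_le[of j u] by (simp add: start_def k mult_ac)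
  then have "k * (u div grain j) \<le> u div grain i"
    by (simp add: less_eq_div_iff_mult_less_eq mult.commute)
  then have "grain i * (k * (u div grain j)) \<le> grain i * (u div grain i)"
    by (rule mult_left_mono) simp
  then show ?thesis
    by (simp add: start_def k mult_ac)
qed

lemma start_eq:
  assumes "start i u \<le> v" "v \<le> u"
  shows "v div grain i = u div grain i"
proof (rule antisym)
  show "v div grain i \<le> u div grain i"
    using assms by (intro div_le_mono) auto
  show "u div grain i \<le> v div grain i"
    using assms by (simp add: less_eq_div_iff_mult_less_eq start_def mult.commute)
qed

lemma epoch_eq:
  assumes "start i u \<le> v" "v \<le> u"
  shows "epoch i v = epoch i u"
  using start_eq[of i u v] start_eq[of "Suc i" u v] assms start_antimono[of i "Suc i" u]
  by (simp add: epoch_def start_def)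

lemma sum_transfer_le: "(\<Sum>i<d. transfer i x \<kappa> u) \<le> op_probes D M (ops x \<kappa>) u"
proof -
  let ?R = "\<lambda>i. {z \<in> op_reads D M (ops x \<kappa>) u. snd z \<in> epoch i u}"
  have "epoch i u \<inter> epoch j u = {}" if "i \<noteq> j" for i j
    using that
  proof (induction i j rule: linorder_wlog)
    case (le i j)
    then have "start j u \<le> start (Suc i) u"
      by (intro start_antimono) auto
    then show ?case by (auto simp: epoch_def)
  qed (simp add: Int_commute)
  then have "?R i \<inter> ?R j = {}" if "i \<noteq> j" for i j
    using that by blast
  then have "(\<Sum>i<d. transfer i x \<kappa> u) = card (\<Union>i<d. ?R i)"
    unfolding transfer_def by (intro card_UN_disjoint[symmetric]) auto
  also have "\<dots> \<le> card (op_reads D M (ops x \<kappa>) u)"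
    by (intro card_mono) auto
  also have "\<dots> \<le> op_probes D M (ops x \<kappa>) u"
    unfolding op_reads_def op_probes_def by (rule card_stamped_reads_le)
  finally show ?thesis .
qed

text \<open>The query of \<open>u\<close> can be varied under a fixed history, so one encoding can
  refer to all possible queries of \<open>u\<close> at once.\<close>

lemma ops_update_query_cong: "v < u \<Longrightarrow> ops x (\<kappa>(u := c)) v = ops x \<kappa> v"
  by (simp add: block_op_def Let_def)

text \<open>From \<open>start i u\<close> to \<open>u\<close> the epoch is constant, so a read
  counted here is counted in the transfer of the operation that makes it.\<close>

lemma card_input_cells_le:
  "card (input_cells D M (ops x \<kappa>) (epoch i u) (start i u) u) \<le>
    (\<Sum>v\<in>{start i u..<u}. transfer i x \<kappa> v)"
proof -
  have eq: "input_cells D M (ops x \<kappa>) (epoch i u) (start i u) u =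
      (\<Union>v\<in>{start i u..<u}. fst ` {z \<in> op_reads D M (ops x \<kappa>) v. snd z \<in> epoch i u})"
    by (force simp: input_cells_def)
  have "card (input_cells D M (ops x \<kappa>) (epoch i u) (start i u) u) \<le>
      (\<Sum>v\<in>{start i u..<u}. card (fst ` {z \<in> op_reads D M (ops x \<kappa>) v. snd z \<in> epoch i u}))"
    unfolding eq by (intro card_UN_le) auto
  also have "\<dots> \<le> (\<Sum>v\<in>{start i u..<u}. transfer i x \<kappa> v)"
  proof (rule sum_mono)
    fix v assume "v \<in> {start i u..<u}"
    then have "epoch i v = epoch i u"
      by (intro epoch_eq) auto
    then show "card (fst ` {z \<in> op_reads D M (ops x \<kappa>) v. snd z \<in> epoch i u}) \<le> transfer i x \<kappa> v"
      unfolding transfer_def by (simp add: card_image_le)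
  qed
  finally show ?thesis .
qed

section \<open>Equal codes force equal values\<close>

lemma input_cells_less:
  "input_cells D M (ops x \<kappa>) E s u \<subseteq> {..<2 ^ b}"
proof
  fix c assume "c \<in> input_cells D M (ops x \<kappa>) E s u"
  then obtain v t where "(c, t) \<in> op_reads D M (ops x \<kappa>) v"
    by (auto simp: input_cells_def)
  then have "c < 2 ^ b"
    using wf valid_memory_mem_at[OF wf] unfolding op_reads_def wf_structure_def
    by (meson stamped_reads_address)
  then show "c \<in> {..<2 ^ b}" by simp
qed

lemma input_cells_cong:
  assumes "\<And>v. v < u \<Longrightarrow> f v = g v"
  shows "input_cells D M f E s u = input_cells D M g E s u"
proof -
  have "op_reads D M f v = op_reads D M g v" if "v < u" for v
    using that assms by (intro op_reads_cong) auto
  then show ?thesis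
    by (auto simp: input_cells_def)
qed

lemma arr_positive:
  assumes sel "p \<in> {1..n}"
  shows "1 \<le> arr x t p"
proof -
  have "1 \<le> lo + int (x (p - 1))"
    using positive(1)[OF assms(1)] by linarith
  with positive(2)[OF assms] show ?thesis
    by (simp only: array_after_def split: if_split) simp
qed

text \<open>The bit that is paid for a bad comparison. One bit is enough, since the quotients of the
  two candidates to be told apart are consecutive.\<close>

definition partial_sum_parity ::
  "(nat \<Rightarrow> nat) \<Rightarrow> nat \<Rightarrow> nat \<Rightarrow> nat \<Rightarrow> bool" where
  "partial_sum_parity x t k l = even (psum (arr x t) (Suc k) div 2 ^ l)"

text \<open>A single step of the decoder, put as a contradiction. The candidates differ only at
  \<open>p\<close> among the items up to \<open>k\<close>, so their partial sums differ by less than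
  \<open>2 ^ a\<close> and some dyadic level separates them. There the parities differ, so by
  \<open>parity\<close> neither run reads the gap; both return the same result, although no answer
  is correct for both arrays.\<close>

lemma query_distinguishes_values:
  assumes x: "x \<in> item_values m a" "x' \<in> item_values m a" and \<kappa>: "\<kappa> \<in> query_choices m a r"
    and u: "u < 2 ^ m * Suc r" "u mod Suc r \<noteq> 0" and k: "k < 2 ^ m"
    and p: "p \<le> k" "p \<in> bitrev m ` {..u div Suc r}" "x p < x' p"
    and eq: "\<And>q. q \<le> k \<Longrightarrow> q \<noteq> p \<Longrightarrow> x q = x' q"
    and le: "u\<^sub>0 \<le> u\<^sub>1" "u\<^sub>1 \<le> u"
    and before: "\<And>v. v < u\<^sub>0 \<Longrightarrow> ops x \<kappa> v = ops x' \<kappa> v"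
    and after: "\<And>v. u\<^sub>1 \<le> v \<Longrightarrow> v < u \<Longrightarrow> ops x \<kappa> v = ops x' \<kappa> v"
    and R: "input_cells D M (ops x \<kappa>) {u\<^sub>0<..u\<^sub>1} u\<^sub>1 u = R"
      "input_cells D M (ops x' \<kappa>) {u\<^sub>0<..u\<^sub>1} u\<^sub>1 u = R"
    and vals: "\<And>c. c \<in> R \<Longrightarrow> mem_at D M (ops x \<kappa>) u\<^sub>1 c = mem_at D M (ops x' \<kappa>) u\<^sub>1 c"
    and parity: "\<And>l. l \<le> a \<Longrightarrow>
      partial_sum_parity x (Suc (u div Suc r)) k l \<noteq> partial_sum_parity x' (Suc (u div Suc r)) k l \<Longrightarrow>
      (\<forall>e<2. \<forall>s\<in>{u\<^sub>0<..u\<^sub>1}. \<forall>c. (c, s) \<notin> op_reads D M (ops x (\<kappa>(u := (k, l, e)))) u) \<and>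
      (\<forall>e<2. \<forall>s\<in>{u\<^sub>0<..u\<^sub>1}. \<forall>c. (c, s) \<notin> op_reads D M (ops x' (\<kappa>(u := (k, l, e)))) u)"
  shows False
proof -
  define T where "T = u div Suc r"
  have diff: "psum (arr x' (Suc T)) (Suc k) - psum (arr x (Suc T)) (Suc k) = int (x' p) - int (x p)"
  proof -
    have "arr x' (Suc T) i - arr x (Suc T) i = (if i = Suc p then int (x' p) - int (x p) else 0)"
      if "i \<in> {1..Suc k}" for i
    proof -
      from that obtain q where q: "i = Suc q" "q \<le> k"
        by (cases i) auto
      have "p \<in> bitrev m ` {..<Suc T}"
        using p(2) by (simp add: T_def lessThan_Suc_atMost)
      then show ?thesis
        using eq[of q] q by (auto simp: array_after_def)
    qed
    then have "psum (arr x' (Suc T)) (Suc k) - psum (arr x (Suc T)) (Suc k) =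
        (\<Sum>i = 1..Suc k. if i = Suc p then int (x' p) - int (x p) else 0)"
      unfolding psum_def sum_subtractf[symmetric] by (intro sum.cong) auto
    also have "\<dots> = int (x' p) - int (x p)"
      using p(1) by (subst sum.delta) auto
    finally show ?thesis .
  qed
  have "p < 2 ^ m"
    using p(1) k by simp
  then have "int (x' p) < 2 ^ a"
    using x(2) by (auto simp: item_values_def dest!: PiE_mem)
  with diff p(3) have P: "psum (arr x (Suc T)) (Suc k) < psum (arr x' (Suc T)) (Suc k)"
      "psum (arr x' (Suc T)) (Suc k) < psum (arr x (Suc T)) (Suc k) + 2 ^ a"
    by linarith+
  have kn: "Suc k \<le> n"
    using k size by linarith
  obtain l where l: "l \<le> a"
      "query_op sel (arr x (Suc T)) (k, l, 1) = query_op sel (arr x' (Suc T)) (k, l, 0)"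
      "even (psum (arr x (Suc T)) (Suc k) div 2 ^ l) \<noteq> even (psum (arr x' (Suc T)) (Suc k) div 2 ^ l)"
      "\<And>r. correct_answer n (arr x (Suc T)) (query_op sel (arr x (Suc T)) (k, l, 1)) r \<Longrightarrow>
        \<not> correct_answer n (arr x' (Suc T)) (query_op sel (arr x (Suc T)) (k, l, 1)) r"
    using query_op_distinguishes[OF P kn arr_positive arr_positive] by metis
  \<comment> \<open>The sides 1 and 0 give the same operation at \<open>u\<close>, since each
    threshold is relative to the partial sum of its own array.\<close>
  define f where "f = ops x (\<kappa>(u := (k, l, 1)))"
  define g where "g = ops x' (\<kappa>(u := (k, l, 0)))"
  have f: "f v = ops x \<kappa> v" and g: "g v = ops x' \<kappa> v" if "v < u" for v
    using that by (simp_all add: f_def g_def ops_update_query_cong)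
  have fu: "f u = query_op sel (arr x (Suc T)) (k, l, 1)"
    using u by (simp add: f_def block_op_def T_def)
  have gu: "g u = query_op sel (arr x (Suc T)) (k, l, 1)"
    using u l(2) by (simp add: g_def block_op_def T_def)
  have unread: "\<forall>e<2. \<forall>s\<in>{u\<^sub>0<..u\<^sub>1}. \<forall>c. (c, s) \<notin> op_reads D M (ops x (\<kappa>(u := (k, l, e)))) u"
     "\<forall>e<2. \<forall>s\<in>{u\<^sub>0<..u\<^sub>1}. \<forall>c. (c, s) \<notin> op_reads D M (ops x' (\<kappa>(u := (k, l, e)))) u"
    using parity[OF l(1)] l(3) by (auto simp: partial_sum_parity_def T_def)
  have res: "op_result D M f u = op_result D M g u"
  proof (rule op_result_eqI[OF le])
    show "f v = g v" if "v < u\<^sub>0" for v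
      using that f[of v] g[of v] before[of v] le by simp
    show "f v = g v" if "u\<^sub>1 \<le> v" "v \<le> u" for v
      using that f[of v] g[of v] after[of v] fu gu by (cases "v = u") auto
    show "input_cells D M f {u\<^sub>0<..u\<^sub>1} u\<^sub>1 u = R"
      unfolding R(1)[symmetric] by (intro input_cells_cong f)
    show "input_cells D M g {u\<^sub>0<..u\<^sub>1} u\<^sub>1 u = R"
      unfolding R(2)[symmetric] by (intro input_cells_cong g)
    show "mem_at D M f u\<^sub>1 c = mem_at D M g u\<^sub>1 c" if "c \<in> R" for c
    proof -
      have "mem_at D M f u\<^sub>1 = mem_at D M (ops x \<kappa>) u\<^sub>1" "mem_at D M g u\<^sub>1 = mem_at D M (ops x' \<kappa>) u\<^sub>1"
        using le f g by (auto intro!: mem_at_cong)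
      with vals[OF that] show ?thesis by simp
    qed
    show "s \<notin> {u\<^sub>0<..u\<^sub>1}" if "(c, s) \<in> op_reads D M f u" for c s
    proof
      assume "s \<in> {u\<^sub>0<..u\<^sub>1}"
      with unread(1) have "(c, s) \<notin> op_reads D M f u"
        unfolding f_def using one_less_numeral_iff semiring_norm(76) by blast
      with that show False by simp
    qed
    show "s \<notin> {u\<^sub>0<..u\<^sub>1}" if "(c, s) \<in> op_reads D M g u" for c s
    proof
      assume "s \<in> {u\<^sub>0<..u\<^sub>1}"
      with unread(2) have "(c, s) \<notin> op_reads D M g u"
        unfolding g_def using zero_less_numeral by blast
      with that show False by simp
    qed
  qed
  have qs: "(k, l, e) \<in> query_set m a" if "e < 2" for e
    using k l(1) that by (simp add: query_set_def)
  have choices: "\<kappa>(u := (k, l, e)) \<in> query_choices m a r" if "e < 2" for e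
    using PiE_fun_upd[of "(k, l, e)" "\<lambda>_. query_set m a" u \<kappa> "{..<2 ^ m * Suc r}"] qs[OF that] \<kappa> u(1)
    by (simp add: query_choices_def insert_absorb)
  have "correct_answer n (arr x (Suc T)) (f u) (op_result D M f u)"
    using correct[OF x(1) choices u, of 1] by (simp add: f_def T_def)
  moreover have "correct_answer n (arr x' (Suc T)) (g u) (op_result D M g u)"
    using correct[OF x(2) choices u, of 0] by (simp add: g_def T_def)
  ultimately show False
    using l(4) res fu gu by metis
qed

lemma transfer_eq_0_iff:
  "transfer i x \<kappa> u = 0 \<longleftrightarrow> (\<forall>s\<in>epoch i u. \<forall>c. (c, s) \<notin> op_reads D M (ops x \<kappa>) u)"
  by (auto simp: transfer_def)

text \<open>
  \<open>U\<close> is spread evenly over the items updated in the first half of the level-\<open>i + 1\<close> block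
  of \<open>u\<close>; the operation \<open>u\<close> itself lies in the second half.
\<close>

lemma level_encoding:
  fixes h l\<^sub>0 q j g i u :: nat and U :: "nat set" and x\<^sub>0 :: "nat \<Rightarrow> nat"
  defines "X \<equiv> PiE U (\<lambda>_. {..<2 ^ a :: nat})"
  assumes i: "i < d" and g: "Suc g = w * Suc i"
    and T: "l\<^sub>0 < 2 ^ g" "(2 * h + 1) * 2 ^ g + l\<^sub>0 < 2 ^ m"
    and u: "u = Suc r * ((2 * h + 1) * 2 ^ g + l\<^sub>0) + Suc q" "q < r"
    and U: "U \<subseteq> bitrev m ` {2 * h * 2 ^ g..<Suc (2 * h) * 2 ^ g}" "card U = 2 ^ g - 1"
    and room: "\<And>p. p \<in> U \<Longrightarrow> p + 2 ^ (m - g) < 2 ^ m"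
    and sep: "\<And>p p'. p \<in> U \<Longrightarrow> p' \<in> U \<Longrightarrow> p < p' \<Longrightarrow> p + 2 ^ (m - g) \<le> p'"
    and j: "j < 2 ^ (m - g)"
    and x: "x\<^sub>0 \<in> item_values m a" and \<kappa>: "\<kappa> \<in> query_choices m a r"
  shows "real (card X) * (2 / 5 * a * card U) \<le>
    (\<Sum>y\<in>X. 2 * real b * (\<Sum>v\<in>{start i u..<u}. transfer i (override_on x\<^sub>0 y U) \<kappa> v) +
      5 * real (\<Sum>p\<in>U. \<Sum>l\<le>a. \<Sum>e<2. transfer i (override_on x\<^sub>0 y U) (\<kappa>(u := (p + j, l, e))) u))"
proof -
  define t where "t = (2 * h + 1) * 2 ^ g + l\<^sub>0"
  define ov where "ov = (\<lambda>y. override_on x\<^sub>0 y U)"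
  define s0 where "s0 = start (Suc i) u"
  define s1 where "s1 = start i u"
  define Rs where "Rs = (\<lambda>y. input_cells D M (ops (ov y) \<kappa>) {s0<..s1} s1 u)"
  \<comment> \<open>Both sides are tested, because it is open whether the candidate has the smaller
    or the larger of the two sums.\<close>
  define bad where "bad = (\<lambda>y p l. \<exists>e<2. transfer i (ov y) (\<kappa>(u := (p + j, l, e))) u \<noteq> 0)"
  \<comment> \<open>The code has three parts: \<open>I\<close> lists the input cells with their
    contents, \<open>F\<close> the operations to replay, and \<open>S\<close> the parities at the
    bad comparisons.\<close>
  define I where "I = (\<lambda>y. restrict (\<lambda>c. if c \<in> Rs y then Some (mem_at D M (ops (ov y) \<kappa>) s1 c) else None)
    {..<2 ^ b})"
  define F where "F = (\<lambda>y. restrict (ops (ov y) \<kappa>) {s1..<u})"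
  define S where "S = (\<lambda>y. restrict (\<lambda>(p, l). if bad y p l
    then Some (partial_sum_parity (ov y) (Suc t) (p + j) l) else None) (U \<times> {..a}))"
  have epoch: "epoch i u = {s0<..s1}"
    by (simp add: epoch_def s0_def s1_def)
  have u_eq: "u = Suc q + t * Suc r"
    by (simp add: u(1) t_def)
  have udiv: "u div Suc r = t"
    using div_mult_self1[of "Suc r" "Suc q" t] u(2) unfolding u_eq by simp
  have umod: "u mod Suc r \<noteq> 0"
    using mod_mult_self1[of "Suc q" t "Suc r"] u(2) unfolding u_eq by simp
  have ult: "u < 2 ^ m * Suc r"
    using T(2) udiv div_less_iff_less_mult[of "Suc r" u "2 ^ m"] unfolding t_def by simp
  have finU: "finite U"
    using U(1) finite_surj by blast
  have Um: "p < 2 ^ m" if "p \<in> U" for p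
    using room[OF that] by simp
  have finX: "finite X"
    using finU by (auto simp: X_def intro!: finite_PiE)
  have "restrict (\<lambda>_. 0) U \<in> X"
    by (simp add: X_def)
  then have X0: "X \<noteq> {}"
    by blast
  have cardX: "card X = (2 ^ a) ^ card U"
    using finU by (simp add: X_def card_PiE)
  have ov: "ov y \<in> item_values m a" if "y \<in> X" for y
    using x that Um by (auto simp: ov_def X_def item_values_def override_on_def PiE_def extensional_def)
  have ov_other: "ov y p = x\<^sub>0 p" if "p \<notin> U" for y p
    using that by (simp add: ov_def)
  \<comment> \<open>\<open>h\<close> numbers the level-\<open>i + 1\<close> block of
    \<open>u\<close>, which has \<open>2 ^ Suc g\<close> rounds.\<close>
  have s0: "s0 = Suc r * (h * 2 ^ Suc g)"
  proof -
    have gi: "grain (Suc i) = Suc r * 2 ^ Suc g"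
      by (simp only: grain_def g)
    have "u div grain (Suc i) = t div 2 ^ Suc g"
      by (simp add: gi div_mult2_eq udiv del: mult_Suc power_Suc)
    also have "t = h * 2 ^ Suc g + (2 ^ g + l\<^sub>0)"
      by (simp add: t_def algebra_simps)
    also have "(h * 2 ^ Suc g + (2 ^ g + l\<^sub>0)) div 2 ^ Suc g = h"
      using T(1) by (intro div_nat_eqI) (auto simp: algebra_simps)
    finally show ?thesis
      by (simp add: s0_def start_def gi mult_ac del: mult_Suc power_Suc)
  qed
  \<comment> \<open>A level-\<open>i\<close> block is at most half a level-\<open>i + 1\<close>
    block, so one starts exactly in the middle. Hence \<open>s1\<close> is not before the middle,
    and the epoch covers the whole first half.\<close>
  have wi: "w * i \<le> g"
    using g params(3) by simp
  have s1: "Suc r * ((2 * h + 1) * 2 ^ g) \<le> s1"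
  proof -
    have s1_eq: "s1 = Suc r * (2 ^ (w * i) * (t div 2 ^ (w * i)))"
      by (simp add: s1_def start_def grain_def div_mult2_eq udiv del: mult_Suc)
    obtain z where z: "(2 :: nat) ^ g = 2 ^ (w * i) * z"
      using le_imp_power_dvd[OF wi, of "2 :: nat"] ..
    have "(2 * h + 1) * z = 2 ^ (w * i) * ((2 * h + 1) * z) div 2 ^ (w * i)"
      by simp
    also have "\<dots> \<le> t div 2 ^ (w * i)"
      by (intro div_le_mono) (simp add: t_def z algebra_simps)
    finally have "2 ^ (w * i) * ((2 * h + 1) * z) \<le> 2 ^ (w * i) * (t div 2 ^ (w * i))"
      by (rule mult_left_mono) simp
    moreover have "(2 * h + 1) * 2 ^ g = 2 ^ (w * i) * ((2 * h + 1) * z)"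
      by (simp only: z mult.left_commute)
    ultimately show ?thesis
      unfolding s1_eq by (metis mult_le_mono2)
  qed
  have s01: "s0 \<le> s1" and s1u: "s1 \<le> u"
    using start_antimono[of i "Suc i" u] start_le[of i u] by (auto simp: s0_def s1_def)
  \<comment> \<open>By injectivity of bit reversal each item is set once per block, so outside the
    first half no round touches \<open>U\<close>.\<close>
  have fresh: "bitrev m t' \<notin> U" if "t' < 2 ^ m" "t' < h * 2 ^ Suc g \<or> (2 * h + 1) * 2 ^ g \<le> t'" for t'
  proof
    assume "bitrev m t' \<in> U"
    then obtain t'' where t'': "bitrev m t' = bitrev m t''" "t'' \<in> {2 * h * 2 ^ g..<Suc (2 * h) * 2 ^ g}"
      using U(1) by auto
    moreover have "t'' < 2 ^ m"
      using t''(2) T by auto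
    ultimately have "t' = t''"
      using inj_onD[OF inj_on_bitrev t''(1)] that(1) by simp
    with t''(2) that(2) show False by (auto simp: algebra_simps)
  qed
  have t_less: "v div Suc r < 2 ^ m" if "v \<le> u" for v
    using div_le_mono[OF that, of "Suc r"] T(2) udiv by (simp add: t_def)
  have before: "ops (ov y) \<kappa> v = ops (ov y') \<kappa> v" if v: "v < s0" for v y y'
  proof -
    have t': "v div Suc r < h * 2 ^ Suc g"
      using v unfolding s0 by (simp add: less_mult_imp_div_less mult.commute del: mult_Suc power_Suc)
    have ov_eq: "ov y (bitrev m t') = ov y' (bitrev m t')" if "t' \<le> v div Suc r" for t'
      using fresh[of t'] t' that t_less[of v] v s01 s1u by (simp add: ov_other)
    have "arr (ov y) (Suc (v div Suc r)) = arr (ov y') (Suc (v div Suc r))"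
    proof (rule ext)
      show "arr (ov y) (Suc (v div Suc r)) p = arr (ov y') (Suc (v div Suc r)) p" for p
        using ov_eq by (auto simp: array_after_def less_Suc_eq_le)
    qed
    with ov_eq[of "v div Suc r"] show ?thesis
      by (simp add: block_op_def Let_def)
  qed
  have update_eq: "ops (ov y) \<kappa> v = ops (ov y') \<kappa> v"
    if v: "s1 \<le> v" "v \<le> u" "v mod Suc r = 0" for v y y'
  proof -
    have "(2 * h + 1) * 2 ^ g \<le> v div Suc r"
      using s1 v(1) by (simp add: less_eq_div_iff_mult_less_eq mult.commute del: mult_Suc)
    with fresh[of "v div Suc r"] t_less[OF v(2)] show ?thesis
      using v(3) by (simp add: block_op_def Let_def ov_other)
  qed
  \<comment> \<open>\<open>p\<close> is the first difference in \<open>U\<close>, and the next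
    element of \<open>U\<close> lies beyond \<open>p + j\<close> by \<open>sep\<close>. The partial
    sum at \<open>p + j\<close> therefore isolates the value at \<open>p\<close>.\<close>
  have inj_aux: False
    if y: "y \<in> X" "y' \<in> X" and p: "p \<in> U" "y p < y' p" and min: "\<forall>q\<in>U. q < p \<longrightarrow> y q = y' q"
      and code: "I y = I y'" "F y = F y'" "S y = S y'" for y y' p
  proof (rule query_distinguishes_values[OF ov[OF y(1)] ov[OF y(2)] \<kappa> ult umod, of "p + j" p s0 s1 "Rs y"])
    show "p + j < 2 ^ m"
      using room[OF p(1)] j by simp
    show "p \<in> bitrev m ` {..u div Suc r}"
      using U(1) p(1) by (auto simp: udiv t_def)
    show "ov y p < ov y' p"
      using p by (simp add: ov_def)
    show "ov y q = ov y' q" if "q \<le> p + j" "q \<noteq> p" for q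
      using min sep[OF p(1), of q] j that by (cases "q \<in> U"; cases "q < p") (auto simp: ov_def)
    show "ops (ov y) \<kappa> v = ops (ov y') \<kappa> v" if "v < s0" for v
      using before that .
    show "ops (ov y) \<kappa> v = ops (ov y') \<kappa> v" if "s1 \<le> v" "v < u" for v
      using fun_cong[OF code(2), of v] that by (simp add: F_def)
    have Rs: "Rs y \<subseteq> {..<2 ^ b}" "Rs y' \<subseteq> {..<2 ^ b}"
      unfolding Rs_def by (rule input_cells_less)+
    have I: "(if c \<in> Rs y then Some (mem_at D M (ops (ov y) \<kappa>) s1 c) else None) =
        (if c \<in> Rs y' then Some (mem_at D M (ops (ov y') \<kappa>) s1 c) else None)" if "c < 2 ^ b" for c
      using fun_cong[OF code(1), of c] that by (simp add: I_def)
    have Rs_eq: "Rs y = Rs y'"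
    proof (intro set_eqI)
      show "c \<in> Rs y \<longleftrightarrow> c \<in> Rs y'" for c
        using Rs I[of c] by (cases "c < 2 ^ b") (auto split: if_splits)
    qed
    then show "input_cells D M (ops (ov y') \<kappa>) {s0<..s1} s1 u = Rs y"
      by (simp add: Rs_def)
    show "mem_at D M (ops (ov y) \<kappa>) s1 c = mem_at D M (ops (ov y') \<kappa>) s1 c" if "c \<in> Rs y" for c
      using Rs I[of c] that Rs_eq by auto
    show "(\<forall>e<2. \<forall>s\<in>{s0<..s1}. \<forall>c. (c, s) \<notin> op_reads D M (ops (ov y) (\<kappa>(u := (p + j, l, e)))) u) \<and>
      (\<forall>e<2. \<forall>s\<in>{s0<..s1}. \<forall>c. (c, s) \<notin> op_reads D M (ops (ov y') (\<kappa>(u := (p + j, l, e)))) u)"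
      if "l \<le> a" "partial_sum_parity (ov y) (Suc (u div Suc r)) (p + j) l \<noteq>
        partial_sum_parity (ov y') (Suc (u div Suc r)) (p + j) l" for l
    proof -
      have "S y (p, l) = S y' (p, l)"
        by (simp add: code(3))
      then have "\<not> bad y p l" "\<not> bad y' p l"
        using p(1) that unfolding S_def udiv by (auto split: if_splits)
      then show ?thesis
        unfolding bad_def epoch[symmetric] by (simp add: transfer_eq_0_iff)
    qed
  qed (use p s01 s1u in \<open>auto simp: Rs_def\<close>)
  have inj: "inj_on (\<lambda>y. (I y, F y, S y)) X"
  proof (rule inj_onI, rule ccontr)
    fix y y' assume y: "y \<in> X" "y' \<in> X" and code: "(I y, F y, S y) = (I y', F y', S y')" and "y \<noteq> y'"
    then obtain p0 where "y p0 \<noteq> y' p0" "p0 \<in> U"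
      unfolding X_def by (metis PiE_ext)
    define p where "p = (LEAST p. p \<in> U \<and> y p \<noteq> y' p)"
    have p: "p \<in> U \<and> y p \<noteq> y' p"
      unfolding p_def by (rule LeastI[of _ p0]) (use \<open>y p0 \<noteq> y' p0\<close> \<open>p0 \<in> U\<close> in auto)
    have min: "y q = y' q" if "q \<in> U" "q < p" for q
      using not_less_Least[of q "\<lambda>p. p \<in> U \<and> y p \<noteq> y' p"] that unfolding p_def by blast
    show False
    proof (cases "y p < y' p")
      case True
      show False
        by (rule inj_aux[of y y' p]) (use True y p min code in auto)
    next
      case False
      show False
        by (rule inj_aux[of y' y p]) (use False y p min code in auto)
    qed
  qed
  \<comment> \<open>Only \<open>Select\<close> queries vary with the encoded values; updates from
    \<open>s1\<close> on and \<open>Sum\<close> queries are the same for all of them.\<close>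
  define OP where "OP = (\<lambda>v. (\<lambda>y. ops (ov y) \<kappa> v) ` X)"
  have OP: "finite (OP v)" "card (OP v) \<le> 2 ^ b" if v: "v \<in> {s1..<u}" for v
  proof -
    show "finite (OP v)"
      using finX by (simp add: OP_def)
    show "card (OP v) \<le> 2 ^ b"
    proof (cases "v mod Suc r \<noteq> 0 \<and> sel")
      case True
      have "OP v \<subseteq> Select ` {1..2 ^ b}"
      proof
        fix z assume "z \<in> OP v"
        then obtain y where y: "y \<in> X" "z = ops (ov y) \<kappa> v"
          by (auto simp: OP_def)
        have "v < 2 ^ m * Suc r"
          using v ult by simp
        then have "\<kappa> v \<in> query_set m a"
          using \<kappa> by (auto simp: query_choices_def)
        then show "z \<in> Select ` {1..2 ^ b}"
          using y True bounded[OF _ ov[OF y(1)], of "v div Suc r" "\<kappa> v"] t_less[of v] v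
          by (simp add: block_op_def Let_def)
      qed
      then have "card (OP v) \<le> card (Select ` {1..2 ^ b})"
        by (intro card_mono) auto
      also have "\<dots> \<le> card {1..2 ^ b :: int}"
        by (intro card_image_le) auto
      finally show ?thesis by (simp add: nat_power_eq)
    next
      case False
      obtain y0 where y0: "y0 \<in> X"
        using X0 by auto
      have "ops (ov y) \<kappa> v = ops (ov y0) \<kappa> v" for y
      proof (cases "v mod Suc r = 0")
        case True
        with update_eq[of v y y0] v show ?thesis by simp
      next
        case nonzero: False
        with False show ?thesis
          by (simp add: block_op_def Let_def query_op_def)
      qed
      then have "OP v \<subseteq> {ops (ov y0) \<kappa> v}"
        by (auto simp: OP_def)
      then have "card (OP v) \<le> 1"
        using card_mono[of "{ops (ov y0) \<kappa> v}" "OP v"] by simp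
      also have "1 \<le> (2 :: nat) ^ b"
        by simp
      finally show ?thesis .
    qed
  qed
  have mem_less: "mem_at D M f v c < 2 ^ b" if "c < 2 ^ b" for f v c
    using valid_memory_mem_at[OF wf] that by (simp add: valid_memory_def)
  have "card X * (ln (card X) - 1 - real (card {s1..<u}) * b - card (U \<times> {..a}) / 32) \<le>
    (\<Sum>y\<in>X. 2 * real b * card {c. c < 2 ^ b \<and> I y c \<noteq> None} +
      5 * real (card {z\<in>U \<times> {..a}. S y z \<noteq> None}))"
  proof (rule encoding_bound[OF finX X0 inj])
    show "I y \<in> PiE {..<2 ^ b} (\<lambda>_. insert None (Some ` {..<2 ^ b}))" for y
      using mem_less by (auto simp: I_def)
    show "F y \<in> PiE {s1..<u} OP" if "y \<in> X" for y
      using that by (auto simp: F_def OP_def)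
    show "S y \<in> PiE (U \<times> {..a}) (\<lambda>_. UNIV)" for y
      by (auto simp: S_def)
  qed (use OP finU in auto)
  also have "\<dots> \<le> (\<Sum>y\<in>X. 2 * real b * (\<Sum>v\<in>{start i u..<u}. transfer i (ov y) \<kappa> v) +
      5 * real (\<Sum>p\<in>U. \<Sum>l\<le>a. \<Sum>e<2. transfer i (ov y) (\<kappa>(u := (p + j, l, e))) u))"
  proof (intro sum_mono add_mono mult_left_mono)
    fix y
    have "card {c. c < 2 ^ b \<and> I y c \<noteq> None} \<le> card (Rs y)"
      using finite_subset[OF input_cells_less] by (intro card_mono) (auto simp: I_def Rs_def split: if_splits)
    also have "\<dots> \<le> (\<Sum>v\<in>{start i u..<u}. transfer i (ov y) \<kappa> v)"
      using card_input_cells_le[of "ov y" \<kappa> i u] unfolding Rs_def epoch s1_def .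
    finally show "real (card {c. c < 2 ^ b \<and> I y c \<noteq> None}) \<le>
        real (\<Sum>v\<in>{start i u..<u}. transfer i (ov y) \<kappa> v)"
      by (simp only: of_nat_le_iff)
    have "card {z\<in>U \<times> {..a}. S y z \<noteq> None} = (\<Sum>z\<in>U \<times> {..a}. if S y z \<noteq> None then 1 else 0)"
      using finU by (simp add: sum.If_cases Int_def)
    also have "\<dots> \<le> (\<Sum>(p, l)\<in>U \<times> {..a}. \<Sum>e<2. transfer i (ov y) (\<kappa>(u := (p + j, l, e))) u)"
    proof (intro sum_mono, clarify)
      fix p l assume pl: "p \<in> U" "l \<le> a"
      show "(if S y (p, l) \<noteq> None then 1 else 0) \<le> (\<Sum>e<2. transfer i (ov y) (\<kappa>(u := (p + j, l, e))) u)"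
      proof (cases "bad y p l")
        case True
        then obtain e where e: "e < 2" "transfer i (ov y) (\<kappa>(u := (p + j, l, e))) u \<noteq> 0"
          by (auto simp: bad_def)
        then have "1 \<le> transfer i (ov y) (\<kappa>(u := (p + j, l, e))) u"
          by simp
        also have "\<dots> \<le> (\<Sum>e<2. transfer i (ov y) (\<kappa>(u := (p + j, l, e))) u)"
          using e(1) by (intro member_le_sum) auto
        finally show ?thesis by simp
      qed (use pl in \<open>simp add: S_def\<close>)
    qed
    also have "\<dots> = (\<Sum>p\<in>U. \<Sum>l\<le>a. \<Sum>e<2. transfer i (ov y) (\<kappa>(u := (p + j, l, e))) u)"
      by (rule sum.cartesian_product[symmetric])
    finally show "real (card {z\<in>U \<times> {..a}. S y z \<noteq> None}) \<le>
        real (\<Sum>p\<in>U. \<Sum>l\<le>a. \<Sum>e<2. transfer i (ov y) (\<kappa>(u := (p + j, l, e))) u)"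
      by (simp only: of_nat_le_iff)
  qed auto
  finally have main: "card X * (ln (card X) - 1 - real (card {s1..<u}) * b - card (U \<times> {..a}) / 32) \<le>
    (\<Sum>y\<in>X. 2 * real b * (\<Sum>v\<in>{start i u..<u}. transfer i (ov y) \<kappa> v) +
      5 * real (\<Sum>p\<in>U. \<Sum>l\<le>a. \<Sum>e<2. transfer i (ov y) (\<kappa>(u := (p + j, l, e))) u))" .
  \<comment> \<open>In units of \<open>B = a * card U\<close>: the logarithm gives at least 2/3,
    from \<open>ln 2\<close>; the constant 1 takes at most 1/39, the replay 1/10 and the comparisons
    1/16. More than 2/5 is left. The 39 is \<open>2 ^ g - 1\<close> with
    \<open>2 ^ w \<ge> 80\<close>, which follows from \<open>params\<close> with
    \<open>r \<ge> 1\<close>.\<close>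
  have "real (card X) * (2 / 5 * a * card U) \<le>
      card X * (ln (card X) - 1 - real (card {s1..<u}) * b - card (U \<times> {..a}) / 32)"
  proof (rule mult_left_mono)
    define B :: real where "B = a * real (card U)"
    have "ln (card X) = B * ln 2"
      by (simp add: cardX B_def ln_realpow power_mult[symmetric])
    moreover have "B * (2 / 3) \<le> B * ln 2"
      using ln2_ge_two_thirds by (intro mult_left_mono) (auto simp: B_def)
    ultimately have lnX: "2 / 3 * B \<le> ln (card X)"
      by simp
    have "80 * b \<le> 40 * b * Suc r"
      using params(4) by simp
    also have "\<dots> \<le> b * 2 ^ w"
      using params(5) mult_right_mono[OF params(2), of "2 ^ w"] by linarith
    finally have "b * 80 \<le> b * 2 ^ w"
      by simp
    then have "80 \<le> (2 :: nat) ^ w"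
      using params(1,2) by simp
    also have "(2 :: nat) ^ w \<le> 2 ^ Suc g"
      using g by (intro power_increasing) auto
    finally have g40: "40 \<le> (2 :: nat) ^ g"
      by simp
    then have U39: "39 \<le> card U" "2 ^ g \<le> 2 * card U"
      using U(2) by auto
    have B: "39 \<le> B"
    proof -
      have "39 * 1 \<le> card U * a"
        using U39 params(1) by (intro mult_le_mono) auto
      then have "real 39 \<le> real (card U * a)"
        by (simp only: of_nat_le_iff)
      then show ?thesis by (simp add: B_def mult.commute)
    qed
    have replay: "real (card {s1..<u}) * b \<le> B / 10"
    proof -
      have "u - s1 = u mod grain i"
        by (simp add: s1_def start_def minus_mult_div_eq_mod)
      then have "card {s1..<u} \<le> grain i"
        by (simp add: less_imp_le)
      then have "40 * (card {s1..<u} * b) \<le> 40 * (grain i * b)"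
        by simp
      also have "40 * (grain i * b) = (40 * b * Suc r) * 2 ^ (w * i)"
        by (simp add: grain_def algebra_simps)
      also have "\<dots> \<le> (a * 2 ^ w) * 2 ^ (w * i)"
        by (intro mult_right_mono params(5)) simp
      also have "\<dots> = a * 2 ^ Suc g"
        unfolding g by (simp add: power_add)
      also have "\<dots> \<le> a * (4 * card U)"
        using U39(2) by (intro mult_left_mono) auto
      finally have "real (40 * (card {s1..<u} * b)) \<le> real (a * (4 * card U))"
        by (simp only: of_nat_le_iff)
      then show ?thesis
        by (simp add: B_def mult_ac)
    qed
    have steps: "card (U \<times> {..a}) / 32 \<le> B / 16"
    proof -
      have "card (U \<times> {..a}) \<le> card U * (2 * a)"
        using params(1) by (simp add: card_cartesian_product)
      then have "real (card (U \<times> {..a})) \<le> real (card U * (2 * a))"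
        by (simp only: of_nat_le_iff)
      then show ?thesis
        by (simp add: B_def mult_ac)
    qed
    have "2 / 5 * real a * real (card U) = 2 / 5 * B"
      by (simp add: B_def)
    also have "\<dots> \<le> ln (card X) - 1 - real (card {s1..<u}) * b - card (U \<times> {..a}) / 32"
      using lnX replay steps B by linarith
    finally show "2 / 5 * real a * real (card U) \<le>
        ln (card X) - 1 - real (card {s1..<u}) * b - card (U \<times> {..a}) / 32" .
  qed simp
  with main show ?thesis
    unfolding ov_def by linarith
qed

section \<open>Averaging over values, queries and levels\<close>

lemma sum_windows_le:
  fixes f :: "nat \<Rightarrow> real"
  assumes "\<And>v. 0 \<le> f v"
  shows "(\<Sum>u<B. \<Sum>v\<in>{start i u..<u}. f v) \<le> grain i * (\<Sum>v<B. f v)"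
proof -
  have "(\<Sum>u<B. \<Sum>v\<in>{start i u..<u}. f v) = (\<Sum>u<B. \<Sum>v<B. if v \<in> {start i u..<u} then f v else 0)"
    by (intro sum.cong refl sum.mono_neutral_cong_left) auto
  also have "\<dots> = (\<Sum>v<B. \<Sum>u<B. if v \<in> {start i u..<u} then f v else 0)"
    by (rule sum.swap)
  also have "\<dots> \<le> (\<Sum>v<B. grain i * f v)"
  proof (rule sum_mono)
    fix v
    \<comment> \<open>A window is shorter than a level-\<open>i\<close> block, so \<open>v\<close>
      lies in at most \<open>grain i\<close> of them.\<close>
    have "{u\<in>{..<B}. v \<in> {start i u..<u}} \<subseteq> {v..<v + grain i}"
    proof
      fix u assume u: "u \<in> {u\<in>{..<B}. v \<in> {start i u..<u}}"
      have "u = start i u + u mod grain i"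
        by (simp add: start_def)
      moreover have "u mod grain i < grain i"
        by simp
      ultimately have "u < start i u + grain i"
        by linarith
      with u show "u \<in> {v..<v + grain i}" by auto
    qed
    then have "card {u\<in>{..<B}. v \<in> {start i u..<u}} \<le> grain i"
      using card_mono[of "{v..<v + grain i}"] by simp
    then have "real (card {u\<in>{..<B}. v \<in> {start i u..<u}}) * f v \<le> grain i * f v"
      by (intro mult_right_mono assms) simp
    then show "(\<Sum>u<B. if v \<in> {start i u..<u} then f v else 0) \<le> grain i * f v"
      by (simp add: sum.If_cases Int_def)
  qed
  finally show ?thesis
    by (simp add: sum_distrib_left)
qed

text \<open>The averaged form of the encoding bound, divided by \<open>2 / 5 * a * c * L\<close>. On
  average, the reads in the node before \<open>u\<close> or those of \<open>u\<close> itself must be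
  many. The factor \<open>1 / (2 * grain i)\<close> will become 1/2 when the windows are summed over
  \<open>u\<close>; the factor 100 is \<open>40 / (2 / 5)\<close>.\<close>

lemma level_cost:
  fixes h l\<^sub>0 q g i u :: nat
  assumes i: "i < d" and g: "Suc g = w * Suc i"
    and T: "l\<^sub>0 < 2 ^ g" "h < 2 ^ (m - Suc g)"
    and u: "u = Suc r * ((2 * h + 1) * 2 ^ g + l\<^sub>0) + Suc q" "q < r"
  shows "real (card (item_values m a)) * real (card (query_choices m a r)) \<le>
    (\<Sum>x\<in>item_values m a. \<Sum>\<kappa>\<in>query_choices m a r.
      (\<Sum>v\<in>{start i u..<u}. real (transfer i x \<kappa> v)) / (2 * grain i) + 100 * real (transfer i x \<kappa> u))"
proof -
  let ?IV = "item_values m a" and ?QC = "query_choices m a r"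
  define L :: nat where "L = 2 ^ (m - g)"
  have gm: "Suc g \<le> m"
    unfolding g using i by (intro mult_le_mono2) simp
  have Tm: "(2 * h + 1) * 2 ^ g + l\<^sub>0 < 2 ^ m"
  proof -
    have "(2 * h + 1) * 2 ^ g + l\<^sub>0 < (2 * h + 2) * 2 ^ g"
      using T(1) by (simp add: algebra_simps)
    also have "\<dots> = Suc h * 2 ^ Suc g"
      by simp
    also have "\<dots> \<le> 2 ^ (m - Suc g) * 2 ^ Suc g"
      using T(2) by (intro mult_right_mono) auto
    also have "\<dots> = 2 ^ m"
      using gm by (simp only: power_add[symmetric] le_add_diff_inverse2)
    finally show ?thesis .
  qed
  have h2: "2 * h < 2 ^ (m - g)"
  proof -
    have "2 * h < 2 ^ Suc (m - Suc g)"
      using T(2) by simp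
    then show ?thesis
      using gm by (simp only: Suc_diff_le[symmetric] diff_Suc_Suc)
  qed
  obtain U where U: "U \<subseteq> bitrev m ` {2 * h * 2 ^ g..<Suc (2 * h) * 2 ^ g}" "card U = 2 ^ g - 1"
      and room: "\<And>p. p \<in> U \<Longrightarrow> p + L < 2 ^ m"
      and sep: "\<And>p p'. p \<in> U \<Longrightarrow> p' \<in> U \<Longrightarrow> p < p' \<Longrightarrow> p + L \<le> p'"
    using bitrev_block[OF Suc_leD[OF gm] h2] unfolding L_def by metis
  define c where "c = card U"
  have finU: "finite U"
    using U(1) finite_surj by blast
  define X where "X = PiE U (\<lambda>_. {..<2 ^ a :: nat})"
  define IT where "IT = (\<lambda>x \<kappa>. \<Sum>v\<in>{start i u..<u}. real (transfer i x \<kappa> v))"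
  define Q where "Q = (\<lambda>x \<kappa>. \<Sum>z\<in>query_set m a. real (transfer i x (\<kappa>(u := z)) u))"
  have cardX: "0 < card X"
    using finU by (simp add: X_def card_PiE)
  have ult: "u < 2 ^ m * Suc r"
  proof -
    have "u < Suc r * ((2 * h + 1) * 2 ^ g + l\<^sub>0) + Suc r"
      using u by simp
    also have "\<dots> = Suc r * Suc ((2 * h + 1) * 2 ^ g + l\<^sub>0)"
      by simp
    also have "\<dots> \<le> Suc r * 2 ^ m"
      using Tm by (intro mult_left_mono) auto
    finally show ?thesis by (simp add: mult.commute)
  qed
  \<comment> \<open>Summing over the shift \<open>j\<close> lets the bad comparisons range over all
    items, each at most once, which gives the full query set \<open>Q\<close>.\<close>
  have one: "real L * (real (card X) * (2 / 5 * a * c)) \<le>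
      (\<Sum>y\<in>X. 2 * b * L * IT (override_on x y U) \<kappa> + 5 * Q (override_on x y U) \<kappa>)"
    if x: "x \<in> ?IV" and \<kappa>: "\<kappa> \<in> ?QC" for x \<kappa>
  proof -
    let ?R = "\<lambda>y k. \<Sum>l\<le>a. \<Sum>e<2. real (transfer i (override_on x y U) (\<kappa>(u := (k, l, e))) u)"
    have "real L * (real (card X) * (2 / 5 * a * c)) = (\<Sum>j<L. real (card X) * (2 / 5 * a * c))"
      by simp
    also have "\<dots> \<le> (\<Sum>j<L. \<Sum>y\<in>X. 2 * real b * IT (override_on x y U) \<kappa> + 5 * (\<Sum>p\<in>U. ?R y (p + j)))"
    proof (rule sum_mono)
      fix j assume "j \<in> {..<L}"
      then have "j < 2 ^ (m - g)" by (simp add: L_def)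
      from level_encoding[OF i g T(1) Tm u U room[unfolded L_def] sep[unfolded L_def] this x \<kappa>]
      show "real (card X) * (2 / 5 * a * c) \<le>
          (\<Sum>y\<in>X. 2 * real b * IT (override_on x y U) \<kappa> + 5 * (\<Sum>p\<in>U. ?R y (p + j)))"
        by (simp add: X_def c_def IT_def)
    qed
    also have "\<dots> = (\<Sum>y\<in>X. \<Sum>j<L. 2 * real b * IT (override_on x y U) \<kappa> + 5 * (\<Sum>p\<in>U. ?R y (p + j)))"
      by (rule sum.swap)
    also have "\<dots> \<le> (\<Sum>y\<in>X. 2 * b * L * IT (override_on x y U) \<kappa> + 5 * Q (override_on x y U) \<kappa>)"
    proof (rule sum_mono)
      fix y
      have "(\<Sum>j<L. \<Sum>p\<in>U. ?R y (p + j)) \<le> (\<Sum>k<2 ^ m. ?R y k)"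
        using room sep finU by (intro sum_separated_le) (auto intro!: sum_nonneg)
      also have "\<dots> = Q (override_on x y U) \<kappa>"
        by (simp add: Q_def query_set_def sum.cartesian_product)
      finally show "(\<Sum>j<L. 2 * real b * IT (override_on x y U) \<kappa> + 5 * (\<Sum>p\<in>U. ?R y (p + j))) \<le>
          2 * b * L * IT (override_on x y U) \<kappa> + 5 * Q (override_on x y U) \<kappa>"
        by (simp add: sum.distrib sum_distrib_left[symmetric])
    qed
    finally show ?thesis .
  qed
  have UI: "U \<subseteq> {..<2 ^ m}"
    using room by (auto dest!: room)
  \<comment> \<open>The encoding varies only the values on \<open>U\<close>; resampling
    \<open>U\<close> turns this into an average over all item values.\<close>
  have two: "real (card ?IV) * (L * (2 / 5 * a * c)) \<le> (\<Sum>x\<in>?IV. 2 * b * L * IT x \<kappa> + 5 * Q x \<kappa>)"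
    if \<kappa>: "\<kappa> \<in> ?QC" for \<kappa>
  proof -
    have "real (card ?IV) * (real L * (real (card X) * (2 / 5 * a * c))) =
        (\<Sum>x\<in>?IV. real L * (real (card X) * (2 / 5 * a * c)))"
      by simp
    also have "\<dots> \<le> (\<Sum>x\<in>?IV. \<Sum>y\<in>X. 2 * b * L * IT (override_on x y U) \<kappa> + 5 * Q (override_on x y U) \<kappa>)"
      by (intro sum_mono one \<kappa>)
    also have "\<dots> = card X * (\<Sum>x\<in>?IV. 2 * b * L * IT x \<kappa> + 5 * Q x \<kappa>)"
      unfolding item_values_def X_def by (rule sum_PiE_override[OF UI])
    finally have "real (card X) * (real (card ?IV) * (L * (2 / 5 * a * c))) \<le>
        real (card X) * (\<Sum>x\<in>?IV. 2 * b * L * IT x \<kappa> + 5 * Q x \<kappa>)"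
      by (simp only: mult_ac)
    with cardX show ?thesis by simp
  qed
  \<comment> \<open>Likewise for the query of \<open>u\<close>: the sum over all its alternatives is
    an average over \<open>\<kappa>\<close>.\<close>
  have upd: "(\<Sum>\<kappa>\<in>?QC. Q x \<kappa>) = card (query_set m a) * (\<Sum>\<kappa>\<in>?QC. real (transfer i x \<kappa> u))" for x
    unfolding Q_def query_choices_def using ult by (intro sum_PiE_update) auto
  have "80 \<le> (2 :: nat) ^ w"
  proof -
    have "80 * b \<le> 40 * b * Suc r"
      using params(4) by simp
    also have "\<dots> \<le> b * 2 ^ w"
      using params(5) mult_right_mono[OF params(2), of "2 ^ w"] by linarith
    finally have "b * 80 \<le> b * 2 ^ w"
      by simp
    then show ?thesis
      using params(1,2) by simp
  qed
  also have "(2 :: nat) ^ w \<le> 2 ^ Suc g"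
    using g by (intro power_increasing) auto
  finally have c2: "2 ^ g \<le> 2 * c" "0 < c"
    using U(2) by (auto simp: c_def)
  have Lpos: "0 < L"
    by (simp add: L_def)
  \<comment> \<open>\<open>query_set\<close> has \<open>2 ^ m * (a + 1) * 2\<close> elements; here
    \<open>2 ^ m \<le> 2 * c * L\<close> and \<open>a + 1 \<le> 2 * a\<close>.\<close>
  have qs: "5 * real (card (query_set m a)) \<le> 40 * (a * c * L)"
  proof -
    have "(2 :: nat) ^ m = 2 ^ g * L"
      using gm by (simp add: L_def power_add[symmetric])
    also have "\<dots> \<le> 2 * c * L"
      using c2 by (intro mult_right_mono) auto
    finally have "2 ^ m * (Suc a * 2) \<le> (2 * c * L) * ((2 * a) * 2)"
      using params(1) by (intro mult_le_mono) auto
    then have "5 * card (query_set m a) \<le> 40 * (a * c * L)"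
      by (simp add: query_set_def card_cartesian_product algebra_simps)
    then have "real (5 * card (query_set m a)) \<le> real (40 * (a * c * L))"
      by (simp only: of_nat_le_iff)
    then show ?thesis by simp
  qed
  have price: "5 * real b * (2 * grain i) \<le> a * c"
  proof -
    have "40 * b * grain i = (40 * b * Suc r) * 2 ^ (w * i)"
      by (simp add: grain_def algebra_simps)
    also have "\<dots> \<le> (a * 2 ^ w) * 2 ^ (w * i)"
      by (intro mult_right_mono params(5)) simp
    also have "\<dots> = a * 2 ^ Suc g"
      unfolding g by (simp add: power_add)
    also have "\<dots> \<le> a * (4 * c)"
      using c2 by (intro mult_left_mono) auto
    finally have "real (40 * b * grain i) \<le> real (a * (4 * c))"
      by (simp only: of_nat_le_iff)
    then show ?thesis by simp
  qed
  have "real (card ?QC) * (real (card ?IV) * (L * (2 / 5 * a * c))) =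
      (\<Sum>\<kappa>\<in>?QC. real (card ?IV) * (L * (2 / 5 * a * c)))"
    by simp
  also have "\<dots> \<le> (\<Sum>\<kappa>\<in>?QC. \<Sum>x\<in>?IV. 2 * b * L * IT x \<kappa> + 5 * Q x \<kappa>)"
    by (intro sum_mono two)
  also have "\<dots> = (\<Sum>x\<in>?IV. \<Sum>\<kappa>\<in>?QC. 2 * b * L * IT x \<kappa> + 5 * Q x \<kappa>)"
    by (rule sum.swap)
  also have "\<dots> = (\<Sum>x\<in>?IV. \<Sum>\<kappa>\<in>?QC. 2 * b * L * IT x \<kappa> +
      5 * real (card (query_set m a)) * real (transfer i x \<kappa> u))"
    by (simp add: sum.distrib sum_distrib_left[symmetric] upd mult.assoc)
  also have "\<dots> \<le> (\<Sum>x\<in>?IV. \<Sum>\<kappa>\<in>?QC. (L * (2 / 5 * a * c)) *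
      (IT x \<kappa> / (2 * grain i) + 100 * real (transfer i x \<kappa> u)))"
  proof (intro sum_mono)
    fix x \<kappa>
    have IT: "0 \<le> IT x \<kappa>"
      by (simp add: IT_def sum_nonneg)
    have "2 * real b * L \<le> L * (2 / 5 * a * c) / (2 * grain i)"
    proof -
      have "real L * (5 * real b * (2 * grain i)) \<le> real L * real (a * c)"
        by (intro mult_left_mono price) simp
      then show ?thesis
        by (simp add: field_simps)
    qed
    then have "2 * real b * L * IT x \<kappa> \<le> L * (2 / 5 * a * c) / (2 * grain i) * IT x \<kappa>"
      using IT by (rule mult_right_mono)
    moreover have "5 * real (card (query_set m a)) * real (transfer i x \<kappa> u) \<le>
        40 * (a * c * L) * real (transfer i x \<kappa> u)"
      using qs by (rule mult_right_mono) simp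
    ultimately show "2 * b * L * IT x \<kappa> + 5 * real (card (query_set m a)) * real (transfer i x \<kappa> u) \<le>
        (L * (2 / 5 * a * c)) * (IT x \<kappa> / (2 * grain i) + 100 * real (transfer i x \<kappa> u))"
      by (simp add: algebra_simps)
  qed
  also have "\<dots> = (L * (2 / 5 * a * c)) *
      (\<Sum>x\<in>?IV. \<Sum>\<kappa>\<in>?QC. IT x \<kappa> / (2 * grain i) + 100 * real (transfer i x \<kappa> u))"
    by (simp only: sum_distrib_left)
  finally have "(L * (2 / 5 * a * c)) * (real (card ?IV) * real (card ?QC)) \<le> (L * (2 / 5 * a * c)) *
      (\<Sum>x\<in>?IV. \<Sum>\<kappa>\<in>?QC. IT x \<kappa> / (2 * grain i) + 100 * real (transfer i x \<kappa> u))"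
    by (simp only: mult_ac)
  moreover have "0 < L * (2 / 5 * a * c)"
    using Lpos c2 params(1) by simp
  ultimately have "real (card ?IV) * real (card ?QC) \<le>
      (\<Sum>x\<in>?IV. \<Sum>\<kappa>\<in>?QC. IT x \<kappa> / (2 * grain i) + 100 * real (transfer i x \<kappa> u))"
    by (rule mult_left_le_imp_le)
  then show ?thesis
    by (simp only: IT_def)
qed

text \<open>Half of all queries lie in second halves of level-\<open>i + 1\<close> blocks, where the
  previous bound applies. Windows contribute 1/2 and queries 100 times the total transfer; this is
  rounded up to 101 and doubled.\<close>

lemma level_total:
  assumes i: "i < d"
  shows "r * 2 ^ m * (real (card (item_values m a)) * real (card (query_choices m a r))) \<le>
    202 * (\<Sum>x\<in>item_values m a. \<Sum>\<kappa>\<in>query_choices m a r.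
      \<Sum>v<2 ^ m * Suc r. real (transfer i x \<kappa> v))"
proof -
  let ?IV = "item_values m a" and ?QC = "query_choices m a r" and ?B = "2 ^ m * Suc r"
  define g where "g = w * Suc i - 1"
  have g: "Suc g = w * Suc i"
    using params(3) by (simp add: g_def)
  have gm: "Suc g \<le> m"
    unfolding g using i by (intro mult_le_mono2) simp
  \<comment> \<open>Query \<open>q\<close> of round \<open>l\<close> in the second half of block
    \<open>h\<close>; \<open>Suc q\<close> skips the update that opens the round.\<close>
  define pos where "pos = (\<lambda>(h, l, q). Suc r * ((2 * h + 1) * 2 ^ g + l) + Suc q)"
  define V where "V = pos ` ({..<2 ^ (m - Suc g)} \<times> {..<2 ^ g} \<times> {..<r})"
  have div: "pos (h, l, q) div Suc r = (2 * h + 1) * 2 ^ g + l"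
    and mod: "pos (h, l, q) mod Suc r = Suc q" if "q < r" for h l q
  proof -
    have eq: "pos (h, l, q) = Suc q + ((2 * h + 1) * 2 ^ g + l) * Suc r"
      by (simp add: pos_def)
    show "pos (h, l, q) div Suc r = (2 * h + 1) * 2 ^ g + l"
      unfolding eq using div_mult_self1[of "Suc r" "Suc q" "(2 * h + 1) * 2 ^ g + l"] that by simp
    show "pos (h, l, q) mod Suc r = Suc q"
      unfolding eq using mod_mult_self1[of "Suc q" "(2 * h + 1) * 2 ^ g + l" "Suc r"] that by simp
  qed
  have "inj_on pos ({..<2 ^ (m - Suc g)} \<times> {..<2 ^ g} \<times> {..<r})"
  proof (rule inj_onI)
    fix z z' assume z: "z \<in> {..<2 ^ (m - Suc g)} \<times> {..<2 ^ g} \<times> {..<r}"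
      "z' \<in> {..<2 ^ (m - Suc g)} \<times> {..<2 ^ g} \<times> {..<r}" "pos z = pos z'"
    obtain h l q h' l' q' where zz: "z = (h, l, q)" "z' = (h', l', q')"
      by (cases z; cases z') blast
    have lt: "l < 2 ^ g" "l' < 2 ^ g" "q < r" "q' < r" and eq: "pos (h, l, q) = pos (h', l', q')"
      using z by (auto simp: zz)
    have q: "q = q'"
      using mod[of q h l] mod[of q' h' l'] eq lt by simp
    have hl: "(2 * h + 1) * 2 ^ g + l = (2 * h' + 1) * 2 ^ g + l'"
      using div[of q h l] div[of q' h' l'] eq lt by simp
    have "((2 * x + 1) * 2 ^ g + y) div 2 ^ g = 2 * x + 1" if "y < 2 ^ g" for x y :: nat
      using that by (intro div_nat_eqI) (auto simp: algebra_simps)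
    then have "2 * h + 1 = 2 * h' + 1"
      using hl lt by metis
    with hl q show "z = z'" by (simp add: zz)
  qed
  then have "card V = 2 ^ (m - Suc g) * (2 ^ g * r)"
    unfolding V_def by (subst card_image) auto
  then have "2 * card V = (2 ^ (m - Suc g) * 2 ^ Suc g) * r"
    by simp
  also have "2 ^ (m - Suc g) * 2 ^ Suc g = (2 :: nat) ^ m"
    using gm by (simp only: power_add[symmetric] le_add_diff_inverse2)
  finally have cardV: "2 * card V = 2 ^ m * r" .
  have VB: "V \<subseteq> {..<?B}"
  proof
    fix u assume "u \<in> V"
    then obtain h l q where *: "h < 2 ^ (m - Suc g)" "l < 2 ^ g" "q < r" "u = pos (h, l, q)"
      by (auto simp: V_def)
    have "(2 * h + 1) * 2 ^ g + l < (2 * h + 2) * 2 ^ g"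
      using * by (simp add: algebra_simps)
    also have "\<dots> = Suc h * 2 ^ Suc g"
      by simp
    also have "\<dots> \<le> 2 ^ (m - Suc g) * 2 ^ Suc g"
      using * by (intro mult_right_mono) auto
    also have "\<dots> = 2 ^ m"
      using gm by (simp only: power_add[symmetric] le_add_diff_inverse2)
    finally have "u div Suc r < 2 ^ m"
      using div[of q h l] * by simp
    then show "u \<in> {..<?B}"
      using div_less_iff_less_mult[of "Suc r" u "2 ^ m"] by simp
  qed
  have finV: "finite V"
    by (simp add: V_def)
  let ?t = "\<lambda>x \<kappa> v. real (transfer i x \<kappa> v)"
  have "card V * (real (card ?IV) * real (card ?QC)) = (\<Sum>u\<in>V. real (card ?IV) * real (card ?QC))"
    by simp
  also have "\<dots> \<le> (\<Sum>u\<in>V. \<Sum>x\<in>?IV. \<Sum>\<kappa>\<in>?QC.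
      (\<Sum>v\<in>{start i u..<u}. ?t x \<kappa> v) / (2 * grain i) + 100 * ?t x \<kappa> u)"
  proof (rule sum_mono)
    fix u assume "u \<in> V"
    then obtain h l q where *: "h < 2 ^ (m - Suc g)" "l < 2 ^ g" "q < r" "u = pos (h, l, q)"
      by (auto simp: V_def)
    show "real (card ?IV) * real (card ?QC) \<le> (\<Sum>x\<in>?IV. \<Sum>\<kappa>\<in>?QC.
      (\<Sum>v\<in>{start i u..<u}. ?t x \<kappa> v) / (2 * grain i) + 100 * ?t x \<kappa> u)"
      by (rule level_cost[OF i g *(2,1) _ *(3)]) (simp add: *(4) pos_def)
  qed
  also have "\<dots> = (\<Sum>x\<in>?IV. \<Sum>u\<in>V. \<Sum>\<kappa>\<in>?QC.
      (\<Sum>v\<in>{start i u..<u}. ?t x \<kappa> v) / (2 * grain i) + 100 * ?t x \<kappa> u)"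
    by (rule sum.swap)
  also have "\<dots> = (\<Sum>x\<in>?IV. \<Sum>\<kappa>\<in>?QC. \<Sum>u\<in>V.
      (\<Sum>v\<in>{start i u..<u}. ?t x \<kappa> v) / (2 * grain i) + 100 * ?t x \<kappa> u)"
    by (intro sum.cong refl sum.swap)
  also have "\<dots> \<le> (\<Sum>x\<in>?IV. \<Sum>\<kappa>\<in>?QC. 101 * (\<Sum>v<?B. ?t x \<kappa> v))"
  proof (intro sum_mono)
    fix x \<kappa>
    have "(\<Sum>u\<in>V. \<Sum>v\<in>{start i u..<u}. ?t x \<kappa> v) \<le> (\<Sum>u<?B. \<Sum>v\<in>{start i u..<u}. ?t x \<kappa> v)"
      using VB by (intro sum_mono2 sum_nonneg) auto
    also have "\<dots> \<le> grain i * (\<Sum>v<?B. ?t x \<kappa> v)"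
      by (rule sum_windows_le) simp
    finally have "(\<Sum>u\<in>V. \<Sum>v\<in>{start i u..<u}. ?t x \<kappa> v) / (2 * grain i) \<le> (\<Sum>v<?B. ?t x \<kappa> v) / 2"
      by (simp add: field_simps)
    moreover have "(\<Sum>u\<in>V. ?t x \<kappa> u) \<le> (\<Sum>v<?B. ?t x \<kappa> v)"
      using VB by (intro sum_mono2) auto
    moreover have "0 \<le> (\<Sum>v<?B. ?t x \<kappa> v)"
      by (intro sum_nonneg) simp
    ultimately show "(\<Sum>u\<in>V. (\<Sum>v\<in>{start i u..<u}. ?t x \<kappa> v) / (2 * grain i) + 100 * ?t x \<kappa> u) \<le>
        101 * (\<Sum>v<?B. ?t x \<kappa> v)"
      unfolding sum.distrib sum_divide_distrib[symmetric] sum_distrib_left[symmetric] by linarith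
  qed
  finally have *: "card V * (real (card ?IV) * real (card ?QC)) \<le>
      101 * (\<Sum>x\<in>?IV. \<Sum>\<kappa>\<in>?QC. \<Sum>v<?B. ?t x \<kappa> v)"
    by (simp only: sum_distrib_left)
  have "real (2 * card V) = real (2 ^ m * r)"
    by (simp only: cardV)
  then have "r * 2 ^ m * (real (card ?IV) * real (card ?QC)) =
      2 * (card V * (real (card ?IV) * real (card ?QC)))"
    by simp
  with * show ?thesis by linarith
qed

lemma total_cost:
  "d * r * 2 ^ m * (real (card (item_values m a)) * real (card (query_choices m a r))) \<le>
    202 * (\<Sum>x\<in>item_values m a. \<Sum>\<kappa>\<in>query_choices m a r.
      \<Sum>v<2 ^ m * Suc r. real (op_probes D M (ops x \<kappa>) v))"
proof -
  let ?IV = "item_values m a" and ?QC = "query_choices m a r" and ?B = "2 ^ m * Suc r"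
  let ?t = "\<lambda>i x \<kappa> v. real (transfer i x \<kappa> v)"
  have "d * r * 2 ^ m * (real (card ?IV) * real (card ?QC)) =
      (\<Sum>i<d. r * 2 ^ m * (real (card ?IV) * real (card ?QC)))"
    by simp
  also have "\<dots> \<le> (\<Sum>i<d. 202 * (\<Sum>x\<in>?IV. \<Sum>\<kappa>\<in>?QC. \<Sum>v<?B. ?t i x \<kappa> v))"
    by (intro sum_mono level_total) simp
  also have "\<dots> = 202 * (\<Sum>i<d. \<Sum>x\<in>?IV. \<Sum>\<kappa>\<in>?QC. \<Sum>v<?B. ?t i x \<kappa> v)"
    by (simp only: sum_distrib_left)
  also have "(\<Sum>i<d. \<Sum>x\<in>?IV. \<Sum>\<kappa>\<in>?QC. \<Sum>v<?B. ?t i x \<kappa> v) =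
      (\<Sum>x\<in>?IV. \<Sum>i<d. \<Sum>\<kappa>\<in>?QC. \<Sum>v<?B. ?t i x \<kappa> v)"
    by (rule sum.swap)
  also have "\<dots> = (\<Sum>x\<in>?IV. \<Sum>\<kappa>\<in>?QC. \<Sum>i<d. \<Sum>v<?B. ?t i x \<kappa> v)"
    by (intro sum.cong refl sum.swap)
  also have "\<dots> = (\<Sum>x\<in>?IV. \<Sum>\<kappa>\<in>?QC. \<Sum>v<?B. \<Sum>i<d. ?t i x \<kappa> v)"
    by (intro sum.cong refl sum.swap)
  also have "\<dots> \<le> (\<Sum>x\<in>?IV. \<Sum>\<kappa>\<in>?QC. \<Sum>v<?B. real (op_probes D M (ops x \<kappa>) v))"
    using sum_transfer_le by (intro sum_mono) (simp only: of_nat_sum[symmetric] of_nat_le_iff)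
  finally show ?thesis by simp
qed

end


section \<open>Operation lists\<close>

definition mem_after :: "cp_structure \<Rightarrow> ps_op list \<Rightarrow> memory \<Rightarrow> memory" where
  "mem_after D xs m = fold (\<lambda>x m. snd (run (program D x) m)) xs m"

lemma mem_after_Cons [simp]:
  "mem_after D (x # xs) m = mem_after D xs (snd (run (program D x) m))"
  by (simp add: mem_after_def)

lemma mem_after_Nil [simp]: "mem_after D [] m = m"
  by (simp add: mem_after_def)

lemma total_probes_append:
  "total_probes D (xs @ ys) m = total_probes D xs m + total_probes D ys (mem_after D xs m)"
  by (induction xs arbitrary: m) auto

lemma all_correct_append:
  "all_correct n D A (xs @ ys) m \<longleftrightarrow>
     all_correct n D A xs m \<and> all_correct n D (fold apply_op xs A) ys (mem_after D xs m)"
  by (induction xs arbitrary: A m) auto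

lemma legal_ops_append:
  "legal_ops n b \<delta> fmt Q A (xs @ ys) \<longleftrightarrow>
     legal_ops n b \<delta> fmt Q A xs \<and> legal_ops n b \<delta> fmt Q (fold apply_op xs A) ys"
  by (induction xs arbitrary: A) auto

lemma mem_after_map: "mem_after D (map f [0..<u]) m = mem_at D m f u"
  by (induction u) (auto simp: mem_after_def)

lemma total_probes_map: "total_probes D (map f [0..<u]) m = (\<Sum>v<u. op_probes D m f v)"
  by (induction u) (auto simp: total_probes_append mem_after_map op_probes_def)

lemma all_correct_map:
  assumes "all_correct n D A (map f [0..<u]) m" "v < u"
  shows "correct_answer n (fold apply_op (map f [0..<v]) A) (f v) (op_result D m f v)"
  using assms
proof (induction u)
  case (Suc u)
  then show ?case
    by (cases "v = u") (auto simp: all_correct_append mem_after_map op_result_def)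
qed simp

lemma legal_ops_map:
  assumes "\<And>v. v < u \<Longrightarrow> legal_op n b \<delta> fmt Q (fold apply_op (map f [0..<v]) A) (f v)"
  shows "legal_ops n b \<delta> fmt Q A (map f [0..<u])"
  using assms by (induction u) (auto simp: legal_ops_append)

lemma valid_memory_mem_after:
  assumes "wf_structure b D" "valid_memory b m"
  shows "valid_memory b (mem_after D xs m)"
  using assms(2)
proof (induction xs arbitrary: m)
  case (Cons x xs)
  have "valid_memory b (snd (run (program D x) m))"
    using assms(1) Cons.prems by (auto simp: wf_structure_def intro: valid_memory_run)
  then show ?case
    using Cons.IH by simp
qed simp

lemma valid_memory_initial:
  assumes "wf_structure b D" "m \<in> initial_memories b D"
  shows "valid_memory b m"
  using assms unfolding wf_structure_def valid_memory_def initial_memories_def by fastforce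

text \<open>The number of updates before operation \<open>v\<close> is \<open>v / (r + 1)\<close>
  rounded up.\<close>

lemma updates_before_eq:
  "(v + r) div Suc r = (if v mod Suc r = 0 then v div Suc r else Suc (v div Suc r))"
proof -
  have v: "v = v div Suc r * Suc r + v mod Suc r"
    by (rule div_mult_mod_eq[symmetric])
  have lt: "v mod Suc r < Suc r"
    by simp
  show ?thesis
  proof (cases "v mod Suc r = 0")
    case True
    have "(v + r) div Suc r = v div Suc r"
    proof (rule div_nat_eqI)
      have "v = Suc r * (v div Suc r)"
        using v True by (simp only: mult.commute add_0_right)
      moreover have "Suc r * Suc (v div Suc r) = Suc r * (v div Suc r) + Suc r"
        by simp
      ultimately show "Suc r * (v div Suc r) \<le> v + r" "v + r < Suc r * Suc (v div Suc r)"
        by linarith+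
    qed
    with True show ?thesis by simp
  next
    case False
    have "(v + r) div Suc r = Suc (v div Suc r)"
    proof (rule div_nat_eqI)
      have "Suc r * Suc (v div Suc r) = v div Suc r * Suc r + Suc r"
        by (simp add: mult.commute)
      then show "Suc r * Suc (v div Suc r) \<le> v + r"
        using False v by linarith
      have "Suc r * Suc (Suc (v div Suc r)) = v div Suc r * Suc r + Suc r + Suc r"
        by (simp add: mult.commute)
      then show "v + r < Suc r * Suc (Suc (v div Suc r))"
        using v lt by linarith
    qed
    with False show ?thesis by simp
  qed
qed

lemma block_updates_before:
  "fold apply_op (map (block_op m lo r sel Y x \<kappa>) [0..<v]) Y =
    array_after m lo Y x ((v + r) div Suc r)"
proof (induction v)
  case 0
  then show ?case by (simp add: array_after_def)
next
  case (Suc v)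
  have Suc_eq: "Suc (v + r) div Suc r = Suc (v div Suc r)"
    using div_add_self2[of "Suc r" v] by simp
  show ?case
  proof (cases "v mod Suc r = 0")
    case True
    have "block_op m lo r sel Y x \<kappa> v =
        Update (Suc (bitrev m (v div Suc r))) (lo + int (x (bitrev m (v div Suc r))))"
      using True by (simp add: block_op_def Let_def)
    moreover have "array_after m lo Y x (Suc (v div Suc r)) = (array_after m lo Y x (v div Suc r))
        (Suc (bitrev m (v div Suc r)) := lo + int (x (bitrev m (v div Suc r))))"
      by (auto simp: array_after_def lessThan_Suc fun_eq_iff)
    ultimately show ?thesis
      using True Suc by (simp add: Suc_eq updates_before_eq)
  next
    case False
    have "apply_op (block_op m lo r sel Y x \<kappa> v) A = A" for A
      using False by (auto simp: block_op_def query_op_def Let_def split: prod.splits)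
    then show ?thesis
      using False Suc by (simp add: Suc_eq updates_before_eq)
  qed
qed


section \<open>Finding a cheap block\<close>

definition op_budget :: "real \<Rightarrow> real \<Rightarrow> real \<Rightarrow> ps_op \<Rightarrow> real" where
  "op_budget t_u t_q t_s x = (case x of Update k \<Delta> \<Rightarrow> t_u | Sum k \<Rightarrow> t_q | Select \<sigma> \<Rightarrow> t_s)"

lemma sum_list_op_budget:
  "sum_list (map (op_budget t_u t_q t_s) xs) =
     real (num_updates xs) * t_u + real (num_sums xs) * t_q + real (num_selects xs) * t_s"
proof (induction xs)
  case Nil
  then show ?case
    by (simp add: num_updates_def num_sums_def num_selects_def)
next
  case (Cons x xs)
  then show ?case
    by (cases x) (auto simp: num_updates_def num_sums_def num_selects_def op_budget_def algebra_simps)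
qed

lemma expected_probes_le:
  assumes "amortized_expected_times n b \<delta> fmt Q A0 D t_u t_q t_s" "wf_structure b D"
    and "legal_ops n b \<delta> fmt Q A0 xs"
  shows "(\<Sum>m\<in>initial_memories b D. real (total_probes D xs m)) \<le>
    card (initial_memories b D) * sum_list (map (op_budget t_u t_q t_s) xs)"
proof -
  have "0 < card (initial_memories b D)"
    using initial_memories_nonempty finite_initial_memories[OF assms(2)] by (simp add: card_gt_0_iff)
  moreover have "measure_pmf.expectation (creation_pmf b D) (\<lambda>m. real (total_probes D xs m)) =
      (\<Sum>m\<in>initial_memories b D. real (total_probes D xs m)) / card (initial_memories b D)"
    unfolding creation_pmf_def
    by (intro integral_pmf_of_set initial_memories_nonempty finite_initial_memories assms)
  moreover have "measure_pmf.expectation (creation_pmf b D) (\<lambda>m. real (total_probes D xs m)) \<le>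
      sum_list (map (op_budget t_u t_q t_s) xs)"
    using assms(1,3) by (simp add: amortized_expected_times_def sum_list_op_budget)
  ultimately show ?thesis
    by (simp add: pos_divide_le_eq mult.commute)
qed

text \<open>
  If every reachable ready state made the average block twice as expensive as its budget, then
  appending expensive blocks one after the other would exceed the amortized bound eventually.
\<close>

lemma exists_cheap_block:
  fixes block :: "(nat \<Rightarrow> int) \<Rightarrow> 'w \<Rightarrow> ps_op list" and ready :: "(nat \<Rightarrow> int) \<Rightarrow> bool"
    and B :: real
  assumes times: "amortized_expected_times n b \<delta> fmt Q A0 D t_u t_q t_s" and wf: "wf_structure b D"
    and W: "finite W" "W \<noteq> {}" and B: "0 < B"
    and ys\<^sub>0: "legal_ops n b \<delta> fmt Q A0 ys\<^sub>0" "ready (fold apply_op ys\<^sub>0 A0)"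
    and block: "\<And>A \<omega>. ready A \<Longrightarrow> \<omega> \<in> W \<Longrightarrow> legal_ops n b \<delta> fmt Q A (block A \<omega>)"
      "\<And>A \<omega>. ready A \<Longrightarrow> \<omega> \<in> W \<Longrightarrow> ready (fold apply_op (block A \<omega>) A)"
      "\<And>A \<omega>. \<omega> \<in> W \<Longrightarrow> sum_list (map (op_budget t_u t_q t_s) (block A \<omega>)) = B"
  obtains ys m where "legal_ops n b \<delta> fmt Q A0 ys" "ready (fold apply_op ys A0)"
    "m \<in> initial_memories b D"
    "(\<Sum>\<omega>\<in>W. real (total_probes D (block (fold apply_op ys A0) \<omega>) (mem_after D ys m))) \<le>
       card W * (2 * B)"
proof -
  let ?I = "initial_memories b D"
  let ?cost = "\<lambda>xs. \<Sum>m\<in>?I. real (total_probes D xs m)"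
  let ?budget = "\<lambda>xs. sum_list (map (op_budget t_u t_q t_s) xs)"
  have I: "finite ?I" "?I \<noteq> {}"
    using initial_memories_nonempty finite_initial_memories[OF wf] by auto
  then have cI: "0 < real (card ?I)"
    by (simp add: card_gt_0_iff)
  have "\<exists>ys m. legal_ops n b \<delta> fmt Q A0 ys \<and> ready (fold apply_op ys A0) \<and> m \<in> ?I \<and>
    (\<Sum>\<omega>\<in>W. real (total_probes D (block (fold apply_op ys A0) \<omega>) (mem_after D ys m))) \<le> card W * (2 * B)"
  proof (rule ccontr)
    assume "\<not> ?thesis"
    then have exp: "card W * (2 * B) <
        (\<Sum>\<omega>\<in>W. real (total_probes D (block (fold apply_op ys A0) \<omega>) (mem_after D ys m)))"
      if "legal_ops n b \<delta> fmt Q A0 ys" "ready (fold apply_op ys A0)" "m \<in> ?I" for ys m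
      using that by (meson not_le)
    \<comment> \<open>Every memory makes the average block expensive. Exchanging the two averages
      gives one block that is expensive on average over the memories; it has to be chosen before the
      random cells are known.\<close>
    have step: "\<exists>\<omega>\<in>W. card ?I * (2 * B) \<le>
        (\<Sum>m\<in>?I. real (total_probes D (block (fold apply_op ys A0) \<omega>) (mem_after D ys m)))"
      if ys: "legal_ops n b \<delta> fmt Q A0 ys" "ready (fold apply_op ys A0)" for ys
    proof (rule ccontr)
      let ?c = "\<lambda>\<omega> m. real (total_probes D (block (fold apply_op ys A0) \<omega>) (mem_after D ys m))"
      assume "\<not> ?thesis"
      then have "(\<Sum>m\<in>?I. ?c \<omega> m) \<le> card ?I * (2 * B)" if "\<omega> \<in> W" for \<omega>
        using that by (meson less_imp_le not_le)
      then have "(\<Sum>\<omega>\<in>W. \<Sum>m\<in>?I. ?c \<omega> m) \<le> (\<Sum>\<omega>\<in>W. card ?I * (2 * B))"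
        by (rule sum_mono)
      also have "\<dots> = (\<Sum>m\<in>?I. card W * (2 * B))"
        by simp
      also have "\<dots> < (\<Sum>m\<in>?I. \<Sum>\<omega>\<in>W. ?c \<omega> m)"
        by (intro sum_strict_mono I exp ys)
      finally show False
        by (subst (asm) sum.swap) simp
    qed
    have "\<exists>ys. legal_ops n b \<delta> fmt Q A0 ys \<and> ready (fold apply_op ys A0) \<and>
        ?budget ys = ?budget ys\<^sub>0 + k * B \<and> card ?I * (k * (2 * B)) \<le> ?cost ys" for k :: nat
    proof (induction k)
      case 0
      have "0 \<le> ?cost ys\<^sub>0"
        by (intro sum_nonneg) simp
      with ys\<^sub>0 show ?case
        by (intro exI[of _ ys\<^sub>0]) auto
    next
      case (Suc k)
      then obtain ys where ys: "legal_ops n b \<delta> fmt Q A0 ys" "ready (fold apply_op ys A0)"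
        "?budget ys = ?budget ys\<^sub>0 + k * B" "card ?I * (k * (2 * B)) \<le> ?cost ys"
        by blast
      obtain \<omega> where \<omega>: "\<omega> \<in> W" "card ?I * (2 * B) \<le>
          (\<Sum>m\<in>?I. real (total_probes D (block (fold apply_op ys A0) \<omega>) (mem_after D ys m)))"
        using step[OF ys(1,2)] by blast
      let ?zs = "ys @ block (fold apply_op ys A0) \<omega>"
      have "?cost ?zs = ?cost ys +
          (\<Sum>m\<in>?I. real (total_probes D (block (fold apply_op ys A0) \<omega>) (mem_after D ys m)))"
        by (simp add: total_probes_append sum.distrib)
      with \<omega>(2) ys(4) have "card ?I * (Suc k * (2 * B)) \<le> ?cost ?zs"
        by (simp add: algebra_simps)
      moreover have "?budget ?zs = ?budget ys\<^sub>0 + Suc k * B"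
        using ys(3) block(3)[OF \<omega>(1)] by (simp add: algebra_simps)
      ultimately show ?case
        using ys(1,2) block(1,2)[OF ys(2) \<omega>(1)] by (intro exI[of _ ?zs]) (simp add: legal_ops_append)
    qed
    \<comment> \<open>After \<open>k\<close> blocks the mean cost is at least
      \<open>2 * k * B\<close> against a budget of \<open>k * B\<close> plus that of
      \<open>ys\<^sub>0\<close>; this \<open>k\<close> makes the latter negligible.\<close>
    moreover obtain k :: nat where k: "?budget ys\<^sub>0 < k * B"
      using reals_Archimedean3[OF B] by blast
    ultimately obtain ys where ys: "legal_ops n b \<delta> fmt Q A0 ys"
        "?budget ys = ?budget ys\<^sub>0 + k * B" "card ?I * (k * (2 * B)) \<le> ?cost ys"
      by blast
    have "card ?I * (k * (2 * B)) \<le> card ?I * (?budget ys\<^sub>0 + k * B)"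
      using expected_probes_le[OF times wf ys(1)] ys(2,3) by simp
    then have "k * (2 * B) \<le> ?budget ys\<^sub>0 + k * B"
      using cI by simp
    with k show False by simp
  qed
  with that show thesis by blast
qed

lemma sum_rounds:
  fixes \<alpha> \<beta> :: real
  shows "(\<Sum>v<N * Suc r. if v mod Suc r = 0 then \<alpha> else \<beta>) = N * (\<alpha> + r * \<beta>)"
proof -
  have "(\<Sum>v<N * Suc r. if v mod Suc r = 0 then \<alpha> else \<beta>) =
      (\<Sum>t<N. \<Sum>v\<in>{t * Suc r..<t * Suc r + Suc r}. if v mod Suc r = 0 then \<alpha> else \<beta>)"
    by (rule sum.nat_group[symmetric])
  also have "\<dots> = (\<Sum>t<N. \<alpha> + r * \<beta>)"
  proof (rule sum.cong[OF refl])
    fix t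
    have "(\<Sum>v\<in>{t * Suc r..<t * Suc r + Suc r}. if v mod Suc r = 0 then \<alpha> else \<beta>) =
        (\<Sum>s\<in>{0..<Suc r}. if (s + t * Suc r) mod Suc r = 0 then \<alpha> else \<beta>)"
      using sum.shift_bounds_nat_ivl[of "\<lambda>v. if v mod Suc r = 0 then \<alpha> else \<beta>" 0 "t * Suc r" "Suc r"]
      by (simp add: add.commute)
    also have "\<dots> = (\<Sum>s\<in>{0..<Suc r}. if s = 0 then \<alpha> else \<beta>)"
      by (intro sum.cong) (auto simp del: mult_Suc_right)
    also have "\<dots> = \<alpha> + r * \<beta>"
      by (simp add: sum.atLeast_Suc_lessThan algebra_simps)
    finally show "(\<Sum>v\<in>{t * Suc r..<t * Suc r + Suc r}. if v mod Suc r = 0 then \<alpha> else \<beta>) = \<alpha> + r * \<beta>" .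
  qed
  finally show ?thesis by simp
qed

lemma block_budget:
  "sum_list (map (op_budget t_u t_q t_s) (map (block_op m lo r sel Y x \<kappa>) [0..<N * Suc r])) =
    N * (t_u + r * (if sel then t_s else t_q))"
proof -
  have "op_budget t_u t_q t_s (block_op m lo r sel Y x \<kappa> v) =
      (if v mod Suc r = 0 then t_u else if sel then t_s else t_q)" for v
    by (auto simp: op_budget_def block_op_def query_op_def Let_def split: prod.splits)
  then have "sum_list (map (op_budget t_u t_q t_s) (map (block_op m lo r sel Y x \<kappa>) [0..<N * Suc r])) =
      (\<Sum>v<N * Suc r. if v mod Suc r = 0 then t_u else if sel then t_s else t_q)"
    by (simp add: sum_list_distinct_conv_sum_set atLeast0LessThan interv_sum_list_conv_sum_set_nat del: upt_Suc)
  then show ?thesis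
    by (simp only: sum_rounds)
qed


section \<open>Legal sequences\<close>

fun format_min :: "int_format \<Rightarrow> nat \<Rightarrow> int" where
  "format_min Unsigned a = 0"
| "format_min Signed a = - (2 ^ (a - 1))"
| "format_min Positive a = 1"

definition rest_value :: "int_format \<Rightarrow> int" where
  "rest_value fmt = (if fmt = Positive then 1 else 0)"

lemma ints_of_width_eq:
  assumes "1 \<le> a"
  shows "ints_of_width fmt a = {format_min fmt a..format_min fmt a + 2 ^ a - 1}"
proof -
  have "(2 :: int) ^ a = 2 * 2 ^ (a - 1)"
    using assms by (simp add: power_Suc[symmetric] del: power_Suc)
  then show ?thesis
    by (cases fmt) auto
qed

lemma ints_of_width_mono:
  assumes "1 \<le> a" "a \<le> b"
  shows "ints_of_width fmt a \<subseteq> ints_of_width fmt b"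
proof -
  have "(2 :: int) ^ a \<le> 2 ^ b" "(2 :: int) ^ (a - 1) \<le> 2 ^ (b - 1)"
    using assms by (intro power_increasing; simp)+
  then show ?thesis
    by (cases fmt) auto
qed

lemma rest_value_in_ints: "rest_value fmt \<in> ints_of_width fmt a"
  by (cases fmt) (auto simp: rest_value_def)

text \<open>Only the positions up to \<open>N\<close> and the last one may deviate from the resting
  value; the last is reserved for the large element of a ready array.\<close>

definition sparse :: "nat \<Rightarrow> nat \<Rightarrow> nat \<Rightarrow> int_format \<Rightarrow> (nat \<Rightarrow> int) \<Rightarrow> bool" where
  "sparse n N a fmt A \<longleftrightarrow>
     (\<forall>p\<in>{1..n}. A p \<in> ints_of_width fmt a) \<and> (\<forall>p\<in>{N<..<n}. A p = rest_value fmt)"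

text \<open>At most \<open>N + 1\<close> elements deviate, within a range of \<open>2 ^ a\<close>
  values each, so the deviations use at most half of the cell. The other half takes up the sign, or
  for positive arrays the base sum, which is at most \<open>n\<close>.\<close>

lemma sparse_fits:
  assumes A: "sparse n N a fmt A" and a: "1 \<le> a" "a \<le> b"
    and N: "(N + 1) * 2 ^ a \<le> 2 ^ (b - 1)" and pos: "fmt = Positive \<Longrightarrow> 2 * n \<le> 2 ^ b"
  shows "fits_in_cells n b fmt A"
  unfolding fits_in_cells_def
proof (intro ballI conjI)
  fix k assume k: "k \<in> {1..n}"
  then show "A k \<in> ints_of_width fmt b"
    using A ints_of_width_mono[OF a] unfolding sparse_def by blast
  define z where "z = rest_value fmt"
  define lo where "lo = format_min fmt a - z"
  define hi where "hi = lo + 2 ^ a - 1"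
  define S where "S = {1..k} \<inter> insert n {1..N}"
  have z: "z \<in> ints_of_width fmt a"
    unfolding z_def by (rule rest_value_in_ints)
  then have lohi: "lo \<le> 0" "0 \<le> hi"
    unfolding lo_def hi_def ints_of_width_eq[OF a(1)] by auto
  have val: "lo \<le> A p - z" "A p - z \<le> hi" if "p \<in> S" for p
    using A k that unfolding sparse_def ints_of_width_eq[OF a(1)] S_def lo_def hi_def by force+
  have "psum A k = (\<Sum>p = 1..k. z + (A p - z))"
    by (simp add: psum_def)
  also have "\<dots> = int k * z + (\<Sum>p = 1..k. A p - z)"
    by (simp only: sum.distrib) simp
  also have "(\<Sum>p = 1..k. A p - z) = (\<Sum>p\<in>S. A p - z)"
    using A k unfolding S_def sparse_def z_def by (intro sum.mono_neutral_right) auto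
  finally have psum: "psum A k = int k * z + (\<Sum>p\<in>S. A p - z)" .
  have "card S \<le> card (insert n {1..N})"
    unfolding S_def by (intro card_mono) auto
  also have "\<dots> \<le> N + 1"
    using card_insert_le_m1[of "Suc N" "{1..N}" n] by simp
  finally have cS: "int (card S) \<le> int N + 1"
    by simp
  have "(\<Sum>p\<in>S. A p - z) \<le> int (card S) * hi"
    using val(2) by (rule sum_bounded_above)
  also have "\<dots> \<le> (int N + 1) * hi"
    using cS lohi by (intro mult_right_mono)
  finally have up: "(\<Sum>p\<in>S. A p - z) \<le> (int N + 1) * hi" .
  have "(int N + 1) * lo \<le> int (card S) * lo"
    using cS lohi by (intro mult_right_mono_neg)
  also have "\<dots> \<le> (\<Sum>p\<in>S. A p - z)"
    using val(1) by (rule sum_bounded_below)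
  finally have low: "(int N + 1) * lo \<le> (\<Sum>p\<in>S. A p - z)" .
  have "int ((N + 1) * 2 ^ a) \<le> int (2 ^ (b - 1))"
    using N by (simp only: of_nat_le_iff)
  then have N': "(int N + 1) * 2 ^ a \<le> 2 ^ (b - 1)"
    by (simp add: algebra_simps)
  have b2: "(2 :: int) ^ b = 2 * 2 ^ (b - 1)" and a2: "(2 :: int) ^ a = 2 * 2 ^ (a - 1)"
    using a by (simp_all add: power_Suc[symmetric] del: power_Suc)
  have hi': "(int N + 1) * hi = (int N + 1) * lo + (int N + 1) * 2 ^ a - (int N + 1)"
    by (simp add: hi_def algebra_simps)
  show "psum A k \<in> ints_of_width fmt b"
  proof (cases fmt)
    case Unsigned
    then have "z = 0" "lo = 0"
      by (auto simp: z_def lo_def rest_value_def)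
    with Unsigned up low N' hi' b2 show ?thesis
      by (simp add: psum)
  next
    case Signed
    then have zl: "z = 0" "lo = - (2 ^ (a - 1))"
      by (auto simp: z_def lo_def rest_value_def)
    have "(int N + 1) * 2 ^ a = 2 * ((int N + 1) * 2 ^ (a - 1))"
      by (simp add: a2)
    moreover have "(int N + 1) * lo = - ((int N + 1) * 2 ^ (a - 1))"
      by (simp only: zl mult_minus_right)
    moreover have "0 \<le> (int N + 1) * 2 ^ (a - 1)"
      by simp
    moreover have "psum A k = (\<Sum>p\<in>S. A p - z)"
      by (simp add: psum zl(1))
    ultimately have "- (2 ^ (b - 1)) \<le> psum A k \<and> psum A k < 2 ^ (b - 1)"
      using up low N' hi' by linarith
    then show ?thesis
      by (simp add: Signed)
  next
    case Positive
    then have zl: "z = 1" "lo = 0"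
      by (auto simp: z_def lo_def rest_value_def)
    have "int (2 * n) \<le> int (2 ^ b)"
      using pos[OF Positive] by (simp only: of_nat_le_iff)
    then have "2 * int n \<le> 2 ^ b"
      by simp
    moreover have "1 \<le> int k" "int k \<le> int n"
      using k by auto
    moreover have "psum A k = int k + (\<Sum>p\<in>S. A p - z)"
      by (simp add: psum zl(1))
    moreover have "(int N + 1) * lo = 0"
      by (simp add: zl(2))
    ultimately have "1 \<le> psum A k \<and> psum A k \<le> 2 ^ b"
      using up low N' hi' b2 by linarith
    then show ?thesis
      by (simp add: Positive)
  qed
qed

section \<open>Reaching a ready array by legal updates\<close>

lemma clear_suffix_fits:
  assumes A: "fits_in_cells n b fmt A"
  shows "fits_in_cells n b fmt (\<lambda>p. if k < p \<and> p \<le> n then rest_value fmt else A p)"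
    (is "fits_in_cells n b fmt ?B")
  unfolding fits_in_cells_def
proof (intro ballI conjI)
  fix p assume p: "p \<in> {1..n}"
  show "?B p \<in> ints_of_width fmt b"
    using A p rest_value_in_ints by (auto simp: fits_in_cells_def)
  show "psum ?B p \<in> ints_of_width fmt b"
  proof (cases "p \<le> k")
    case True
    then have "psum ?B p = psum A p"
      unfolding psum_def by (intro sum.cong) auto
    with A p show ?thesis
      by (simp add: fits_in_cells_def)
  next
    case False
    have split: "psum f p = psum f k + (\<Sum>i\<in>{k<..p}. f i)" for f :: "nat \<Rightarrow> int"
    proof -
      have "{1..p} = {1..k} \<union> {k<..p}"
        using False by auto
      then show ?thesis
        unfolding psum_def by (simp only:) (rule sum.union_disjoint, auto)
    qed
    have "psum ?B k = psum A k"
      unfolding psum_def by (intro sum.cong) auto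
    moreover have "(\<Sum>i\<in>{k<..p}. ?B i) = (\<Sum>i\<in>{k<..p}. rest_value fmt)"
      using p by (intro sum.cong) auto
    ultimately have B: "psum ?B p = psum A k + int (p - k) * rest_value fmt"
      by (simp add: split)
    show ?thesis
    proof (cases "fmt = Positive")
      case True
      have pos: "1 \<le> A i" if "i \<in> {1..n}" for i
        using A that by (auto simp: fits_in_cells_def True)
      have "(\<Sum>i\<in>{k<..p}. 1) \<le> (\<Sum>i\<in>{k<..p}. A i)"
        using pos p by (intro sum_mono) auto
      then have "psum ?B p \<le> psum A p"
        unfolding B by (simp add: split[of A] True rest_value_def)
      moreover have "psum A p \<le> 2 ^ b"
        using A p by (auto simp: fits_in_cells_def True)
      moreover have "0 \<le> psum A k"
        unfolding psum_def using pos p False by (intro sum_nonneg) force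
      then have "1 \<le> psum ?B p"
        unfolding B using False by (simp add: True rest_value_def)
      ultimately show ?thesis
        by (simp add: True)
    next
      case other: False
      then have "psum ?B p = psum A k"
        by (simp add: B rest_value_def)
      moreover have "psum A k \<in> ints_of_width fmt b"
      proof (cases "k = 0")
        case True
        with other show ?thesis
          using rest_value_in_ints[of fmt b] by (simp add: psum_def rest_value_def)
      next
        case False
        with A p \<open>\<not> p \<le> k\<close> show ?thesis
          by (auto simp: fits_in_cells_def)
      qed
      ultimately show ?thesis by simp
    qed
  qed
qed

text \<open>Clearing runs from right to left. In the signed and unsigned formats every intermediate
  partial sum is then an old one or 0, while left to right a signed array could overflow, because
  cancelling terms disappear first. Positive sums only decrease.\<close>

lemma clear_suffix_legal:
  assumes A: "fits_in_cells n b fmt A" and k: "k \<le> n"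
  shows "\<exists>ys. legal_ops n b \<delta> fmt Q A ys \<and>
    fold apply_op ys A = (\<lambda>p. if k < p \<and> p \<le> n then rest_value fmt else A p)"
  using k
proof (induction k rule: inc_induct)
  case base
  show ?case
    by (rule exI[of _ "[]"]) auto
next
  case (step k)
  then obtain ys where ys: "legal_ops n b \<delta> fmt Q A ys"
      "fold apply_op ys A = (\<lambda>p. if Suc k < p \<and> p \<le> n then rest_value fmt else A p)"
    by blast
  have upd: "(\<lambda>p. if Suc k < p \<and> p \<le> n then rest_value fmt else A p)(Suc k := rest_value fmt) =
      (\<lambda>p. if k < p \<and> p \<le> n then rest_value fmt else A p)"
    using step by (auto simp: fun_eq_iff)
  show ?case
  proof (rule exI[of _ "ys @ [Update (Suc k) (rest_value fmt)]"], intro conjI)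
    show "legal_ops n b \<delta> fmt Q A (ys @ [Update (Suc k) (rest_value fmt)])"
      using ys step rest_value_in_ints clear_suffix_fits[OF A, of k]
      by (simp add: legal_ops_append upd)
    show "fold apply_op (ys @ [Update (Suc k) (rest_value fmt)]) A =
        (\<lambda>p. if k < p \<and> p \<le> n then rest_value fmt else A p)"
      using ys by (simp add: upd)
  qed
qed

text \<open>
  The large last element of a ready array keeps all comparison queries within the total.
\<close>

definition ready :: "nat \<Rightarrow> nat \<Rightarrow> nat \<Rightarrow> int_format \<Rightarrow> (nat \<Rightarrow> int) \<Rightarrow> bool" where
  "ready n N a fmt A \<longleftrightarrow> sparse n N a fmt A \<and> A n = format_min fmt a + 2 ^ a - 1"

lemma exists_ready:
  assumes A: "fits_in_cells n b fmt A" and n: "N < n" and a: "1 \<le> a" "a \<le> \<delta>" "\<delta> \<le> b"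
    and N: "(N + 1) * 2 ^ a \<le> 2 ^ (b - 1)" and pos: "fmt = Positive \<Longrightarrow> 2 * n \<le> 2 ^ b"
  obtains ys where "legal_ops n b \<delta> fmt Q A ys" "ready n N a fmt (fold apply_op ys A)"
proof -
  obtain ys where ys: "legal_ops n b \<delta> fmt Q A ys"
      "fold apply_op ys A = (\<lambda>p. if 0 < p \<and> p \<le> n then rest_value fmt else A p)"
    using clear_suffix_legal[OF A le0] by blast
  define B where "B = (\<lambda>p. if 0 < p \<and> p \<le> n then rest_value fmt else A p)
    (n := format_min fmt a + 2 ^ a - 1)"
  have last: "format_min fmt a + 2 ^ a - 1 \<in> ints_of_width fmt a"
    unfolding ints_of_width_eq[OF a(1)] by simp
  have ready: "ready n N a fmt B"
    using last rest_value_in_ints by (auto simp: ready_def sparse_def B_def)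
  then have "fits_in_cells n b fmt B"
    using a by (intro sparse_fits[OF _ a(1) _ N pos]) (auto simp: ready_def)
  then have "legal_ops n b \<delta> fmt Q A (ys @ [Update n (format_min fmt a + 2 ^ a - 1)])"
    using ys n last ints_of_width_mono[OF a(1,2)] by (auto simp: legal_ops_append B_def)
  moreover have "fold apply_op (ys @ [Update n (format_min fmt a + 2 ^ a - 1)]) A = B"
    using ys by (simp add: B_def)
  ultimately show thesis
    using that ready by metis
qed

lemma ready_array_after:
  assumes "ready n (2 ^ m) a fmt A" "2 ^ m < n" "1 \<le> a" "x \<in> item_values m a"
  shows "ready n (2 ^ m) a fmt (array_after m (format_min fmt a) A x t)"
proof -
  have "p \<le> 2 ^ m" if "p \<in> Suc ` bitrev m ` {..<t}" for p
    using that bitrev_less[of m] by (auto simp: Suc_le_eq)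
  moreover have "format_min fmt a + int (x (bitrev m s)) \<in> ints_of_width fmt a" for s
  proof -
    have "x (bitrev m s) < 2 ^ a"
      using assms(4) bitrev_less[of m s] by (auto simp: item_values_def dest!: PiE_mem)
    then have "int (x (bitrev m s)) < 2 ^ a"
      by simp
    then show ?thesis
      unfolding ints_of_width_eq[OF assms(3)] by simp
  qed
  ultimately show ?thesis
    using assms(1,2) unfolding ready_def sparse_def array_after_def by fastforce
qed

text \<open>A threshold exceeds the partial sum by at most \<open>2 ^ l \<le> 2 ^ a\<close>. The
  element at \<open>n\<close> has this size and lies beyond
  \<open>Suc k \<le> 2 ^ m\<close>.\<close>

lemma query_op_legal:
  assumes A: "ready n (2 ^ m) a fmt A" and n: "2 ^ m < n" and c: "c \<in> query_set m a" and a: "1 \<le> a"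
    and sel: "sel \<Longrightarrow> SelectQuery \<in> Q \<and> fmt = Positive" "\<not> sel \<Longrightarrow> SumQuery \<in> Q"
  shows "legal_op n b \<delta> fmt Q A (query_op sel A c)"
proof -
  obtain k l e where c': "c = (k, l, e)" "k < 2 ^ m" "l \<le> a" "e < 2"
    using c by (auto simp: query_set_def)
  show ?thesis
  proof (cases sel)
    case False
    then show ?thesis
      using sel(2) c' n by (simp add: query_op_def)
  next
    case True
    then have fmt: "fmt = Positive" "SelectQuery \<in> Q"
      using sel(1) by auto
    have pos: "1 \<le> A p" if "p \<in> {1..n}" for p
      using A that unfolding ready_def sparse_def fmt ints_of_width.simps by fastforce
    have An: "A n = 2 ^ a"
      using A by (simp add: ready_def fmt)
    have "psum A (Suc k) \<le> psum A (n - 1)"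
      using pos c' n by (intro psum_mono[of n]) force+
    moreover have "psum A n = psum A (n - 1) + A n"
      using n by (cases n) (auto simp: psum_def)
    ultimately have total: "psum A (Suc k) + 2 ^ a \<le> psum A n"
      by (simp add: An)
    have nonneg: "0 \<le> psum A (Suc k)"
      unfolding psum_def using pos c'(2) n by (intro sum_nonneg) force
    have "2 ^ l * (psum A (Suc k) div 2 ^ l + int e) \<le>
        2 ^ l * (psum A (Suc k) div 2 ^ l) + 2 ^ l * 1"
      unfolding distrib_left using c'(4) by (intro add_mono mult_left_mono) auto
    also have "2 ^ l * (psum A (Suc k) div 2 ^ l) \<le> psum A (Suc k)"
    proof -
      have "psum A (Suc k) = 2 ^ l * (psum A (Suc k) div 2 ^ l) + psum A (Suc k) mod 2 ^ l"
        by simp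
      moreover have "0 \<le> psum A (Suc k) mod 2 ^ l"
        by simp
      ultimately show ?thesis by linarith
    qed
    also have "2 ^ l * 1 \<le> (2 :: int) ^ a"
      using c'(3) by (simp add: power_increasing)
    finally have "2 ^ l * (psum A (Suc k) div 2 ^ l + int e) \<le> psum A n"
      using total by simp
    moreover have "1 \<le> psum A n"
      using total nonneg zero_less_power[of "2 :: int" a] by linarith
    ultimately show ?thesis
      using fmt by (simp add: query_op_def c'(1) True)
  qed
qed

lemma block_legal:
  assumes A: "ready n (2 ^ m) a fmt A" and n: "2 ^ m < n" and a: "1 \<le> a" "a \<le> \<delta>" "\<delta> \<le> b"
    and N: "(2 ^ m + 1) * 2 ^ a \<le> (2 :: nat) ^ (b - 1)" and pos: "fmt = Positive \<Longrightarrow> 2 * n \<le> 2 ^ b"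
    and sel: "sel \<Longrightarrow> SelectQuery \<in> Q \<and> fmt = Positive" "\<not> sel \<Longrightarrow> SumQuery \<in> Q"
    and x: "x \<in> item_values m a" and \<kappa>: "\<kappa> \<in> query_choices m a r"
  shows "legal_ops n b \<delta> fmt Q A
    (map (block_op m (format_min fmt a) r sel A x \<kappa>) [0..<2 ^ m * Suc r])"
proof (rule legal_ops_map)
  fix v assume v: "v < 2 ^ m * Suc r"
  let ?f = "block_op m (format_min fmt a) r sel A x \<kappa>" and ?A = "array_after m (format_min fmt a) A x"
  have ready: "ready n (2 ^ m) a fmt (?A t)" for t
    by (rule ready_array_after[OF A n a(1) x])
  show "legal_op n b \<delta> fmt Q (fold apply_op (map ?f [0..<v]) A) (?f v)"
  proof (cases "v mod Suc r = 0")
    case True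
    let ?k = "bitrev m (v div Suc r)"
    have k: "?k < 2 ^ m"
      by (rule bitrev_less)
    have upd: "(?A (v div Suc r))(Suc ?k := format_min fmt a + int (x ?k)) = ?A (Suc (v div Suc r))"
      by (auto simp: array_after_def lessThan_Suc fun_eq_iff)
    have "?A (Suc (v div Suc r)) (Suc ?k) \<in> ints_of_width fmt a"
      using ready[of "Suc (v div Suc r)"] k n by (auto simp: ready_def sparse_def)
    then have "format_min fmt a + int (x ?k) \<in> ints_of_width fmt \<delta>"
      using ints_of_width_mono[OF a(1,2), of fmt] by (auto simp: upd[symmetric])
    moreover have "fits_in_cells n b fmt (?A (Suc (v div Suc r)))"
      using ready a by (intro sparse_fits[OF _ a(1) _ N pos]) (auto simp: ready_def)
    ultimately show ?thesis
      using True k n by (simp add: block_updates_before updates_before_eq block_op_def Let_def upd)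
  next
    case False
    have "\<kappa> v \<in> query_set m a"
      using \<kappa> v by (auto simp: query_choices_def dest!: PiE_mem)
    with query_op_legal[OF ready n _ a(1) sel] show ?thesis
      using False by (simp add: block_updates_before updates_before_eq block_op_def Let_def)
  qed
qed


section \<open>The trade-off\<close>

text \<open>An operation that preserves the array can be repeated forever, which amortizes the
  budget of \<open>ys\<close> away and leaves a bound per operation.\<close>

lemma amortized_repeat:
  assumes D: "amortized_expected_times n b \<delta> fmt Q A0 D t_u t_q t_s" "wf_structure b D"
    and ys: "legal_ops n b \<delta> fmt Q A0 ys"
    and x: "legal_op n b \<delta> fmt Q (fold apply_op ys A0) x"
      "apply_op x (fold apply_op ys A0) = fold apply_op ys A0"
    and c: "\<And>m. c \<le> probes (program D x) m"
  shows "real c \<le> op_budget t_u t_q t_s x"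
proof (rule ccontr)
  let ?A = "fold apply_op ys A0" and ?I = "initial_memories b D"
  let ?y = "sum_list (map (op_budget t_u t_q t_s) ys)"
  assume "\<not> ?thesis"
  then have gap: "0 < c - op_budget t_u t_q t_s x"
    by simp
  have I: "0 < real (card ?I)"
    using initial_memories_nonempty finite_initial_memories[OF D(2)] by (simp add: card_gt_0_iff)
  have legal: "legal_ops n b \<delta> fmt Q ?A (replicate k x)" for k
    by (induction k) (simp_all add: x)
  have probes: "k * c \<le> total_probes D (replicate k x) m" for k m
    by (induction k arbitrary: m) (auto intro: add_mono c)
  obtain k :: nat where k: "?y < k * (c - op_budget t_u t_q t_s x)"
    using reals_Archimedean3[OF gap] by blast
  have "real (k * c) \<le> real (total_probes D (ys @ replicate k x) m)" for m
    using probes[of k "mem_after D ys m"] by (simp only: of_nat_le_iff total_probes_append)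
  then have "(\<Sum>m\<in>?I. real (k * c)) \<le> (\<Sum>m\<in>?I. real (total_probes D (ys @ replicate k x) m))"
    by (rule sum_mono)
  also have "\<dots> \<le> card ?I * sum_list (map (op_budget t_u t_q t_s) (ys @ replicate k x))"
    using ys legal by (intro expected_probes_le[OF D]) (simp add: legal_ops_append)
  finally have "real (k * c) \<le> ?y + k * op_budget t_u t_q t_s x"
    using I by (simp add: sum_list_replicate)
  with k show False
    by (simp add: algebra_simps)
qed

text \<open>The time bounds are arbitrary reals, so the sign needs an argument: rewriting the last
  element with its current value is legal any number of times.\<close>

lemma update_time_nonneg:
  assumes D: "amortized_expected_times n b \<delta> fmt Q A0 D t_u t_q t_s"
      "partial_sums_structure n b \<delta> fmt Q A0 D"
    and n: "2 ^ m < n" and a: "1 \<le> a" "a \<le> \<delta>" "\<delta> \<le> b"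
    and N: "(2 ^ m + 1) * 2 ^ a \<le> (2 :: nat) ^ (b - 1)" and pos: "fmt = Positive \<Longrightarrow> 2 * n \<le> 2 ^ b"
  shows "0 \<le> t_u"
proof -
  have wf: "wf_structure b D" and fits: "fits_in_cells n b fmt A0"
    using D(2) by (auto simp: partial_sums_structure_def)
  obtain ys where ys: "legal_ops n b \<delta> fmt Q A0 ys" "ready n (2 ^ m) a fmt (fold apply_op ys A0)"
    using exists_ready[OF fits n a _ pos] N by auto
  let ?A = "fold apply_op ys A0" and ?x = "Update n (fold apply_op ys A0 n)"
  have "?A n \<in> ints_of_width fmt a"
    using ys(2) by (simp add: ready_def ints_of_width_eq[OF a(1)])
  moreover have "fits_in_cells n b fmt ?A"
    using ys(2) a by (intro sparse_fits[OF _ a(1) _ N pos]) (auto simp: ready_def)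
  ultimately have "legal_op n b \<delta> fmt Q ?A ?x"
    using n ints_of_width_mono[OF a(1,2)] by auto
  then have "real 0 \<le> op_budget t_u t_q t_s ?x"
    by (intro amortized_repeat[OF D(1) wf ys(1)]) auto
  then show ?thesis
    by (simp add: op_budget_def)
qed

text \<open>A program without probes returns a constant, but two arrays that differ by 1 in their
  first element require different answers to one query. The bound makes the quotient
  \<open>t_u / t\<close> meaningful and covers trees without levels.\<close>

lemma query_time_ge_1:
  assumes D: "amortized_expected_times n b \<delta> fmt Q A0 D t_u t_q t_s"
      "partial_sums_structure n b \<delta> fmt Q A0 D"
    and n: "2 ^ m < n" and a: "1 \<le> a" "a \<le> \<delta>" "\<delta> \<le> b"
    and N: "(2 ^ m + 1) * 2 ^ a \<le> (2 :: nat) ^ (b - 1)" and pos: "fmt = Positive \<Longrightarrow> 2 * n \<le> 2 ^ b"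
    and sel: "sel \<Longrightarrow> SelectQuery \<in> Q \<and> fmt = Positive" "\<not> sel \<Longrightarrow> SumQuery \<in> Q"
  shows "1 \<le> (if sel then t_s else t_q)"
proof -
  have wf: "wf_structure b D" and fits: "fits_in_cells n b fmt A0"
    and correct: "\<And>xs m. legal_ops n b \<delta> fmt Q A0 xs \<Longrightarrow> m \<in> initial_memories b D \<Longrightarrow>
      all_correct n D A0 xs m"
    using D(2) by (auto simp: partial_sums_structure_def)
  obtain ys where ys: "legal_ops n b \<delta> fmt Q A0 ys" "ready n (2 ^ m) a fmt (fold apply_op ys A0)"
    using exists_ready[OF fits n a _ pos] N by auto
  define lo where "lo = format_min fmt a"
  define A where "A = (\<lambda>v. (fold apply_op ys A0)(1 := lo + v))"
  have two: "(2 :: int) \<le> 2 ^ a"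
    using a(1) power_increasing[of 1 a "2 :: int"] by simp
  have one_n: "1 < n"
    using n one_le_power[of "2 :: nat" m] by linarith
  have A_val: "lo + v \<in> ints_of_width fmt a" if "v \<in> {0, 1}" for v
    using that two unfolding ints_of_width_eq[OF a(1)] lo_def by auto
  have ready: "ready n (2 ^ m) a fmt (A v)" if "v \<in> {0, 1}" for v
    using ys(2) A_val[OF that] one_n unfolding ready_def sparse_def A_def
    by (auto simp: not_less)
  have psum1: "psum (A v) (Suc 0) = lo + v" for v
    by (simp add: psum_def A_def)
  have "\<exists>l\<le>a. query_op sel (A 0) (0, l, 1) = query_op sel (A 1) (0, l, 0) \<and>
    (\<forall>r. correct_answer n (A 0) (query_op sel (A 0) (0, l, 1)) r \<longrightarrow>
      \<not> correct_answer n (A 1) (query_op sel (A 0) (0, l, 1)) r)"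
  proof -
    have pos': "1 \<le> A v p" if sel "p \<in> {1..n}" "v \<in> {0, 1}" for v p
      using ready[OF that(3)] that(1,2) sel(1) unfolding ready_def sparse_def by fastforce
    show ?thesis
      by (rule query_op_distinguishes[of "A 0" 0 "A 1" a n sel])
        (use two one_n pos' in \<open>auto simp: psum1\<close>)
  qed
  then obtain l where l: "l \<le> a" "query_op sel (A 0) (0, l, 1) = query_op sel (A 1) (0, l, 0)"
      "\<And>r. correct_answer n (A 0) (query_op sel (A 0) (0, l, 1)) r \<Longrightarrow>
        \<not> correct_answer n (A 1) (query_op sel (A 0) (0, l, 1)) r"
    by blast
  define x where "x = query_op sel (A 0) (0, l, 1)"
  have legal_x: "legal_op n b \<delta> fmt Q (A v) x" if v: "v \<in> {0, 1}" for v
  proof -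
    have "x = query_op sel (A v) (0, l, if v = 0 then 1 else 0)"
      using v l(2) by (auto simp: x_def)
    moreover have "(0, l, if v = 0 then 1 else 0) \<in> query_set m a"
      using l(1) by (simp add: query_set_def)
    ultimately show ?thesis
      using query_op_legal[OF ready[OF v] n _ a(1) sel] by metis
  qed
  have upd: "legal_ops n b \<delta> fmt Q A0 (ys @ [Update 1 (lo + v)])"
    and fold: "fold apply_op (ys @ [Update 1 (lo + v)]) A0 = A v" if v: "v \<in> {0, 1}" for v
  proof -
    have "fits_in_cells n b fmt (A v)"
      using ready[OF v] a by (intro sparse_fits[OF _ a(1) _ N pos]) (auto simp: ready_def)
    then show "legal_ops n b \<delta> fmt Q A0 (ys @ [Update 1 (lo + v)])"
      using ys(1) one_n A_val[OF v] ints_of_width_mono[OF a(1,2)]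
      by (auto simp: legal_ops_append A_def)
    show "fold apply_op (ys @ [Update 1 (lo + v)]) A0 = A v"
      by (simp add: A_def)
  qed
  have x_idem: "apply_op x B = B" for B
    by (simp add: x_def query_op_def)
  have "1 \<le> probes (program D x) m'" for m'
  proof (cases "program D x")
    case (Return r)
    obtain m0 where m0: "m0 \<in> initial_memories b D"
      using initial_memories_nonempty by blast
    have "correct_answer n (A v) x r" if v: "v \<in> {0, 1}" for v
    proof -
      have "legal_ops n b \<delta> fmt Q A0 ((ys @ [Update 1 (lo + v)]) @ [x])"
        using upd[OF v] fold[OF v] legal_x[OF v] by (simp only: legal_ops_append) simp
      from correct[OF this m0] show ?thesis
        using fold[OF v] by (simp only: all_correct_append) (simp add: Return)
    qed
    with l(3) have False
      by (auto simp: x_def)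
    then show ?thesis ..
  qed auto
  then have "real 1 \<le> op_budget t_u t_q t_s x"
    using upd[of 0] fold[of 0] legal_x[of 0] x_idem
    by (intro amortized_repeat[OF D(1) wf, of "ys @ [Update 1 (lo + 0)]"]) simp_all
  then show ?thesis
    by (simp add: op_budget_def x_def query_op_def split: if_splits)
qed

text \<open>With \<open>t_u \<le> r * t\<close> a round has budget at most \<open>2 * r * t\<close>.
  A cheap block costs at most twice its budget on average, and the levels force
  \<open>d * r / 202\<close> per round, hence 808 = 202 * 2 * 2.\<close>

lemma query_time_ge_depth:
  fixes t :: real
  assumes D: "amortized_expected_times n b \<delta> fmt Q A0 D t_u t_q t_s"
      "partial_sums_structure n b \<delta> fmt Q A0 D"
    and n: "2 ^ (w * d) < n" and a: "1 \<le> a" "a \<le> \<delta>" "\<delta> \<le> b"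
    and N: "(2 ^ (w * d) + 1) * 2 ^ a \<le> (2 :: nat) ^ (b - 1)"
    and pos: "fmt = Positive \<Longrightarrow> 2 * n \<le> 2 ^ b"
    and sel: "sel \<Longrightarrow> SelectQuery \<in> Q \<and> fmt = Positive" "\<not> sel \<Longrightarrow> SumQuery \<in> Q"
    and w: "1 \<le> w" "40 * b * Suc r \<le> a * 2 ^ w" and r: "0 < r"
    and t: "t = (if sel then t_s else t_q)" "t_u \<le> r * t"
  shows "d \<le> 808 * t"
proof -
  let ?m = "w * d"
  let ?IV = "item_values ?m a" and ?QC = "query_choices ?m a r" and ?lo = "format_min fmt a"
  have wf: "wf_structure b D" and fits: "fits_in_cells n b fmt A0"
    and correct: "\<And>xs m. legal_ops n b \<delta> fmt Q A0 xs \<Longrightarrow> m \<in> initial_memories b D \<Longrightarrow>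
      all_correct n D A0 xs m"
    using D(2) by (auto simp: partial_sums_structure_def)
  have t1: "1 \<le> t"
    using query_time_ge_1[of n b \<delta> fmt Q A0 D t_u t_q t_s "w * d" a sel, OF D n a N pos sel] t(1) by simp
  have tu: "0 \<le> t_u"
    by (rule update_time_nonneg[OF D n a N pos])
  define B where "B = real (2 ^ ?m) * (t_u + r * t)"
  have Bpos: "0 < B"
    unfolding B_def using t1 tu r by (intro mult_pos_pos add_nonneg_pos) auto
  define block where "block = (\<lambda>A (x, \<kappa>). map (block_op ?m ?lo r sel A x \<kappa>) [0..<2 ^ ?m * Suc r])"
  have "restrict (\<lambda>_. 0) {..<2 ^ ?m} \<in> ?IV"
    by (simp add: item_values_def)
  moreover have "restrict (\<lambda>_. (0, 0, 0)) {..<2 ^ ?m * Suc r} \<in> ?QC"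
    by (auto simp: query_choices_def query_set_def)
  ultimately have ne: "?IV \<noteq> {}" "?QC \<noteq> {}"
    by blast+
  obtain ys\<^sub>0 where ys\<^sub>0: "legal_ops n b \<delta> fmt Q A0 ys\<^sub>0" "ready n (2 ^ ?m) a fmt (fold apply_op ys\<^sub>0 A0)"
    using exists_ready[OF fits n a _ pos] N by auto
  obtain ys m where ys: "legal_ops n b \<delta> fmt Q A0 ys" "ready n (2 ^ ?m) a fmt (fold apply_op ys A0)"
    and m: "m \<in> initial_memories b D"
    and cheap: "(\<Sum>\<omega>\<in>?IV \<times> ?QC. real (total_probes D (block (fold apply_op ys A0) \<omega>) (mem_after D ys m))) \<le>
       card (?IV \<times> ?QC) * (2 * B)"
  proof (rule exists_cheap_block[where W = "?IV \<times> ?QC" and block = block and ready = "ready n (2 ^ ?m) a fmt",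
        OF D(1) wf _ _ Bpos ys\<^sub>0])
    fix A \<omega> assume A: "ready n (2 ^ ?m) a fmt A" and \<omega>: "\<omega> \<in> ?IV \<times> ?QC"
    then obtain x \<kappa> where x\<kappa>: "\<omega> = (x, \<kappa>)" "x \<in> ?IV" "\<kappa> \<in> ?QC"
      by auto
    show "legal_ops n b \<delta> fmt Q A (block A \<omega>)"
      unfolding block_def x\<kappa>(1) prod.case by (rule block_legal[OF A n a N pos sel x\<kappa>(2,3)])
    show "ready n (2 ^ ?m) a fmt (fold apply_op (block A \<omega>) A)"
      unfolding block_def x\<kappa>(1) prod.case block_updates_before
      by (rule ready_array_after[OF A n a(1) x\<kappa>(2)])
  next
    fix A \<omega> assume "\<omega> \<in> ?IV \<times> ?QC"
    show "sum_list (map (op_budget t_u t_q t_s) (block A \<omega>)) = B"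
      unfolding block_def by (cases \<omega>) (simp only: prod.case block_budget B_def t(1))
  qed (use ne that in auto)
  define Y where "Y = fold apply_op ys A0"
  define M where "M = mem_after D ys m"
  have ready: "ready n (2 ^ ?m) a fmt (array_after ?m ?lo Y x u)" if "x \<in> ?IV" for x u
    unfolding Y_def by (rule ready_array_after[OF ys(2) n a(1) that])
  interpret partial_sums_block n b a w d r sel ?lo Y D M
  proof
    show "valid_memory b M"
      unfolding M_def by (intro valid_memory_mem_after[OF wf] valid_memory_initial[OF wf m])
    show "1 \<le> ?lo" if sel
      using sel(1)[OF that] by simp
    show "1 \<le> Y p" if sel "p \<in> {1..n}" for p
      using ys(2) that sel(1) unfolding ready_def sparse_def Y_def by fastforce
    show "query_op sel (array_after ?m ?lo Y x (Suc u)) c \<in> Select ` {1..2 ^ b}"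
      if "sel" "x \<in> ?IV" "c \<in> query_set ?m a" for x u c
    proof -
      let ?A = "array_after ?m ?lo Y x (Suc u)"
      have "legal_op n b \<delta> fmt Q ?A (query_op sel ?A c)"
        by (rule query_op_legal[OF ready[OF that(2)] n that(3) a(1) sel])
      moreover from that(1) obtain \<sigma> where \<sigma>: "query_op sel ?A c = Select \<sigma>"
        by (cases c) (auto simp: query_op_def)
      moreover have "fits_in_cells n b fmt ?A"
        using ready[OF that(2)] a by (intro sparse_fits[OF _ a(1) _ N pos]) (auto simp: ready_def)
      then have "psum ?A n \<le> 2 ^ b"
        using sel(1)[OF that(1)] n by (auto simp: fits_in_cells_def)
      ultimately show ?thesis by auto
    qed
    show "correct_answer n (array_after ?m ?lo Y x (Suc (v div Suc r))) (block_op ?m ?lo r sel Y x \<kappa> v)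
        (op_result D M (block_op ?m ?lo r sel Y x \<kappa>) v)"
      if "x \<in> ?IV" "\<kappa> \<in> ?QC" "v < 2 ^ ?m * Suc r" "v mod Suc r \<noteq> 0" for x \<kappa> v
    proof -
      have "legal_ops n b \<delta> fmt Q A0 (ys @ block Y (x, \<kappa>))"
        using ys(1) block_legal[OF ys(2) n a N pos sel that(1,2)]
        by (simp add: legal_ops_append block_def Y_def)
      from correct[OF this m] have "all_correct n D Y (block Y (x, \<kappa>)) M"
        by (simp add: all_correct_append Y_def M_def)
      then show ?thesis
        using all_correct_map[of n D Y "block_op ?m ?lo r sel Y x \<kappa>" "2 ^ ?m * Suc r" M v] that(3,4)
        by (simp only: block_def prod.case block_updates_before updates_before_eq if_False)
    qed
  qed (use wf a w r n in auto)
  let ?C = "real (card ?IV) * real (card ?QC)"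
  have "d * r * 2 ^ ?m * ?C \<le> 202 * (\<Sum>x\<in>?IV. \<Sum>\<kappa>\<in>?QC.
      \<Sum>v<2 ^ ?m * Suc r. real (op_probes D M (block_op ?m ?lo r sel Y x \<kappa>) v))"
    by (rule total_cost)
  also have "(\<Sum>x\<in>?IV. \<Sum>\<kappa>\<in>?QC. \<Sum>v<2 ^ ?m * Suc r. real (op_probes D M (block_op ?m ?lo r sel Y x \<kappa>) v)) =
      (\<Sum>x\<in>?IV. \<Sum>\<kappa>\<in>?QC. real (total_probes D (block Y (x, \<kappa>)) M))"
    by (simp add: block_def total_probes_map del: upt_Suc mult_Suc_right)
  also have "\<dots> = (\<Sum>\<omega>\<in>?IV \<times> ?QC. real (total_probes D (block Y \<omega>) M))"
    by (simp add: sum.cartesian_product)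
  also have "\<dots> \<le> ?C * (2 * B)"
    using cheap by (simp add: Y_def M_def card_cartesian_product)
  finally have "d * r * 2 ^ ?m * ?C \<le> 404 * B * ?C"
    by (simp add: mult_ac)
  moreover have "0 < ?C"
    using ne by (simp add: card_gt_0_iff)
  ultimately have "d * r * 2 ^ ?m \<le> 404 * B"
    by (rule mult_right_le_imp_le)
  also have "\<dots> \<le> 404 * (2 ^ ?m * (2 * (r * t)))"
    unfolding B_def using t(2) by (simp add: mult.commute)
  finally have "(r * 2 ^ ?m) * real d \<le> (r * 2 ^ ?m) * (808 * t)"
    by (simp add: mult_ac)
  then show ?thesis
    using r by (subst (asm) mult_le_cancel_left_pos) auto
qed

lemma lg_ge_1: "0 \<le> x \<Longrightarrow> 1 \<le> lg x"
  by (simp add: lg_def)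

lemma tradeoff:
  fixes t t_u K :: real
  assumes K: "K > 0" and large: "8 \<le> lg n" "6 \<le> K * lg n"
    and adm: "admissible K n b \<delta> fmt Q"
    and D: "amortized_expected_times n b \<delta> fmt Q A0 D t_u t_q t_s"
      "partial_sums_structure n b \<delta> fmt Q A0 D"
    and sel: "sel \<Longrightarrow> SelectQuery \<in> Q" "\<not> sel \<Longrightarrow> SumQuery \<in> Q"
    and t: "t = (if sel then t_s else t_q)"
  shows "min (K / 8) (1 / 8) / 9696 * lg n \<le> t * (lg (b / \<delta>) + lg (t_u / t))"
proof -
  have \<delta>: "1 \<le> \<delta>" "\<delta> \<le> b" and Kb: "K * lg n \<le> b" and pos: "fmt = Positive \<Longrightarrow> 2 * n \<le> 2 ^ b"
    and sel': "sel \<Longrightarrow> SelectQuery \<in> Q \<and> fmt = Positive"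
    using adm sel(1) by (auto simp: admissible_def)
  \<comment> \<open>Values and number of items take a quarter of the cell width each:
    \<open>2 * h + 1 \<le> b - 1\<close> makes all sums fit. The cost is a constant:
    \<open>a \<ge> \<delta> / 8\<close>, and \<open>h \<ge> b / 8\<close> since
    \<open>b \<ge> 6\<close>.\<close>
  define h where "h = b div 4"
  define a where "a = min \<delta> h"
  \<comment> \<open>A quarter of \<open>lg n\<close> stays below \<open>lg n - 2\<close>, so
    \<open>2 ^ k\<close> items leave room for a last element, while rounding down keeps at least
    \<open>lg n / 8\<close>.\<close>
  define e where "e = nat \<lfloor>lg n / 4\<rfloor>"
  define k where "k = min h e"
  have b6: "6 \<le> b"
    using large Kb by linarith
  then have h: "1 \<le> h" "4 * h \<le> b" "b \<le> 4 * h + 3"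
    by (auto simp: h_def)
  have a: "1 \<le> a" "a \<le> \<delta>" "\<delta> \<le> b" "\<delta> \<le> 8 * a"
    using h \<delta> by (auto simp: a_def min_def)
  have k: "min (K / 8) (1 / 8) * lg n \<le> k"
  proof -
    have "K / 8 * lg n \<le> h"
      using h(3) Kb large(2) by linarith
    moreover have "1 / 8 * lg n \<le> e"
      unfolding e_def using large(1) by linarith
    moreover have "min (K / 8) (1 / 8) * lg n \<le> K / 8 * lg n" "min (K / 8) (1 / 8) * lg n \<le> 1 / 8 * lg n"
      using large(1) by (intro mult_right_mono; simp)+
    ultimately show ?thesis
      unfolding k_def by linarith
  qed
  have kn: "2 ^ k < n"
  proof -
    have "real (2 ^ k) = 2 powr k"
      by (simp add: powr_realpow)
    also have "\<dots> \<le> 2 powr (lg n - 2)"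
      using large(1) by (intro powr_mono) (auto simp: k_def e_def, linarith)
    also have "\<dots> = (2 + real n) / 4"
      by (simp add: lg_def powr_diff)
    also have "\<dots> < n"
    proof -
      have "2 powr 8 \<le> 2 powr lg n"
        using large(1) by (intro powr_mono) auto
      then have "256 \<le> 2 + real n"
        by (simp add: lg_def)
      then show ?thesis by simp
    qed
    finally show ?thesis by simp
  qed
  have fit: "(2 ^ j + 1) * 2 ^ a \<le> (2 :: nat) ^ (b - 1)" if "j \<le> k" for j
  proof -
    have "(2 :: nat) ^ j \<le> 2 ^ h" "(2 :: nat) ^ a \<le> 2 ^ h" "(1 :: nat) \<le> 2 ^ h"
      using that by (auto simp: k_def a_def intro!: power_increasing)
    then have "(2 ^ j + 1) * 2 ^ a \<le> (2 ^ h + 2 ^ h) * (2 :: nat) ^ h"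
      by (intro mult_le_mono add_le_mono) auto
    also have "\<dots> = 2 ^ (2 * h + 1)"
      by (simp only: mult_2 power_add power_one_right mult_2_right distrib_right)
    also have "\<dots> \<le> 2 ^ (b - 1)"
      using h by (intro power_increasing) auto
    finally show ?thesis .
  qed
  have t1: "1 \<le> t"
    using query_time_ge_1[of n b \<delta> fmt Q A0 D t_u t_q t_s k a sel, OF D kn a(1,2,3) fit pos sel' sel(2)] t
    by simp
  have tu: "0 \<le> t_u"
    using update_time_nonneg[OF D kn a(1,2,3) fit pos] by simp
  define x where "x = t_u / t"
  have x: "0 \<le> x"
    using t1 tu by (simp add: x_def)
  \<comment> \<open>Rounding up and the maximum give \<open>r + 1 \<le> 2 + x\<close>, exactly the
    argument of the logarithm in \<open>lg x\<close>.\<close>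
  define r where "r = max 1 (nat \<lceil>x\<rceil>)"
  have r: "0 < r" "x \<le> r" "Suc r \<le> 2 + x"
    using x by (auto simp: r_def max_def, linarith+)
  have tur: "t_u \<le> r * t"
    using r(2) t1 by (simp add: x_def field_simps)
  \<comment> \<open>Minimality bounds \<open>2 ^ w\<close> from above within a factor of 2 of the
    requirement, so that \<open>w\<close> is O(\<open>S\<close>).\<close>
  define w where "w = (LEAST w. 40 * b * Suc r \<le> a * 2 ^ w)"
  have "40 * b * Suc r < 2 ^ (40 * b * Suc r)"
    by simp
  also have "\<dots> \<le> a * 2 ^ (40 * b * Suc r)"
    using a(1) by simp
  finally have "40 * b * Suc r \<le> a * 2 ^ (40 * b * Suc r)"
    by simp
  then have w: "40 * b * Suc r \<le> a * 2 ^ w"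
    unfolding w_def by (rule LeastI)
  have w1: "1 \<le> w"
  proof (rule ccontr)
    assume "\<not> 1 \<le> w"
    then have "w = 0"
      by simp
    with w have "40 * b * Suc r \<le> a"
      by simp
    moreover have "40 * b \<le> 40 * b * Suc r"
      by simp
    ultimately show False
      using a b6 by linarith
  qed
  have "\<not> 40 * b * Suc r \<le> a * 2 ^ (w - 1)"
    by (rule not_less_Least[of "w - 1" "\<lambda>w. 40 * b * Suc r \<le> a * 2 ^ w", folded w_def]) (use w1 in simp)
  moreover have "(2 :: nat) ^ w = 2 * 2 ^ (w - 1)"
    using w1 by (simp add: power_Suc[symmetric] del: power_Suc)
  ultimately have "a * 2 ^ w \<le> 80 * b * Suc r"
    by simp
  then have "real (a * 2 ^ w) \<le> real (80 * b * Suc r)"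
    by (simp only: of_nat_le_iff)
  then have wa: "real a * 2 ^ w \<le> 80 * real b * Suc r"
    by (simp add: algebra_simps)
  define S where "S = lg (b / \<delta>) + lg x"
  have S2: "2 \<le> S"
    using lg_ge_1[OF x] lg_ge_1[of "b / \<delta>"] by (simp add: S_def)
  have "w \<le> 10 + S"
  proof -
    have "real \<delta> * 2 ^ w \<le> real (8 * a) * 2 ^ w"
      using a(4) by (intro mult_right_mono) auto
    also have "\<dots> \<le> 8 * (80 * real b * (2 + x))"
      using wa mult_left_mono[OF r(3), of "80 * real b"] by simp
    finally have "2 ^ w \<le> 640 * (b / \<delta>) * (2 + x)"
      using \<delta> by (simp add: field_simps)
    also have "\<dots> \<le> 1024 * (2 + b / \<delta>) * (2 + x)"
      using x by (intro mult_right_mono mult_mono) auto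
    finally have "log 2 (2 ^ w) \<le> log 2 (1024 * ((2 + b / \<delta>) * (2 + x)))"
      by (intro log_mono) (simp_all add: algebra_simps)
    also have "\<dots> = log 2 1024 + (log 2 (2 + b / \<delta>) + log 2 (2 + x))"
      using x add_pos_nonneg[of 2 "b / \<delta>"] by (simp add: log_mult)
    also have "log 2 1024 = (10 :: real)"
      using log_pow_cancel[of 2 10] by simp
    finally show ?thesis
      by (simp add: S_def lg_def)
  qed
  with S2 have wS: "w \<le> 6 * S"
    by linarith
  have "k \<le> 9696 * (t * S)"
  \<comment> \<open>If \<open>w\<close> exceeds \<open>k\<close>, the tree has no level, but then
    \<open>S\<close> alone is large enough, as \<open>t \<ge> 1\<close>. Otherwise
    \<open>d \<ge> 1\<close> makes the rounding in \<open>k div w\<close> cost a factor of 2, and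
    9696 = 2 * 808 * 6.\<close>
  proof (cases "w \<le> k")
    case False
    then have "real k \<le> 6 * S"
      using wS by simp
    also have "\<dots> \<le> 9696 * (1 * S)"
      using S2 by simp
    also have "\<dots> \<le> 9696 * (t * S)"
      using t1 S2 by (intro mult_left_mono mult_right_mono) auto
    finally show ?thesis .
  next
    case True
    define d where "d = k div w"
    have wd: "w * d \<le> k"
      by (simp add: d_def)
    have "2 ^ (w * d) \<le> (2 :: nat) ^ k"
      using wd by (intro power_increasing) auto
    then have n: "2 ^ (w * d) < n"
      using kn by linarith
    have dt: "d \<le> 808 * t"
      by (rule query_time_ge_depth[OF D n a(1,2,3) fit[OF wd] pos sel' sel(2) w1 w r(1) t tur])
    have "1 \<le> d"
      using True w1 by (simp add: d_def less_eq_div_iff_mult_less_eq)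
    then have "1 * w \<le> d * w"
      by (rule mult_le_mono1)
    moreover have "k < d * w + w"
      using w1 dividend_less_times_div[of w k] by (simp add: d_def mult.commute)
    ultimately have "k \<le> 2 * (d * w)"
      by linarith
    then have "real k \<le> real (2 * (d * w))"
      by (simp only: of_nat_le_iff)
    also have "\<dots> = 2 * (real d * real w)"
      by simp
    also have "\<dots> \<le> 2 * ((808 * t) * (6 * S))"
      using dt wS t1 by (intro mult_left_mono mult_mono) auto
    finally show ?thesis by simp
  qed
  with k have "min (K / 8) (1 / 8) * lg n \<le> 9696 * (t * S)"
    by linarith
  then show ?thesis
    by (simp add: S_def x_def)
qed

theorem theorem2p2:
  fixes K :: real
  assumes "K > 0"
  shows "\<exists>c > 0. \<exists>N. \<forall>n \<ge> N. \<forall>b \<delta> fmt Q A0 D t_u t_q t_s.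
    admissible K n b \<delta> fmt Q \<longrightarrow>
    partial_sums_structure n b \<delta> fmt Q A0 D \<longrightarrow>
    amortized_expected_times n b \<delta> fmt Q A0 D t_u t_q t_s \<longrightarrow>
      (SumQuery \<in> Q \<longrightarrow>
         t_q * (lg (real b / real \<delta>) + lg (t_u / t_q)) \<ge> c * lg (real n)) \<and>
      (SelectQuery \<in> Q \<longrightarrow>
         t_s * (lg (real b / real \<delta>) + lg (t_u / t_s)) \<ge> c * lg (real n))"
proof -
  define c where "c = min (K / 8) (1 / 8) / 9696"
  \<comment> \<open>Chosen so that \<open>lg n \<ge> 8 + 6 / K\<close>, which yields both
    \<open>lg n \<ge> 8\<close> and \<open>K * lg n \<ge> 6\<close>.\<close>
  define N where "N = nat \<lceil>2 powr (8 + 6 / K)\<rceil>"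
  have large: "8 \<le> lg n \<and> 6 \<le> K * lg n" if "N \<le> n" for n :: nat
  proof -
    have "2 powr (8 + 6 / K) \<le> 2 + real n"
      using that unfolding N_def by linarith
    then have "8 + 6 / K \<le> lg n"
      by (simp add: lg_def le_log_iff)
    moreover have "0 < 6 / K" "K * (8 + 6 / K) = K * 8 + 6"
      using assms by (simp_all add: field_simps)
    ultimately show ?thesis
      using assms mult_left_mono[of "8 + 6 / K" "lg n" K] by linarith
  qed
  have "c > 0"
    using assms by (simp add: c_def)
  moreover have "(SumQuery \<in> Q \<longrightarrow> c * lg n \<le> t_q * (lg (b / \<delta>) + lg (t_u / t_q))) \<and>
      (SelectQuery \<in> Q \<longrightarrow> c * lg n \<le> t_s * (lg (b / \<delta>) + lg (t_u / t_s)))"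
    if "N \<le> n" "admissible K n b \<delta> fmt Q" "partial_sums_structure n b \<delta> fmt Q A0 D"
      "amortized_expected_times n b \<delta> fmt Q A0 D t_u t_q t_s" for n b \<delta> fmt Q A0 D t_u t_q t_s
    using tradeoff[OF assms _ _ that(2,4,3), of False t_q] tradeoff[OF assms _ _ that(2,4,3), of True t_s]
      large[OF that(1)]
    by (simp add: c_def)
  ultimately show ?thesis
    by blast
qed

end
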